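(* Let $X$ and $Y$ be sequence classes such that $X$ is multilinearly stable, $Y$ is linearly stable, and $X(\mathbb{K})^n \hookrightarrow Y(\mathbb{K})$ for every $n \in \mathbb{N}$. Then $(\mathcal{L}_{X;Y}, \|\cdot\|_{X;Y})$ is a Banach hyper-ideal of multilinear operators.
   Context: All Banach spaces are over $\mathbb{K} = \mathbb{R}$ or $\mathbb{C}$. $\mathcal{L}(E_1,\ldots,E_n;F)$ is the Banach space of continuous $n$-linear operators $E_1\times\cdots\times E_n \to F$ with the usual sup norm. **Sequence class.** $E \hookrightarrow F$ means that the Banach space $E$ is a linear subspace of the Banach space $F$ and $\|x\|_F \le \|x\|_E$ for all $x\in E$. $c_{00}(E)$ is the space of eventually null $E$-valued sequences, $\ell_\infty(E)$ the Banach space of bounded $E$-valued sequences with the sup norm, and $e_j$ the $j$-th canonical scalar sequence. A sequence class is a rule $E\mapsto X(E)$ assigning to each Banach space $E$ a Banach space $X(E)$ of $E$-valued sequences (coordinatewise operations) such that $c_{00}(E)\subseteq X(E)$, $X(E)\hookrightarrow \ell_\infty(E)$ and $\|e_j\|_{X(\mathbb{K})}=1$ for every $j\in\mathbb{N}$. **Linearly stable.** $Y$ is linearly stable if for all Banach spaces $E,F$ and every $u\in\mathcal{L}(E;F)$, $(u(x_j))_{j=1}^\infty\in Y(F)$ whenever $(x_j)_{j=1}^\infty\in Y(E)$, and the induced linear operator $\widetilde u\colon Y(E)\to Y(F)$, $\widetilde u((x_j)_j)=(u(x_j))_j$, is continuous with $\|\widetilde u\|=\|u\|$. **Multilinearly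 stable.** $X$ is multilinearly stable if for all $n\in\mathbb{N}$, Banach spaces $E_1,\ldots,E_n,F$ and $A\in\mathcal{L}(E_1,\ldots,E_n;F)$, $(A(x_j^1,\ldots,x_j^n))_{j=1}^\infty\in X(F)$ whenever $(x_j^m)_{j=1}^\infty\in X(E_m)$, $m=1,\ldots,n$, and the induced $n$-linear operator $\widetilde A\colon X(E_1)\times\cdots\times X(E_n)\to X(F)$, $\widetilde A((x^1_j)_j,\ldots,(x^n_j)_j)=(A(x_j^1,\ldots,x_j^n))_j$, is continuous with $\|\widetilde A\|=\|A\|$. **Compatibility.** $X(\mathbb{K})^n\hookrightarrow Y(\mathbb{K})$ means: whenever $(\lambda_j^m)_{j=1}^\infty\in X(\mathbb{K})$, $m=1,\ldots,n$, one has $(\lambda_j^1\cdots\lambda_j^n)_{j=1}^\infty\in Y(\mathbb{K})$ and $\|(\lambda_j^1\cdots\lambda_j^n)_j\|_{Y(\mathbb{K})}\le\prod_{m=1}^n\|(\lambda_j^m)_j\|_{X(\mathbb{K})}$. **$(X;Y)$-summing operators.** $A\in\mathcal{L}(E_1,\ldots,E_n;F)$ belongs to $\mathcal{L}_{X;Y}(E_1,\ldots,E_n;F)$ if $(A(x_j^1,\ldots,x_j^n))_{j=1}^\infty\in Y(F)$ whenever $(x_j^m)_{j=1}^\infty\in X(E_m)$, $m=1,\ldots,n$. In this case the induced $n$-linear operator $\widetilde A\colon X(E_1)\times\cdots\times X(E_n)\to Y(F)$, $\widetilde A((x^1_j)_j,\ldots,(x^n_j)_j)=(A(x_j^1,\ldots,x_j^n))_j$,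 is automatically continuous (known), and $\|A\|_{X;Y}:=\|\widetilde A\|$. **Banach hyper-ideal of multilinear operators.** A pair $(\mathcal{H},\|\cdot\|_{\mathcal{H}})$, where $\mathcal{H}$ is a subclass of the class of continuous multilinear operators between Banach spaces and $\|\cdot\|_{\mathcal{H}}\colon\mathcal{H}\to\mathbb{R}$, such that for all $n$ and Banach spaces $E_1,\ldots,E_n,F$ the components $\mathcal{H}(E_1,\ldots,E_n;F):=\mathcal{L}(E_1,\ldots,E_n;F)\cap\mathcal{H}$ satisfy: (1) $\mathcal{H}(E_1,\ldots,E_n;F)$ is a linear subspace of $\mathcal{L}(E_1,\ldots,E_n;F)$ containing the operators of finite type (linear combinations of operators $(x_1,\ldots,x_n)\mapsto\varphi_1(x_1)\cdots\varphi_n(x_n)b$ with $\varphi_i\in E_i^*$, $b\in F$), on which $\|\cdot\|_{\mathcal{H}}$ is a complete norm, and the operator $I_n\colon\mathbb{K}^n\to\mathbb{K}$, $I_n(\lambda_1,\ldots,\lambda_n)=\lambda_1\cdots\lambda_n$, satisfies $\|I_n\|_{\mathcal{H}}=1$. (2) Hyper-ideal property: given $n\in\mathbb{N}$, natural numbers $1\le m_1<\cdots<m_n$, Banach spaces $G_1,\ldots,G_{m_n},E_1,\ldots,E_n,F,H$, if $A\in\mathcal{H}(E_1,\ldots,E_n;F)$, $B_1\in\mathcal{L}(G_1,\ldots,G_{m_1};E_1),\ldots,B_n\in\mathcal{L}(G_{m_{n-1}+1},\ldots,G_{m_n};E_n)$ and $t\in\mathcal{L}(F;H)$, then $t\circ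 A\circ(B_1,\ldots,B_n)\in\mathcal{H}(G_1,\ldots,G_{m_n};H)$ and $\|t\circ A\circ(B_1,\ldots,B_n)\|_{\mathcal{H}}\le\|t\|\cdot\|A\|_{\mathcal{H}}\cdot\|B_1\|\cdots\|B_n\|$. *)

theory Defs
  imports "HOL-Analysis.Analysis" "HOL-Algebra.Module"
begin

section \<open>Scalars and Banach spaces\<close>

text \<open>The scalar field is \<open>\<real>\<close> or \<open>\<complex>\<close>, up to an isometric field isomorphism.\<close>

class real_or_complex = real_normed_field +
  assumes real_or_complex:
    "(\<exists>f :: 'a \<Rightarrow> real. bij f \<and> (\<forall>x y. f (x + y) = f x + f y) \<and> (\<forall>x y. f (x * y) = f x * f y)
        \<and> (\<forall>x. norm (f x) = norm x))
     \<or> (\<exists>f :: 'a \<Rightarrow> complex. bij f \<and> (\<forall>x y. f (x + y) = f x + f y) \<and> (\<forall>x y. f (x * y) = f x * f y)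
        \<and> (\<forall>x. norm (f x) = norm x))"

instance real :: real_or_complex
  by standard (rule disjI1, rule exI[of _ id], simp)

instance complex :: real_or_complex
  by standard (rule disjI2, rule exI[of _ id], simp)

definition scalar_ring :: "'k::real_or_complex ring"
  where "scalar_ring = \<lparr>carrier = UNIV, mult = (*), one = 1, zero = 0, add = (+)\<rparr>"

text \<open>
  Since one cannot quantify over types, Banach spaces are modules (in the sense of \<open>HOL-Algebra\<close>) with
  explicit carrier inside a type \<open>'a\<close>, which serves as the universe. The inherited fields \<open>mult\<close>
  and \<open>one\<close> are irrelevant for modules.
\<close>

record ('k, 'a) nspace = "('k, 'a) module" +
  nrm :: "'a \<Rightarrow> real"

text \<open>The value outside the carrier is \<open>0\<close> because the locale \<open>Metric_space\<close> requires a distance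
  to be symmetric and nonnegative on the whole type.\<close>

definition nspace_dist :: "('k, 'a) nspace \<Rightarrow> 'a \<Rightarrow> 'a \<Rightarrow> real"
  where "nspace_dist E x y =
    (if x \<in> carrier E \<and> y \<in> carrier E then nrm E (x \<ominus>\<^bsub>E\<^esub> y) else 0)"

definition nspace_topology :: "('k, 'a) nspace \<Rightarrow> 'a topology"
  where "nspace_topology E = Metric_space.mtopology (carrier E) (nspace_dist E)"

definition normed_space :: "('k::real_or_complex, 'a) nspace \<Rightarrow> bool"
  where "normed_space E \<longleftrightarrow>
    Module.module scalar_ring E \<and>
    (\<forall>x\<in>carrier E. 0 \<le> nrm E x \<and> (nrm E x = 0 \<longleftrightarrow> x = \<zero>\<^bsub>E\<^esub>)) \<and>
    (\<forall>a. \<forall>x\<in>carrier E. nrm E (a \<odot>\<^bsub>E\<^esub> x) = norm a * nrm E x) \<and>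
    (\<forall>x\<in>carrier E. \<forall>y\<in>carrier E. nrm E (x \<oplus>\<^bsub>E\<^esub> y) \<le> nrm E x + nrm E y)"

definition banach_space :: "('k::real_or_complex, 'a) nspace \<Rightarrow> bool"
  where "banach_space E \<longleftrightarrow>
    normed_space E \<and> Metric_space.mcomplete (carrier E) (nspace_dist E)"

text \<open>The scalar field as a Banach space, copied into a universe \<open>'a\<close> along an injection \<open>\<iota>\<close>.\<close>

definition scalar_space :: "('k::real_or_complex \<Rightarrow> 'a) \<Rightarrow> ('k, 'a) nspace"
  where "scalar_space \<iota> =
    \<lparr>carrier = range \<iota>, mult = undefined, one = undefined, zero = \<iota> 0,
     add = (\<lambda>x y. \<iota> (inv_into UNIV \<iota> x + inv_into UNIV \<iota> y)), smult = (\<lambda>a x. \<iota> (a * inv_into UNIV \<iota> x)),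
     nrm = (\<lambda>x. norm (inv_into UNIV \<iota> x))\<rparr>"

text \<open>The relation \<open>E \<hookrightarrow> F\<close>.\<close>

definition embeds :: "('k, 'a) nspace \<Rightarrow> ('k, 'a) nspace \<Rightarrow> bool"
  where "embeds E F \<longleftrightarrow>
    carrier E \<subseteq> carrier F \<and>
    (\<forall>x\<in>carrier E. \<forall>y\<in>carrier E. x \<oplus>\<^bsub>E\<^esub> y = x \<oplus>\<^bsub>F\<^esub> y) \<and>
    (\<forall>a. \<forall>x\<in>carrier E. a \<odot>\<^bsub>E\<^esub> x = a \<odot>\<^bsub>F\<^esub> x) \<and>
    (\<forall>x\<in>carrier E. nrm F x \<le> nrm E x)"


section \<open>Continuous linear and multilinear operators\<close>

text \<open>A linear operator is identified by its values on the carrier; values elsewhere are irrelevant.\<close>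

definition linear_ops :: "('k::real_or_complex, 'a) nspace \<Rightarrow> ('k, 'b) nspace \<Rightarrow> ('a \<Rightarrow> 'b) set"
  where "linear_ops E F =
    {u. (\<forall>x\<in>carrier E. \<forall>y\<in>carrier E. u (x \<oplus>\<^bsub>E\<^esub> y) = u x \<oplus>\<^bsub>F\<^esub> u y) \<and>
        (\<forall>a. \<forall>x\<in>carrier E. u (a \<odot>\<^bsub>E\<^esub> x) = a \<odot>\<^bsub>F\<^esub> u x) \<and>
        continuous_map (nspace_topology E) (nspace_topology F) u}"

definition linear_norm :: "('k, 'a) nspace \<Rightarrow> ('k, 'b) nspace \<Rightarrow> ('a \<Rightarrow> 'b) \<Rightarrow> real"
  where "linear_norm E F u = (SUP x\<in>{x \<in> carrier E. nrm E x \<le> 1}. nrm F (u x))"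

text \<open>
  The domain \<open>E\<^sub>1 \<times> \<dots> \<times> E\<^sub>n\<close> is given by the list \<open>Es\<close> of its factors (numbered from \<open>0\<close>);
  its elements are extensional functions on \<open>{..<n}\<close>.
\<close>

definition prod_carrier :: "('k, 'a) nspace list \<Rightarrow> (nat \<Rightarrow> 'a) set"
  where "prod_carrier Es = (\<Pi>\<^sub>E i\<in>{..<length Es}. carrier (Es ! i))"

definition multilinear :: "('k::real_or_complex, 'a) nspace list \<Rightarrow> ('k, 'b) nspace \<Rightarrow> ((nat \<Rightarrow> 'a) \<Rightarrow> 'b) \<Rightarrow> bool"
  where "multilinear Es F A \<longleftrightarrow>
    (\<forall>i<length Es. \<forall>x\<in>prod_carrier Es. \<forall>u\<in>carrier (Es ! i).
      (\<forall>v\<in>carrier (Es ! i). A (x(i := u \<oplus>\<^bsub>Es ! i\<^esub> v)) = A (x(i := u)) \<oplus>\<^bsub>F\<^esub> A (x(i := v))) \<and>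
      (\<forall>a. A (x(i := a \<odot>\<^bsub>Es ! i\<^esub> u)) = a \<odot>\<^bsub>F\<^esub> A (x(i := u))))"

definition continuous_multilinear ::
  "('k::real_or_complex, 'a) nspace list \<Rightarrow> ('k, 'b) nspace \<Rightarrow> ((nat \<Rightarrow> 'a) \<Rightarrow> 'b) \<Rightarrow> bool"
  where "continuous_multilinear Es F A \<longleftrightarrow>
    multilinear Es F A \<and>
    continuous_map (product_topology (\<lambda>i. nspace_topology (Es ! i)) {..<length Es}) (nspace_topology F) A"

definition multilinear_norm ::
  "('k, 'a) nspace list \<Rightarrow> ('k, 'b) nspace \<Rightarrow> ((nat \<Rightarrow> 'a) \<Rightarrow> 'b) \<Rightarrow> real"
  where "multilinear_norm Es F A =
    (SUP x\<in>{x \<in> prod_carrier Es. \<forall>i<length Es. nrm (Es ! i) (x i) \<le> 1}. nrm F (A x))"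

text \<open>The normed space \<open>\<L>(E\<^sub>1, \<dots>, E\<^sub>n; F)\<close>; its elements are extensional, so that operators are equal
  iff they agree on the domain.\<close>

definition multilinear_space ::
  "('k::real_or_complex, 'a) nspace list \<Rightarrow> ('k, 'b) nspace \<Rightarrow> ('k, (nat \<Rightarrow> 'a) \<Rightarrow> 'b) nspace"
  where "multilinear_space Es F =
    \<lparr>carrier = {A \<in> extensional (prod_carrier Es). continuous_multilinear Es F A},
     mult = undefined, one = undefined,
     zero = (\<lambda>x\<in>prod_carrier Es. \<zero>\<^bsub>F\<^esub>),
     add = (\<lambda>A B. \<lambda>x\<in>prod_carrier Es. A x \<oplus>\<^bsub>F\<^esub> B x),
     smult = (\<lambda>a A. \<lambda>x\<in>prod_carrier Es. a \<odot>\<^bsub>F\<^esub> A x),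
     nrm = multilinear_norm Es F\<rparr>"

abbreviation multilinear_ops ::
  "('k::real_or_complex, 'a) nspace list \<Rightarrow> ('k, 'b) nspace \<Rightarrow> ((nat \<Rightarrow> 'a) \<Rightarrow> 'b) set"
  where "multilinear_ops Es F \<equiv> carrier (multilinear_space Es F)"


section \<open>Sequence classes\<close>

definition c00 :: "('k, 'a) nspace \<Rightarrow> (nat \<Rightarrow> 'a) set"
  where "c00 E = {s. (\<forall>j. s j \<in> carrier E) \<and> (\<exists>N. \<forall>j\<ge>N. s j = \<zero>\<^bsub>E\<^esub>)}"

definition linfty :: "('k, 'a) nspace \<Rightarrow> ('k, nat \<Rightarrow> 'a) nspace"
  where "linfty E =
    \<lparr>carrier = {s. (\<forall>j. s j \<in> carrier E) \<and> bdd_above (range (\<lambda>j. nrm E (s j)))},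
     mult = undefined, one = undefined,
     zero = (\<lambda>j. \<zero>\<^bsub>E\<^esub>),
     add = (\<lambda>s t j. s j \<oplus>\<^bsub>E\<^esub> t j),
     smult = (\<lambda>a s j. a \<odot>\<^bsub>E\<^esub> s j),
     nrm = (\<lambda>s. SUP j. nrm E (s j))\<rparr>"

text \<open>
  A rule \<open>X\<close> assigns a space of sequences to each Banach space with carrier in the universe \<open>'a\<close>.
  That the operations of \<open>X E\<close> are coordinatewise is part of \<open>embeds (X E) (linfty E)\<close>.
\<close>

type_synonym ('k, 'a) seq_rule = "('k, 'a) nspace \<Rightarrow> ('k, nat \<Rightarrow> 'a) nspace"

definition sequence_class :: "('k::real_or_complex \<Rightarrow> 'a) \<Rightarrow> ('k, 'a) seq_rule \<Rightarrow> bool"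
  where "sequence_class \<iota> X \<longleftrightarrow>
    (\<forall>E. banach_space E \<longrightarrow>
      banach_space (X E) \<and> c00 E \<subseteq> carrier (X E) \<and> embeds (X E) (linfty E)) \<and>
    (\<forall>j. nrm (X (scalar_space \<iota>)) (\<lambda>i. \<iota> (if i = j then 1 else 0)) = 1)"

definition linearly_stable :: "('k::real_or_complex, 'a) seq_rule \<Rightarrow> bool"
  where "linearly_stable Y \<longleftrightarrow>
    (\<forall>E F u. banach_space E \<and> banach_space F \<and> u \<in> linear_ops E F \<longrightarrow>
      (\<forall>s\<in>carrier (Y E). (\<lambda>j. u (s j)) \<in> carrier (Y F)) \<and>
      (\<lambda>s j. u (s j)) \<in> linear_ops (Y E) (Y F) \<and>
      linear_norm (Y E) (Y F) (\<lambda>s j. u (s j)) = linear_norm E F u)"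

text \<open>The operator induced by an \<open>n\<close>-linear operator on \<open>n\<close>-tuples of sequences; \<open>s m j\<close> is the
  \<open>j\<close>-th term of the \<open>m\<close>-th sequence.\<close>

definition induced :: "nat \<Rightarrow> ((nat \<Rightarrow> 'a) \<Rightarrow> 'b) \<Rightarrow> (nat \<Rightarrow> nat \<Rightarrow> 'a) \<Rightarrow> nat \<Rightarrow> 'b"
  where "induced n A = (\<lambda>s j. A (\<lambda>m\<in>{..<n}. s m j))"

definition multilinearly_stable :: "('k::real_or_complex, 'a) seq_rule \<Rightarrow> bool"
  where "multilinearly_stable X \<longleftrightarrow>
    (\<forall>Es F A. Es \<noteq> [] \<and> (\<forall>E\<in>set Es. banach_space E) \<and> banach_space F \<and> A \<in> multilinear_ops Es F \<longrightarrow>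
      (\<forall>s\<in>prod_carrier (map X Es). induced (length Es) A s \<in> carrier (X F)) \<and>
      continuous_multilinear (map X Es) (X F) (induced (length Es) A) \<and>
      multilinear_norm (map X Es) (X F) (induced (length Es) A) = multilinear_norm Es F A)"

text \<open>The relation \<open>X(\<bbbK>)\<^sup>n \<hookrightarrow> Y(\<bbbK>)\<close>.\<close>

definition power_embeds ::
  "('k::real_or_complex \<Rightarrow> 'a) \<Rightarrow> nat \<Rightarrow> ('k, 'a) seq_rule \<Rightarrow> ('k, 'a) seq_rule \<Rightarrow> bool"
  where "power_embeds \<iota> n X Y \<longleftrightarrow>
    (\<forall>l :: nat \<Rightarrow> nat \<Rightarrow> 'k. (\<forall>m<n. (\<lambda>j. \<iota> (l m j)) \<in> carrier (X (scalar_space \<iota>))) \<longrightarrow>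
      (\<lambda>j. \<iota> (\<Prod>m<n. l m j)) \<in> carrier (Y (scalar_space \<iota>)) \<and>
      nrm (Y (scalar_space \<iota>)) (\<lambda>j. \<iota> (\<Prod>m<n. l m j))
        \<le> (\<Prod>m<n. nrm (X (scalar_space \<iota>)) (\<lambda>j. \<iota> (l m j))))"


section \<open>Summing operators and hyper-ideals\<close>

text \<open>
  A class of multilinear operators with a real-valued function on it is given by its components: to
  the list of factors of the domain and the codomain they assign a set of operators and a function.
\<close>

type_synonym ('k, 'a) op_class =
  "('k, 'a) nspace list \<Rightarrow> ('k, 'a) nspace \<Rightarrow> ((nat \<Rightarrow> 'a) \<Rightarrow> 'a) set"

type_synonym ('k, 'a) op_class_norm =
  "('k, 'a) nspace list \<Rightarrow> ('k, 'a) nspace \<Rightarrow> ((nat \<Rightarrow> 'a) \<Rightarrow> 'a) \<Rightarrow> real"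

definition summing_ops ::
  "('k::real_or_complex, 'a) seq_rule \<Rightarrow> ('k, 'a) seq_rule \<Rightarrow> ('k, 'a) op_class"
  where "summing_ops X Y Es F =
    {A \<in> multilinear_ops Es F.
      \<forall>s\<in>prod_carrier (map X Es). induced (length Es) A s \<in> carrier (Y F)}"

definition summing_norm ::
  "('k::real_or_complex, 'a) seq_rule \<Rightarrow> ('k, 'a) seq_rule \<Rightarrow> ('k, 'a) op_class_norm"
  where "summing_norm X Y Es F A = multilinear_norm (map X Es) (Y F) (induced (length Es) A)"

text \<open>Functionals take their values in \<open>scalar_space id\<close>, i.e. in the type \<open>'k\<close> itself.\<close>

definition finite_type_ops ::
  "('k::real_or_complex, 'a) nspace list \<Rightarrow> ('k, 'b) nspace \<Rightarrow> ((nat \<Rightarrow> 'a) \<Rightarrow> 'b) set"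
  where "finite_type_ops Es F =
    {A. \<exists>(N::nat) c \<phi> b.
      (\<forall>k<N. \<forall>i<length Es. \<phi> k i \<in> linear_ops (Es ! i) (scalar_space id)) \<and>
      (\<forall>k<N. b k \<in> carrier F) \<and>
      A = (\<lambda>x\<in>prod_carrier Es.
            \<Oplus>\<^bsub>F\<^esub>k\<in>{..<N}. c k \<odot>\<^bsub>F\<^esub> ((\<Prod>i<length Es. \<phi> k i (x i)) \<odot>\<^bsub>F\<^esub> b k))}"

definition scalar_mult_op :: "('k::real_or_complex \<Rightarrow> 'a) \<Rightarrow> nat \<Rightarrow> (nat \<Rightarrow> 'a) \<Rightarrow> 'a"
  where "scalar_mult_op \<iota> n =
    (\<lambda>x\<in>prod_carrier (replicate n (scalar_space \<iota>)). \<iota> (\<Prod>i<n. inv_into UNIV \<iota> (x i)))"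

text \<open>
  \<open>t \<circ> A \<circ> (B\<^sub>1, \<dots>, B\<^sub>n)\<close>, where the \<open>i\<close>-th block (counted from \<open>0\<close>) of the variables consists
  of those with index in \<open>{m i..<m (i + 1)}\<close>.
\<close>

definition compose_blocks ::
  "(nat \<Rightarrow> nat) \<Rightarrow> nat \<Rightarrow> ('k, 'a) nspace list \<Rightarrow> ('c \<Rightarrow> 'd) \<Rightarrow> ((nat \<Rightarrow> 'b) \<Rightarrow> 'c)
    \<Rightarrow> (nat \<Rightarrow> (nat \<Rightarrow> 'a) \<Rightarrow> 'b) \<Rightarrow> (nat \<Rightarrow> 'a) \<Rightarrow> 'd"
  where "compose_blocks m n Gs t A B =
    (\<lambda>x\<in>prod_carrier Gs.
      t (A (\<lambda>i\<in>{..<n}. B i (\<lambda>j\<in>{..<m (Suc i) - m i}. x (m i + j)))))"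

definition banach_hyper_ideal ::
  "('k::real_or_complex \<Rightarrow> 'a) \<Rightarrow> ('k, 'a) op_class \<Rightarrow> ('k, 'a) op_class_norm \<Rightarrow> bool"
  where "banach_hyper_ideal \<iota> \<H> \<nu> \<longleftrightarrow>
    (\<forall>Es F. Es \<noteq> [] \<and> (\<forall>E\<in>set Es. banach_space E) \<and> banach_space F \<longrightarrow>
      submodule (\<H> Es F) scalar_ring (multilinear_space Es F) \<and>
      finite_type_ops Es F \<subseteq> \<H> Es F \<and>
      banach_space ((multilinear_space Es F)\<lparr>carrier := \<H> Es F, nrm := \<nu> Es F\<rparr>)) \<and>
    (\<forall>n\<ge>1. \<nu> (replicate n (scalar_space \<iota>)) (scalar_space \<iota>) (scalar_mult_op \<iota> n) = 1) \<and>
    (\<forall>n\<ge>1. \<forall>m Gs Es F H A B t.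
      m 0 = 0 \<and> (\<forall>i<n. m i < m (Suc i)) \<and> length Gs = m n \<and> length Es = n \<and>
      (\<forall>G\<in>set Gs. banach_space G) \<and> (\<forall>E\<in>set Es. banach_space E) \<and>
      banach_space F \<and> banach_space H \<and>
      A \<in> \<H> Es F \<and>
      (\<forall>i<n. B i \<in> multilinear_ops (map ((!) Gs) [m i..<m (Suc i)]) (Es ! i)) \<and>
      t \<in> linear_ops F H \<longrightarrow>
      compose_blocks m n Gs t A B \<in> \<H> Gs H \<and>
      \<nu> Gs H (compose_blocks m n Gs t A B)
        \<le> linear_norm F H t * \<nu> Es F A
          * (\<Prod>i<n. multilinear_norm (map ((!) Gs) [m i..<m (Suc i)]) (Es ! i) (B i)))"

end

theory Submission
  imports Defs
begin

text \<open>
  Everything is read off the induced operators \<open>A\<^sup>~ : X(E\<^sub>1) \<times> \<dots> \<times> X(E\<^sub>n) \<rightarrow> Y(F)\<close>. Coordinates are continuous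
  on \<open>X(E)\<close> and \<open>Y(F)\<close>, so \<open>A\<^sup>~\<close> has a closed graph in each variable; Baire's theorem, applied to one
  variable after the other, makes it bounded. Multilinear stability of \<open>X\<close>, applied to \<open>\<lambda> \<mapsto> \<lambda>x\<close>, gives
  \<open>\<parallel>(x, 0, 0, \<dots>)\<parallel> \<le> \<parallel>x\<parallel>\<close> in \<open>X(E)\<close>, hence \<open>\<parallel>A\<parallel> \<le> \<parallel>A\<^sup>~\<parallel>\<close>, and a Cauchy sequence for the summing norm has
  a pointwise limit whose induced operator is the limit of the induced operators. For an operator of
  finite type, stability of \<open>X\<close> under the functionals, \<open>X(\<bbbK>)\<^sup>n \<hookrightarrow> Y(\<bbbK>)\<close> and stability of \<open>Y\<close> under
  \<open>\<lambda> \<mapsto> \<lambda>b\<close> are combined. Finally, \<open>t \<circ> A \<circ> (B\<^sub>1, \<dots>, B\<^sub>n)\<close> induces the composition of the operators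
  induced by \<open>t\<close>, \<open>A\<close> and the \<open>B\<^sub>i\<close>.
\<close>


section \<open>Normed modules over the scalar field\<close>

text \<open>Operator norms are suprema of reals, which carry no information for an unbounded set, so
  boundedness of each induced operator has to precede every estimate. The obstacle is the product
  domain: a closed graph gives boundedness in each variable separately, and the passage to a joint
  bound needs bounds that are uniform in the remaining variables. The uniform boundedness principle
  is therefore proved for families whose members are only known to have closed graphs; this contains
  the linear closed graph theorem, and it is what the induction over the variables consumes. The
  scalar field occurs in two copies. Functionals take values in \<open>scalar_space id\<close>,
  whereas \<open>X\<close> and \<open>Y\<close> act on spaces inside the universe \<open>'a\<close>,
  where the field is \<open>scalar_space \<iota>\<close>; the injection \<open>\<iota>\<close>
  carries one copy isometrically onto the other. Single vectors are placed in coordinate 0 because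
  \<open>e_0\<close> has norm exactly 1 in \<open>X(K)\<close>.\<close>

lemma scalar_ring_simps [simp]:
  "carrier scalar_ring = UNIV" "a \<otimes>\<^bsub>scalar_ring\<^esub> b = a * b" "\<one>\<^bsub>scalar_ring\<^esub> = 1"
  "\<zero>\<^bsub>scalar_ring\<^esub> = 0" "a \<oplus>\<^bsub>scalar_ring\<^esub> b = a + b"
  by (simp_all add: scalar_ring_def)

lemma cring_scalar_ring: "cring (scalar_ring :: 'k::real_or_complex ring)"
proof (rule cringI)
  show "abelian_group (scalar_ring :: 'k ring)"
  proof (rule abelian_groupI)
    fix x :: 'k
    have "- x \<oplus>\<^bsub>scalar_ring\<^esub> x = \<zero>\<^bsub>scalar_ring\<^esub>" by simp
    then show "\<exists>y\<in>carrier scalar_ring. y \<oplus>\<^bsub>scalar_ring\<^esub> x = \<zero>\<^bsub>scalar_ring\<^esub>"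
      by (intro bexI[of _ "- x"]) simp_all
  qed (simp_all add: algebra_simps)
  show "Group.comm_monoid (scalar_ring :: 'k ring)"
    by (rule Group.comm_monoidI) (auto simp: algebra_simps)
qed (auto simp: algebra_simps)

lemma scalar_ring_uminus [simp]: "\<ominus>\<^bsub>scalar_ring\<^esub> a = - a"
proof -
  interpret cring scalar_ring by (rule cring_scalar_ring)
  show ?thesis by (rule minus_equality) auto
qed

text \<open>Since \<open>- 1\<close> is a scalar, \<open>0 \<odot> x = \<zero>\<close> replaces the existence of additive inverses.\<close>

lemma scalar_module_intro:
  fixes M :: "('k::real_or_complex, 'a, 'z) module_scheme" (structure)
  assumes "\<And>x y. x \<in> carrier M \<Longrightarrow> y \<in> carrier M \<Longrightarrow> x \<oplus> y \<in> carrier M"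
    and "\<zero> \<in> carrier M"
    and "\<And>x y z. x \<in> carrier M \<Longrightarrow> y \<in> carrier M \<Longrightarrow> z \<in> carrier M \<Longrightarrow> (x \<oplus> y) \<oplus> z = x \<oplus> (y \<oplus> z)"
    and "\<And>x y. x \<in> carrier M \<Longrightarrow> y \<in> carrier M \<Longrightarrow> x \<oplus> y = y \<oplus> x"
    and "\<And>x. x \<in> carrier M \<Longrightarrow> \<zero> \<oplus> x = x"
    and "\<And>a x. x \<in> carrier M \<Longrightarrow> a \<odot> x \<in> carrier M"
    and "\<And>x. x \<in> carrier M \<Longrightarrow> 0 \<odot> x = \<zero>"
    and "\<And>a b x. x \<in> carrier M \<Longrightarrow> (a + b) \<odot> x = a \<odot> x \<oplus> b \<odot> x"
    and "\<And>a x y. x \<in> carrier M \<Longrightarrow> y \<in> carrier M \<Longrightarrow> a \<odot> (x \<oplus> y) = a \<odot> x \<oplus> a \<odot> y"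
    and "\<And>a b x. x \<in> carrier M \<Longrightarrow> (a * b) \<odot> x = a \<odot> (b \<odot> x)"
    and "\<And>x. x \<in> carrier M \<Longrightarrow> 1 \<odot> x = x"
  shows "Module.module scalar_ring M"
proof (rule Module.moduleI)
  show "abelian_group M"
  proof (rule abelian_groupI)
    fix x assume x: "x \<in> carrier M"
    have "(- 1) \<odot> x \<oplus> x = (- 1) \<odot> x \<oplus> 1 \<odot> x" using assms x by simp
    also have "\<dots> = (- 1 + 1) \<odot> x" using assms x by metis
    finally have "(- 1) \<odot> x \<oplus> x = \<zero>" using assms x by simp
    then show "\<exists>y\<in>carrier M. y \<oplus> x = \<zero>" using assms x by blast
  qed (use assms in auto)
qed (use assms cring_scalar_ring in auto)

locale nspace_on =
  fixes E :: "('k::real_or_complex, 'a) nspace" (structure)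
  assumes normed: "normed_space E"

sublocale nspace_on \<subseteq> Module.module scalar_ring E
  using normed by (simp add: normed_space_def)

context nspace_on
begin

lemma nrm_nonneg [simp]: "x \<in> carrier E \<Longrightarrow> 0 \<le> nrm E x"
  and nrm_eq_0_iff: "x \<in> carrier E \<Longrightarrow> nrm E x = 0 \<longleftrightarrow> x = \<zero>"
  and nrm_smult: "x \<in> carrier E \<Longrightarrow> nrm E (a \<odot> x) = norm a * nrm E x"
  and nrm_triangle: "x \<in> carrier E \<Longrightarrow> y \<in> carrier E \<Longrightarrow> nrm E (x \<oplus> y) \<le> nrm E x + nrm E y"
  using normed by (simp_all add: normed_space_def)

lemma smult_1 [simp]: "x \<in> carrier E \<Longrightarrow> 1 \<odot> x = x"
  and smult_0 [simp]: "x \<in> carrier E \<Longrightarrow> 0 \<odot> x = \<zero>"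
  and smult_assoc: "x \<in> carrier E \<Longrightarrow> (a * b) \<odot> x = a \<odot> (b \<odot> x)"
  and smult_add_left: "x \<in> carrier E \<Longrightarrow> (a + b) \<odot> x = a \<odot> x \<oplus> b \<odot> x"
  using smult_one[of x] smult_l_null[of x] smult_assoc1[of a b x] smult_l_distr[of a b x]
  by simp_all

lemma nrm_zero [simp]: "nrm E \<zero> = 0"
  by (simp add: nrm_eq_0_iff)

lemma uminus_eq_smult: "x \<in> carrier E \<Longrightarrow> \<ominus> x = (- 1) \<odot> x"
  using smult_l_minus[of 1 x] by simp

lemma minus_eq_add_smult: "x \<in> carrier E \<Longrightarrow> y \<in> carrier E \<Longrightarrow> x \<ominus> y = x \<oplus> (- 1) \<odot> y"
  by (simp add: minus_eq uminus_eq_smult)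

lemma minus_closed' [simp, intro]: "x \<in> carrier E \<Longrightarrow> y \<in> carrier E \<Longrightarrow> x \<ominus> y \<in> carrier E"
  by (rule M.minus_closed)

lemma nrm_minus_commute: "x \<in> carrier E \<Longrightarrow> y \<in> carrier E \<Longrightarrow> nrm E (x \<ominus> y) = nrm E (y \<ominus> x)"
proof -
  assume x: "x \<in> carrier E" "y \<in> carrier E"
  have "y \<ominus> x = \<ominus> (x \<ominus> y)" using x by (simp add: minus_eq M.minus_add M.minus_minus M.a_comm)
  then have "y \<ominus> x = (- 1) \<odot> (x \<ominus> y)" using x by (simp add: uminus_eq_smult)
  then show ?thesis using x by (simp add: nrm_smult)
qed

lemma minus_add_minus: "x \<in> carrier E \<Longrightarrow> y \<in> carrier E \<Longrightarrow> z \<in> carrier E \<Longrightarrow> (x \<ominus> y) \<oplus> (y \<ominus> z) = x \<ominus> z"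
  by (metis M.a_assoc M.l_neg M.l_zero M.minus_closed M.minus_eq M.a_inv_closed)

lemma add_minus_cancel: "x \<in> carrier E \<Longrightarrow> y \<in> carrier E \<Longrightarrow> y \<oplus> (x \<ominus> y) = x"
  by (metis M.a_assoc M.a_comm M.minus_closed M.minus_eq M.a_inv_closed M.l_neg M.r_zero)

lemma minus_eq_zero_iff: "x \<in> carrier E \<Longrightarrow> y \<in> carrier E \<Longrightarrow> x \<ominus> y = \<zero> \<longleftrightarrow> x = y"
  by (metis M.add.inv_solve_right M.l_zero M.minus_eq M.zero_closed)

lemma nrm_minus_triangle:
  "x \<in> carrier E \<Longrightarrow> y \<in> carrier E \<Longrightarrow> z \<in> carrier E \<Longrightarrow> nrm E (x \<ominus> z) \<le> nrm E (x \<ominus> y) + nrm E (y \<ominus> z)"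
  by (metis minus_add_minus nrm_triangle M.minus_closed)

lemma nrm_le_add_minus:
  "x \<in> carrier E \<Longrightarrow> y \<in> carrier E \<Longrightarrow> nrm E x \<le> nrm E y + nrm E (x \<ominus> y)"
  by (metis add_minus_cancel nrm_triangle M.minus_closed)

lemma nrm_minus_le: "x \<in> carrier E \<Longrightarrow> y \<in> carrier E \<Longrightarrow> nrm E (x \<ominus> y) \<le> nrm E x + nrm E y"
  using nrm_triangle[of x "(- 1) \<odot> y"] by (simp add: minus_eq_add_smult nrm_smult)

lemma minus_add_distrib:
  assumes "x \<in> carrier E" "y \<in> carrier E" "z \<in> carrier E" "w \<in> carrier E"
  shows "(x \<oplus> y) \<ominus> (z \<oplus> w) = (x \<ominus> z) \<oplus> (y \<ominus> w)"
  using assms by (simp add: minus_eq M.minus_add M.a_ac)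

lemma add_minus_cancel_left: "x \<in> carrier E \<Longrightarrow> y \<in> carrier E \<Longrightarrow> x \<oplus> y \<ominus> x = y"
  by (simp add: M.a_comm[of x y] minus_eq M.a_assoc M.r_neg)

text \<open>For the Baire argument: if \<open>x\<close> is close to \<open>c \<oplus> z\<close> and
  \<open>y\<close> is close to \<open>c\<close>, then \<open>x \<ominus> y\<close> is close to
  \<open>z\<close>, the two errors being subtracted.\<close>

lemma minus_minus_eq:
  assumes "c \<in> carrier E" "z \<in> carrier E" "x \<in> carrier E" "y \<in> carrier E"
  shows "(c \<oplus> z \<ominus> x) \<ominus> (c \<ominus> y) = z \<ominus> (x \<ominus> y)"
proof -
  have "(c \<oplus> z \<ominus> x) \<ominus> (c \<ominus> y) = (c \<oplus> (z \<ominus> x)) \<ominus> (c \<oplus> \<ominus> y)"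
    using assms by (simp add: minus_eq M.a_assoc)
  also have "\<dots> = (c \<ominus> c) \<oplus> (z \<ominus> x \<ominus> \<ominus> y)"
    using assms by (intro minus_add_distrib) auto
  also have "\<dots> = z \<ominus> (x \<ominus> y)"
    using assms by (simp add: minus_eq M.r_neg M.minus_add M.minus_minus M.a_ac)
  finally show ?thesis .
qed

lemma smult_minus_distrib:
  "x \<in> carrier E \<Longrightarrow> y \<in> carrier E \<Longrightarrow> a \<odot> (x \<ominus> y) = a \<odot> x \<ominus> a \<odot> y"
  by (simp add: minus_eq smult_r_distr smult_r_minus)

section \<open>Metric and convergence of sequences\<close>

sublocale Metric_space "carrier E" "nspace_dist E"
proof
  show "nspace_dist E x y = nspace_dist E y x" for x y
    by (auto simp: nspace_dist_def nrm_minus_commute)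
  show "nspace_dist E x y = 0 \<longleftrightarrow> x = y" if "x \<in> carrier E" "y \<in> carrier E" for x y
    using that by (auto simp: nspace_dist_def nrm_eq_0_iff minus_eq_zero_iff)
qed (auto simp: nspace_dist_def nrm_minus_triangle)

lemma nspace_topology_eq: "nspace_topology E = mtopology"
  by (simp add: nspace_topology_def)

lemma topspace_nspace_topology [simp]: "topspace (nspace_topology E) = carrier E"
  by (simp add: nspace_topology_def)

text \<open>Convergence is reduced to a real null sequence, to which the limit rules for reals
  apply; membership of the terms and of the limit is built in. \<open>limitin_iff_tends\<close>
  identifies it with convergence in \<open>mtopology\<close>.\<close>

definition tends :: "(nat \<Rightarrow> 'a) \<Rightarrow> 'a \<Rightarrow> bool"
  where "tends p l \<longleftrightarrow> (\<forall>i. p i \<in> carrier E) \<and> l \<in> carrier E \<and> (\<lambda>i. nrm E (p i \<ominus> l)) \<longlonglongrightarrow> 0"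

lemma tends_unique:
  assumes "tends p l" "tends p l'"
  shows "l = l'"
proof -
  have c: "\<And>i. p i \<in> carrier E" "l \<in> carrier E" "l' \<in> carrier E"
    using assms by (auto simp: tends_def)
  have "(\<lambda>i. nrm E (p i \<ominus> l) + nrm E (p i \<ominus> l')) \<longlonglongrightarrow> 0 + 0"
    using assms by (intro tendsto_add) (auto simp: tends_def)
  moreover have "nrm E (l \<ominus> l') \<le> nrm E (p i \<ominus> l) + nrm E (p i \<ominus> l')" for i
    using nrm_minus_triangle[of l "p i" l'] c by (simp add: nrm_minus_commute)
  ultimately have "nrm E (l \<ominus> l') \<le> 0 + 0"
    by (intro LIMSEQ_le_const[of _ "0 + 0"]) auto
  then have "nrm E (l \<ominus> l') = 0" using c nrm_nonneg[of "l \<ominus> l'"] by (simp add: order.antisym)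
  then show ?thesis using c by (simp add: nrm_eq_0_iff minus_eq_zero_iff)
qed

lemma tends_I:
  assumes "\<And>i. p i \<in> carrier E" "l \<in> carrier E"
    and "\<And>i. nrm E (p i \<ominus> l) \<le> b i" and "b \<longlonglongrightarrow> 0"
  shows "tends p l"
proof -
  have "(\<lambda>i. nrm E (p i \<ominus> l)) \<longlonglongrightarrow> 0"
    by (rule tendsto_sandwich[of "\<lambda>_. 0" _ _ b]) (use assms in auto)
  then show ?thesis using assms by (simp add: tends_def)
qed

lemma tends_add:
  assumes "tends p l" "tends q m"
  shows "tends (\<lambda>i. p i \<oplus> q i) (l \<oplus> m)"
proof (rule tends_I[where b = "\<lambda>i. nrm E (p i \<ominus> l) + nrm E (q i \<ominus> m)"])
  show "(\<lambda>i. nrm E (p i \<ominus> l) + nrm E (q i \<ominus> m)) \<longlonglongrightarrow> 0"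
    using tendsto_add[of "\<lambda>i. nrm E (p i \<ominus> l)" 0 _ "\<lambda>i. nrm E (q i \<ominus> m)" 0] assms by (simp add: tends_def)
qed (use assms in \<open>auto simp: tends_def minus_add_distrib intro!: nrm_triangle\<close>)

lemma tends_smult:
  assumes "tends p l"
  shows "tends (\<lambda>i. a \<odot> p i) (a \<odot> l)"
proof (rule tends_I[where b = "\<lambda>i. norm a * nrm E (p i \<ominus> l)"])
  show "(\<lambda>i. norm a * nrm E (p i \<ominus> l)) \<longlonglongrightarrow> 0"
    using tendsto_mult_left[of "\<lambda>i. nrm E (p i \<ominus> l)" 0 _ "norm a"] assms by (simp add: tends_def)
qed (use assms in \<open>auto simp: tends_def smult_minus_distrib[symmetric] nrm_smult\<close>)

text \<open>By the reverse triangle inequality the distance to \<open>c\<close> is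
  1-Lipschitz.\<close>

lemma tends_nrm_minus:
  assumes "tends p l" "c \<in> carrier E"
  shows "(\<lambda>i. nrm E (c \<ominus> p i)) \<longlonglongrightarrow> nrm E (c \<ominus> l)"
proof -
  have c: "\<And>i. p i \<in> carrier E" "l \<in> carrier E" and lim: "(\<lambda>i. nrm E (p i \<ominus> l)) \<longlonglongrightarrow> 0"
    using assms by (auto simp: tends_def)
  have "norm (nrm E (c \<ominus> p i) - nrm E (c \<ominus> l)) \<le> nrm E (p i \<ominus> l)" for i
    using nrm_minus_triangle[of c "p i" l] nrm_minus_triangle[of c l "p i"] c assms(2)
    by (simp add: nrm_minus_commute[of l "p i"])
  then show ?thesis
    by (intro Lim_transform_bound[OF _ lim, THEN LIM_zero_cancel])
      (auto intro!: always_eventually intro: order_trans[OF _ abs_ge_self])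
qed

text \<open>Carries Cauchy estimates over to the limit; the completeness proof needs it for values
  in \<open>F\<close> and for sequences in \<open>Y F\<close>.\<close>

lemma tends_nrm_minus_le:
  assumes "tends p l" "c \<in> carrier E" and "\<And>i. N \<le> i \<Longrightarrow> nrm E (c \<ominus> p i) \<le> b"
  shows "nrm E (c \<ominus> l) \<le> b"
  using tends_nrm_minus[OF assms(1,2)] by (rule LIMSEQ_le_const2) (use assms(3) in auto)

lemma minus_zero [simp]: "x \<in> carrier E \<Longrightarrow> x \<ominus> \<zero> = x"
  by (simp add: minus_eq)

lemma zero_minus_nrm [simp]: "x \<in> carrier E \<Longrightarrow> nrm E (\<zero> \<ominus> x) = nrm E x"
  by (simp add: nrm_minus_commute[of \<zero> x])

text \<open>Since \<open>inverse 0 = 0\<close>, the zero vector is sent to itself, so every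
  \<open>x\<close> is \<open>nrm E x\<close> times a vector of the unit ball without
  exception.\<close>

definition unit_vec :: "'a \<Rightarrow> 'a"
  where "unit_vec x = (of_real (inverse (nrm E x)) :: 'k) \<odot> x"

lemma unit_vec:
  assumes "x \<in> carrier E"
  shows "unit_vec x \<in> carrier E" "nrm E (unit_vec x) \<le> 1" "of_real (nrm E x) \<odot> unit_vec x = x"
proof -
  show "unit_vec x \<in> carrier E" "nrm E (unit_vec x) \<le> 1"
    using assms by (cases "nrm E x = 0"; simp add: unit_vec_def nrm_smult flip: of_real_inverse)+
  show "of_real (nrm E x) \<odot> unit_vec x = x"
  proof (cases "nrm E x = 0")
    case True
    then show ?thesis using assms by (simp add: nrm_eq_0_iff unit_vec_def)
  next
    case False
    then show ?thesis using assms by (simp add: unit_vec_def flip: smult_assoc of_real_mult)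
  qed
qed

end

section \<open>Completeness in terms of Cauchy sequences\<close>

locale bspace_on = nspace_on +
  assumes complete: "mcomplete"

lemma bspace_on_iff: "bspace_on E \<longleftrightarrow> banach_space E"
  by (auto simp: bspace_on_def bspace_on_axioms_def banach_space_def nspace_on_def)

lemma (in nspace_on) MCauchy_iff:
  "MCauchy p \<longleftrightarrow> (\<forall>i. p i \<in> carrier E) \<and> (\<forall>e>0. \<exists>N. \<forall>m\<ge>N. \<forall>n\<ge>N. nrm E (p m \<ominus> p n) < e)"
  unfolding MCauchy_def by (auto simp: nspace_dist_def image_subset_iff)

lemma (in nspace_on) limitin_iff_tends:
  assumes "\<And>i. p i \<in> carrier E"
  shows "limitin mtopology p l sequentially \<longleftrightarrow> tends p l"
  using assms by (auto simp: limit_metric_sequentially tends_def nspace_dist_def LIMSEQ_iff)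

lemma (in bspace_on) Cauchy_tends:
  assumes "\<And>i. p i \<in> carrier E"
    and "\<And>e. e > 0 \<Longrightarrow> \<exists>N. \<forall>m\<ge>N. \<forall>n\<ge>N. nrm E (p m \<ominus> p n) < e"
  obtains l where "tends p l"
proof -
  have "MCauchy p" using assms by (auto simp: MCauchy_iff)
  then show ?thesis using complete that assms(1) by (auto simp: mcomplete_def limitin_iff_tends)
qed

lemma (in nspace_on) bspace_onI:
  assumes "\<And>p. (\<And>i. p i \<in> carrier E) \<Longrightarrow> (\<And>e. e > 0 \<Longrightarrow> \<exists>N. \<forall>m\<ge>N. \<forall>n\<ge>N. nrm E (p m \<ominus> p n) < e)
    \<Longrightarrow> \<exists>l. tends p l"
  shows "bspace_on E"
proof
  show mcomplete
    unfolding mcomplete_def MCauchy_iff using assms by (metis limitin_iff_tends)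
qed


section \<open>Continuity and boundedness of multilinear operators\<close>

lemma prod_carrier_nth: "x \<in> prod_carrier Es \<Longrightarrow> i < length Es \<Longrightarrow> x i \<in> carrier (Es ! i)"
  by (auto simp: prod_carrier_def PiE_iff)

lemma prod_carrier_upd:
  "x \<in> prod_carrier Es \<Longrightarrow> i < length Es \<Longrightarrow> u \<in> carrier (Es ! i) \<Longrightarrow> x(i := u) \<in> prod_carrier Es"
  by (auto simp: prod_carrier_def PiE_iff extensional_def)

lemma prod_carrier_restrict:
  "(\<And>i. i < length Es \<Longrightarrow> f i \<in> carrier (Es ! i)) \<Longrightarrow> (\<lambda>i\<in>{..<length Es}. f i) \<in> prod_carrier Es"
  by (auto simp: prod_carrier_def)

lemma prod_carrier_eqI:
  "x \<in> prod_carrier Es \<Longrightarrow> y \<in> prod_carrier Es \<Longrightarrow> (\<And>i. i < length Es \<Longrightarrow> x i = y i) \<Longrightarrow> x = y"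
  by (auto simp: prod_carrier_def intro: PiE_ext)

definition prod_ball :: "('k, 'a) nspace list \<Rightarrow> (nat \<Rightarrow> 'a) set"
  where "prod_ball Es = {x \<in> prod_carrier Es. \<forall>i<length Es. nrm (Es ! i) (x i) \<le> 1}"

lemma prod_ball_subset: "x \<in> prod_ball Es \<Longrightarrow> x \<in> prod_carrier Es"
  by (simp add: prod_ball_def)

lemma multilinear_norm_eq: "multilinear_norm Es F A = (SUP x\<in>prod_ball Es. nrm F (A x))"
  by (simp add: multilinear_norm_def prod_ball_def)

text \<open>\<open>multilinear\<close> says nothing about where the values lie, hence the assumption
  \<open>closed\<close>. Extensionality is not part of the locale, so that induced operators fit
  into it directly.\<close>

locale multilinear_on = nspace_on F for F :: "('k::real_or_complex, 'b) nspace" (structure) +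
  fixes Es :: "('k, 'a) nspace list" and A :: "(nat \<Rightarrow> 'a) \<Rightarrow> 'b"
  assumes factors: "\<And>E. E \<in> set Es \<Longrightarrow> normed_space E"
    and multilinear: "multilinear Es F A"
    and closed: "x \<in> prod_carrier Es \<Longrightarrow> A x \<in> carrier F"
begin

lemma factor: "i < length Es \<Longrightarrow> nspace_on (Es ! i)"
  using factors by (simp add: nspace_on_def)

lemma map_add:
  "i < length Es \<Longrightarrow> x \<in> prod_carrier Es \<Longrightarrow> u \<in> carrier (Es ! i) \<Longrightarrow> v \<in> carrier (Es ! i) \<Longrightarrow>
    A (x(i := u \<oplus>\<^bsub>Es ! i\<^esub> v)) = A (x(i := u)) \<oplus> A (x(i := v))"
  and map_smult:
  "i < length Es \<Longrightarrow> x \<in> prod_carrier Es \<Longrightarrow> u \<in> carrier (Es ! i) \<Longrightarrow>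
    A (x(i := a \<odot>\<^bsub>Es ! i\<^esub> u)) = a \<odot> A (x(i := u))"
  using multilinear by (auto simp: multilinear_def)

lemma map_minus:
  assumes "i < length Es" "x \<in> prod_carrier Es" "u \<in> carrier (Es ! i)" "v \<in> carrier (Es ! i)"
  shows "A (x(i := u \<ominus>\<^bsub>Es ! i\<^esub> v)) = A (x(i := u)) \<ominus> A (x(i := v))"
proof -
  interpret E: nspace_on "Es ! i" using assms factor by blast
  show ?thesis
    using assms
    by (simp add: E.minus_eq_add_smult minus_eq_add_smult map_add map_smult closed prod_carrier_upd)
qed

lemma map_scale:
  assumes x: "x \<in> prod_carrier Es"
  shows "A (\<lambda>i\<in>{..<length Es}. c i \<odot>\<^bsub>Es ! i\<^esub> x i) = (\<Prod>i<length Es. c i) \<odot> A x"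
proof -
  \<comment> \<open>Only the first \<open>k\<close> coordinates are scaled, so that
    \<open>y (Suc k)\<close> differs from \<open>y k\<close> in a single variable.\<close>
  define y where "y k = (\<lambda>i\<in>{..<length Es}. if i < k then c i \<odot>\<^bsub>Es ! i\<^esub> x i else x i)" for k :: nat
  have smult: "c i \<odot>\<^bsub>Es ! i\<^esub> x i \<in> carrier (Es ! i)" if "i < length Es" for i
  proof -
    interpret E: nspace_on "Es ! i" using that factor by blast
    show ?thesis using prod_carrier_nth[OF x that] by simp
  qed
  have y: "y k \<in> prod_carrier Es" for k
    unfolding y_def using x smult by (intro prod_carrier_restrict) (auto simp: prod_carrier_nth)
  have "k \<le> length Es \<Longrightarrow> A (y k) = (\<Prod>i<k. c i) \<odot> A x" for k
  proof (induction k)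
    case 0
    have "y 0 = x" by (rule prod_carrier_eqI[OF y x]) (simp add: y_def)
    then show ?case using x closed by simp
  next
    case (Suc k)
    then have k: "k < length Es" by simp
    have "y (Suc k) = (y k)(k := c k \<odot>\<^bsub>Es ! k\<^esub> x k)" and yk: "(y k)(k := x k) = y k"
      using k by (auto simp: y_def fun_eq_iff)
    then have "A (y (Suc k)) = c k \<odot> A (y k)"
      using k y prod_carrier_nth[OF x k] by (simp add: map_smult yk)
    then show ?case using Suc closed x by (simp add: smult_assoc mult.commute)
  qed
  from this[of "length Es"] show ?thesis
    by (simp add: y_def cong: restrict_cong)
qed

text \<open>Homogeneity in all variables at once: pulling the norms out of \<open>x\<close> leaves a
  point of the unit ball. Zero coordinates fit in because of the convention in
  \<open>unit_vec\<close>.\<close>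

lemma nrm_le_of_ball:
  assumes bound: "\<And>x. x \<in> prod_ball Es \<Longrightarrow> nrm F (A x) \<le> C" and x: "x \<in> prod_carrier Es"
  shows "nrm F (A x) \<le> C * (\<Prod>i<length Es. nrm (Es ! i) (x i))"
proof -
  define u where "u = (\<lambda>i\<in>{..<length Es}. nspace_on.unit_vec (Es ! i) (x i))"
  define c where "c i = (of_real (nrm (Es ! i) (x i)) :: 'k)" for i
  have u: "u i \<in> carrier (Es ! i)" "nrm (Es ! i) (u i) \<le> 1" "c i \<odot>\<^bsub>Es ! i\<^esub> u i = x i"
      "norm (c i) = nrm (Es ! i) (x i)"
    if "i < length Es" for i
  proof -
    interpret E: nspace_on "Es ! i" using that factor by blast
    show "u i \<in> carrier (Es ! i)" "nrm (Es ! i) (u i) \<le> 1" "c i \<odot>\<^bsub>Es ! i\<^esub> u i = x i"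
      "norm (c i) = nrm (Es ! i) (x i)"
      using E.unit_vec[OF prod_carrier_nth[OF x that]] prod_carrier_nth[OF x that] that
      by (simp_all add: u_def c_def)
  qed
  have uc: "u \<in> prod_carrier Es"
    unfolding u_def using u by (intro prod_carrier_restrict) (simp add: u_def)
  then have ub: "u \<in> prod_ball Es" using u by (simp add: prod_ball_def)
  have "x = (\<lambda>i\<in>{..<length Es}. c i \<odot>\<^bsub>Es ! i\<^esub> u i)"
    using x u by (intro prod_carrier_eqI[OF x]) (auto intro!: prod_carrier_restrict simp: prod_carrier_nth)
  then have "A x = (\<Prod>i<length Es. c i) \<odot> A u"
    using map_scale[OF uc] by simp
  then have "nrm F (A x) = (\<Prod>i<length Es. nrm (Es ! i) (x i)) * nrm F (A u)"
    using closed uc u(4) by (simp add: nrm_smult prod_norm[symmetric])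
  also have "\<dots> \<le> (\<Prod>i<length Es. nrm (Es ! i) (x i)) * C"
    using bound[OF ub] u(4) by (intro mult_left_mono prod_nonneg) (auto simp: u(4)[symmetric])
  finally show ?thesis by (simp add: mult.commute)
qed

text \<open>Telescoping: the coordinates of \<open>x\<close> are exchanged for those of
  \<open>y\<close> one at a time. Each exchange changes the value by \<open>A\<close> at a point
  with one coordinate of norm at most \<open>d\<close> and the others of norm at most
  \<open>M\<close>. Because of \<open>1 \<le> M\<close>, the exponent may be rounded up to
  \<open>length Es\<close>.\<close>

lemma nrm_minus_le_of_ball:
  assumes bound: "\<And>x. x \<in> prod_ball Es \<Longrightarrow> nrm F (A x) \<le> C"
    and x: "x \<in> prod_carrier Es" and y: "y \<in> prod_carrier Es"
    and M: "1 \<le> M" "\<And>i. i < length Es \<Longrightarrow> nrm (Es ! i) (x i) \<le> M"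
      "\<And>i. i < length Es \<Longrightarrow> nrm (Es ! i) (y i) \<le> M"
    and d: "\<And>i. i < length Es \<Longrightarrow> nrm (Es ! i) (y i \<ominus>\<^bsub>Es ! i\<^esub> x i) \<le> d"
    and C: "0 \<le> C"
  shows "nrm F (A y \<ominus> A x) \<le> real (length Es) * (C * (d * M ^ length Es))"
proof -
  define z where "z k = (\<lambda>i\<in>{..<length Es}. if i < k then y i else x i)" for k :: nat
  have z: "z k \<in> prod_carrier Es" for k
    unfolding z_def using x y by (intro prod_carrier_restrict) (auto simp: prod_carrier_nth)
  have z0: "z 0 = x" by (rule prod_carrier_eqI[OF z x]) (simp add: z_def)
  have zn: "z (length Es) = y" by (rule prod_carrier_eqI[OF z y]) (simp add: z_def)
  have step: "nrm F (A (z (Suc k)) \<ominus> A (z k)) \<le> C * (d * M ^ length Es)" if k: "k < length Es" for k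
  proof -
    interpret E: nspace_on "Es ! k" using k factor by blast
    let ?w = "(z k)(k := y k \<ominus>\<^bsub>Es ! k\<^esub> x k)"
    have xk: "x k \<in> carrier (Es ! k)" and yk: "y k \<in> carrier (Es ! k)"
      using x y k by (auto simp: prod_carrier_nth)
    have "z (Suc k) = (z k)(k := y k)" "z k = (z k)(k := x k)"
      using k by (auto simp: z_def fun_eq_iff)
    then have "A (z (Suc k)) \<ominus> A (z k) = A ?w"
      using map_minus[OF k z yk xk, of k] by simp
    moreover have w: "?w \<in> prod_carrier Es"
      using z k xk yk by (intro prod_carrier_upd) auto
    then have "nrm F (A ?w) \<le> C * (\<Prod>i<length Es. nrm (Es ! i) (?w i))"
      using bound by (intro nrm_le_of_ball) auto
    moreover have "(\<Prod>i<length Es. nrm (Es ! i) (?w i)) \<le> d * M ^ length Es"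
    proof -
      have "(\<Prod>i<length Es. nrm (Es ! i) (?w i)) =
          nrm (Es ! k) (?w k) * (\<Prod>i\<in>{..<length Es} - {k}. nrm (Es ! i) (?w i))"
        using k by (intro prod.remove) auto
      also have "\<dots> \<le> d * M ^ length Es"
      proof (rule mult_mono)
        show "nrm (Es ! k) (?w k) \<le> d" using d[OF k] by simp
        then show "0 \<le> d" using E.nrm_nonneg[OF E.minus_closed'[OF yk xk]] by simp
        have nn: "0 \<le> nrm (Es ! i) (?w i)" if "i < length Es" for i
          using nspace_on.nrm_nonneg[OF factor[OF that] prod_carrier_nth[OF w that]] .
        have le: "nrm (Es ! i) (?w i) \<le> M" if "i < length Es" "i \<noteq> k" for i
          using that M by (simp add: z_def)
        have "(\<Prod>i\<in>{..<length Es} - {k}. nrm (Es ! i) (?w i)) \<le> (\<Prod>i\<in>{..<length Es} - {k}. M)"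
          using nn le by (intro prod_mono) (auto simp del: fun_upd_apply)
        also have "\<dots> \<le> M ^ length Es"
          using M(1) k by (simp add: power_increasing)
        finally show "(\<Prod>i\<in>{..<length Es} - {k}. nrm (Es ! i) (?w i)) \<le> M ^ length Es" .
        show "0 \<le> (\<Prod>i\<in>{..<length Es} - {k}. nrm (Es ! i) (?w i))"
          using nn by (intro prod_nonneg) (auto simp del: fun_upd_apply)
      qed
      finally show ?thesis .
    qed
    ultimately show ?thesis
      using C by (smt (verit) mult_left_mono)
  qed
  have "k \<le> length Es \<Longrightarrow> nrm F (A (z k) \<ominus> A x) \<le> real k * (C * (d * M ^ length Es))" for k
  proof (induction k)
    case 0
    then show ?case using x closed by (simp add: z0 minus_eq M.r_neg)
  next
    case (Suc k)
    have "nrm F (A (z (Suc k)) \<ominus> A x) \<le> nrm F (A (z (Suc k)) \<ominus> A (z k)) + nrm F (A (z k) \<ominus> A x)"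
      using closed z x by (intro nrm_minus_triangle) auto
    also have "\<dots> \<le> C * (d * M ^ length Es) + real k * (C * (d * M ^ length Es))"
      using Suc step[of k] by (intro add_mono) auto
    finally show ?case by (simp add: algebra_simps)
  qed
  from this[of "length Es"] show ?thesis by (simp add: zn)
qed

lemma topspace_prod:
  "topspace (product_topology (\<lambda>i. nspace_topology (Es ! i)) {..<length Es}) = prod_carrier Es"
  using factor by (auto simp: prod_carrier_def PiE_iff nspace_on.topspace_nspace_topology)

lemma mball_open:
  "i < length Es \<Longrightarrow> openin (nspace_topology (Es ! i))
    (Metric_space.mball (carrier (Es ! i)) (nspace_dist (Es ! i)) c r)"
proof -
  assume "i < length Es"
  then interpret E: nspace_on "Es ! i" using factor by blast
  show ?thesis by (simp add: E.nspace_topology_eq)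
qed

lemma continuousI:
  assumes bound: "\<And>x. x \<in> prod_ball Es \<Longrightarrow> nrm F (A x) \<le> C"
  shows "continuous_multilinear Es F A"
  unfolding continuous_multilinear_def
proof (intro conjI multilinear)
  show "continuous_map (product_topology (\<lambda>i. nspace_topology (Es ! i)) {..<length Es}) (nspace_topology F) A"
    unfolding nspace_topology_eq continuous_map_to_metric topspace_prod
  proof (intro ballI allI impI)
    fix x and e :: real assume x: "x \<in> prod_carrier Es" and e: "0 < e"
    \<comment> \<open>\<open>M\<close> exceeds each coordinate norm of \<open>x\<close> by at least
      1, hence bounds the coordinates of every \<open>y\<close> within distance 1. \<open>K\<close>
      dominates the Lipschitz factor of \<open>nrm_minus_le_of_ball\<close>, the added 1 making it
      positive; halving \<open>e\<close> makes the final estimate strict. \<open>max C 0\<close>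
      supplies the nonnegative constant which that lemma asks for.\<close>
    define M where "M = 2 + (\<Sum>i<length Es. nrm (Es ! i) (x i))"
    define K where "K = 1 + real (length Es) * (max C 0 * M ^ length Es)"
    define d where "d = min 1 (e / (2 * K))"
    have nn: "0 \<le> nrm (Es ! i) (x i)" if "i < length Es" for i
      using nspace_on.nrm_nonneg[OF factor[OF that] prod_carrier_nth[OF x that]] .
    have xM: "nrm (Es ! i) (x i) + 1 \<le> M" if "i < length Es" for i
      using member_le_sum[of i "{..<length Es}" "\<lambda>i. nrm (Es ! i) (x i)"] that nn by (auto simp: M_def)
    have M1: "1 \<le> M" unfolding M_def using sum_nonneg[of "{..<length Es}" "\<lambda>i. nrm (Es ! i) (x i)"] nn by simp
    then have K: "1 \<le> K" unfolding K_def by simp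
    have d: "0 < d" "d \<le> 1" using e K by (auto simp: d_def)
    let ?B = "\<lambda>i. Metric_space.mball (carrier (Es ! i)) (nspace_dist (Es ! i)) (x i) d"
    let ?U = "\<Pi>\<^sub>E i\<in>{..<length Es}. ?B i"
    have ball: "v \<in> ?B i \<longleftrightarrow> v \<in> carrier (Es ! i) \<and> nrm (Es ! i) (v \<ominus>\<^bsub>Es ! i\<^esub> x i) < d"
      if "i < length Es" for i v
    proof -
      interpret E: nspace_on "Es ! i" using that factor by blast
      show ?thesis using prod_carrier_nth[OF x that] by (auto simp: nspace_dist_def E.nrm_minus_commute)
    qed
    have "x \<in> ?U"
    proof -
      have "x i \<in> ?B i" if "i < length Es" for i
      proof -
        interpret E: nspace_on "Es ! i" using that factor by blast
        show ?thesis using prod_carrier_nth[OF x that] d by auto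
      qed
      then show ?thesis using x by (auto simp: prod_carrier_def PiE_iff)
    qed
    moreover have "openin (product_topology (\<lambda>i. nspace_topology (Es ! i)) {..<length Es}) ?U"
      by (subst openin_PiE) (auto simp: mball_open)
    moreover have "A y \<in> mball (A x) e" if "y \<in> ?U" for y
    proof -
      have yi: "y i \<in> carrier (Es ! i)" "nrm (Es ! i) (y i \<ominus>\<^bsub>Es ! i\<^esub> x i) < d" if "i < length Es" for i
        using ball[OF that] \<open>y \<in> ?U\<close> that by (auto simp: PiE_iff)
      have y: "y \<in> prod_carrier Es"
        using that yi by (auto simp: prod_carrier_def PiE_iff)
      have yM: "nrm (Es ! i) (y i) \<le> M" if "i < length Es" for i
        using nspace_on.nrm_le_add_minus[OF factor[OF that] yi(1)[OF that] prod_carrier_nth[OF x that]]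
          yi(2)[OF that] xM[OF that] d by linarith
      have "nrm F (A y \<ominus> A x) \<le> real (length Es) * (max C 0 * (d * M ^ length Es))"
      proof (rule nrm_minus_le_of_ball[OF _ x y M1])
        show "nrm F (A x) \<le> max C 0" if "x \<in> prod_ball Es" for x using bound[OF that] by simp
        show "nrm (Es ! i) (x i) \<le> M" if "i < length Es" for i using xM[OF that] by simp
        show "nrm (Es ! i) (y i \<ominus>\<^bsub>Es ! i\<^esub> x i) \<le> d" if "i < length Es" for i using yi(2)[OF that] by simp
      qed (use yM in auto)
      also have "\<dots> \<le> d * K" using d by (simp add: K_def algebra_simps)
      also have "\<dots> \<le> e / (2 * K) * K" using K by (intro mult_right_mono) (auto simp: d_def)
      also have "\<dots> < e" using K e by simp
      finally show ?thesis using closed x y by (simp add: nspace_dist_def nrm_minus_commute)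
    qed
    ultimately show "\<exists>U. openin (product_topology (\<lambda>i. nspace_topology (Es ! i)) {..<length Es}) U \<and>
        x \<in> U \<and> (\<forall>y\<in>U. A y \<in> mball (A x) e)" by blast
  qed
qed

text \<open>Makes the supremum in \<open>multilinear_norm\<close> one over a nonempty set; the
  origin is also the base point for deriving boundedness from continuity.\<close>

lemma zero_in_ball: "(\<lambda>i\<in>{..<length Es}. \<zero>\<^bsub>Es ! i\<^esub>) \<in> prod_ball Es"
proof -
  have "\<zero>\<^bsub>Es ! i\<^esub> \<in> carrier (Es ! i) \<and> nrm (Es ! i) \<zero>\<^bsub>Es ! i\<^esub> \<le> 1" if "i < length Es" for i
  proof -
    interpret E: nspace_on "Es ! i" using that factor by blast
    show ?thesis by simp
  qed
  then show ?thesis by (auto simp: prod_ball_def intro: prod_carrier_restrict)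
qed

text \<open>Continuity at the origin provides a box with radii \<open>r i\<close> on which
  \<open>A\<close> stays within distance 1 of its value there. Scaling the coordinates of a point of
  the unit ball by \<open>r i / 2\<close> moves it into the box, and multilinearity takes these
  factors out again, whence the denominator.\<close>

lemma continuous_imp_bounded:
  assumes "continuous_multilinear Es F A"
  obtains C where "\<And>x. x \<in> prod_ball Es \<Longrightarrow> nrm F (A x) \<le> C"
proof -
  define o' where "o' = (\<lambda>i\<in>{..<length Es}. \<zero>\<^bsub>Es ! i\<^esub>)"
  have o': "o' \<in> prod_carrier Es"
    unfolding o'_def by (rule prod_ball_subset[OF zero_in_ball])
  have "continuous_map (product_topology (\<lambda>i. nspace_topology (Es ! i)) {..<length Es}) mtopology A"
    using assms by (simp add: continuous_multilinear_def nspace_topology_eq)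
  then obtain U where U: "openin (product_topology (\<lambda>i. nspace_topology (Es ! i)) {..<length Es}) U"
      "o' \<in> U" "\<And>y. y \<in> U \<Longrightarrow> A y \<in> mball (A o') 1"
    unfolding continuous_map_to_metric topspace_prod using o' by (metis zero_less_one)
  from U(1)[unfolded openin_product_topology_alt, rule_format, OF U(2)]
  obtain V where V: "\<And>i. i < length Es \<Longrightarrow> openin (nspace_topology (Es ! i)) (V i)"
      "o' \<in> Pi\<^sub>E {..<length Es} V" "Pi\<^sub>E {..<length Es} V \<subseteq> U"
    by auto
  have "\<exists>r>0. \<forall>v\<in>carrier (Es ! i). nrm (Es ! i) v < r \<longrightarrow> v \<in> V i" if i: "i < length Es" for i
  proof -
    interpret E: nspace_on "Es ! i" using that factor by blast
    have "\<zero>\<^bsub>Es ! i\<^esub> \<in> V i" using V(2) i by (auto simp: PiE_iff o'_def)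
    then obtain r where r: "r > 0" "E.mball \<zero>\<^bsub>Es ! i\<^esub> r \<subseteq> V i"
      using V(1)[OF i] by (auto simp: E.nspace_topology_eq E.openin_mtopology)
    then show ?thesis by (intro exI[of _ r]) (auto simp: subset_iff nspace_dist_def)
  qed
  then obtain r where r: "\<And>i. i < length Es \<Longrightarrow> 0 < r i"
      "\<And>i v. i < length Es \<Longrightarrow> v \<in> carrier (Es ! i) \<Longrightarrow> nrm (Es ! i) v < r i \<Longrightarrow> v \<in> V i"
    by metis
  have "nrm F (A x) \<le> (1 + nrm F (A o')) / (\<Prod>i<length Es. r i / 2)" if "x \<in> prod_ball Es" for x
  proof -
    have x: "x \<in> prod_carrier Es" "\<And>i. i < length Es \<Longrightarrow> nrm (Es ! i) (x i) \<le> 1"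
      using that by (auto simp: prod_ball_def)
    define y where "y = (\<lambda>i\<in>{..<length Es}. (of_real (r i / 2) :: 'k) \<odot>\<^bsub>Es ! i\<^esub> x i)"
    have "y i \<in> V i" if i: "i < length Es" for i
    proof -
      interpret E: nspace_on "Es ! i" using that factor by blast
      have xi: "x i \<in> carrier (Es ! i)" using x i by (auto simp: prod_carrier_nth)
      have "nrm (Es ! i) (y i) = r i / 2 * nrm (Es ! i) (x i)"
        using xi i r(1)[OF i] by (simp add: y_def E.nrm_smult del: of_real_divide)
      also have "\<dots> < r i" using x(2)[OF i] r(1)[OF i] mult_left_mono[of "nrm (Es ! i) (x i)" 1 "r i / 2"] by simp
      finally show ?thesis using r(2)[OF i] xi i by (simp add: y_def)
    qed
    then have "y \<in> U" using V(3) by (auto simp: y_def PiE_iff subset_iff)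
    then have "A y \<in> mball (A o') 1" by (rule U(3))
    then have "A y \<in> carrier F" "nrm F (A y \<ominus> A o') < 1" using closed[OF o']
      by (auto simp: nspace_dist_def nrm_minus_commute)
    \<comment> \<open>The value at the origin stays in the bound: for the empty list of factors it
      may be nonzero.\<close>
    then have "nrm F (A y) \<le> 1 + nrm F (A o')"
      using nrm_le_add_minus[of "A y" "A o'"] closed[OF o'] by simp
    moreover have c: "norm (of_real (r i / 2) :: 'k) = r i / 2" if "i < length Es" for i
      using r(1)[OF that] by (simp del: of_real_divide)
    moreover have "A y = (\<Prod>i<length Es. of_real (r i / 2)) \<odot> A x"
      unfolding y_def using x(1) by (rule map_scale)
    then have "nrm F (A y) = (\<Prod>i<length Es. r i / 2) * nrm F (A x)"
      using closed[OF x(1)] c by (simp add: nrm_smult prod_norm[symmetric] del: of_real_divide)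
    moreover have "0 < (\<Prod>i<length Es. r i / 2)" using r(1) by (intro prod_pos) auto
    ultimately show ?thesis by (simp add: pos_le_divide_eq mult.commute)
  qed
  then show ?thesis by (rule that)
qed

lemma norm_leI: "(\<And>x. x \<in> prod_ball Es \<Longrightarrow> nrm F (A x) \<le> C) \<Longrightarrow> multilinear_norm Es F A \<le> C"
  unfolding multilinear_norm_eq using zero_in_ball by (intro cSUP_least) auto

end

locale continuous_multilinear_on = multilinear_on +
  assumes continuous: "continuous_multilinear Es F A"
begin

text \<open>A real supremum is an upper bound only of a set that is bounded above, and continuity
  guarantees this.\<close>

lemma nrm_le_norm:
  assumes "x \<in> prod_ball Es"
  shows "nrm F (A x) \<le> multilinear_norm Es F A"
proof -
  obtain C where "\<And>x. x \<in> prod_ball Es \<Longrightarrow> nrm F (A x) \<le> C"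
    using continuous_imp_bounded[OF continuous] by blast
  then show ?thesis
    unfolding multilinear_norm_eq using assms by (intro cSUP_upper) (auto simp: bdd_above_def)
qed

lemma nrm_le: "x \<in> prod_carrier Es \<Longrightarrow>
    nrm F (A x) \<le> multilinear_norm Es F A * (\<Prod>i<length Es. nrm (Es ! i) (x i))"
  by (rule nrm_le_of_ball[OF nrm_le_norm])

lemma norm_nonneg: "0 \<le> multilinear_norm Es F A"
  using order_trans[OF nrm_nonneg nrm_le_norm[OF zero_in_ball]] closed prod_ball_subset[OF zero_in_ball]
  by blast

lemma tends_map:
  assumes "x \<in> prod_carrier Es" "i < length Es" "nspace_on.tends (Es ! i) p l"
  shows "tends (\<lambda>j. A (x(i := p j))) (A (x(i := l)))"
proof -
  interpret E: nspace_on "Es ! i" using assms factor by blast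
  have c: "\<And>j. p j \<in> carrier (Es ! i)" "l \<in> carrier (Es ! i)"
    and lim: "(\<lambda>j. nrm (Es ! i) (p j \<ominus>\<^bsub>Es ! i\<^esub> l)) \<longlonglongrightarrow> 0"
    using assms by (auto simp: E.tends_def)
  \<comment> \<open>Lipschitz constant of \<open>A\<close> in the \<open>i\<close>-th variable, the
    others being fixed.\<close>
  define R where "R = multilinear_norm Es F A * (\<Prod>j\<in>{..<length Es} - {i}. nrm (Es ! j) (x j))"
  show ?thesis
  proof (rule tends_I[where b = "\<lambda>j. R * nrm (Es ! i) (p j \<ominus>\<^bsub>Es ! i\<^esub> l)"])
    show "(\<lambda>j. R * nrm (Es ! i) (p j \<ominus>\<^bsub>Es ! i\<^esub> l)) \<longlonglongrightarrow> 0"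
      using tendsto_mult_left[OF lim, of R] by simp
    fix j
    have "A (x(i := p j)) \<ominus> A (x(i := l)) = A (x(i := p j \<ominus>\<^bsub>Es ! i\<^esub> l))"
      using assms c by (simp add: map_minus)
    then have "nrm F (A (x(i := p j)) \<ominus> A (x(i := l))) \<le>
        multilinear_norm Es F A * (\<Prod>k<length Es. nrm (Es ! k) ((x(i := p j \<ominus>\<^bsub>Es ! i\<^esub> l)) k))"
      using nrm_le[OF prod_carrier_upd[OF assms(1,2)], of "p j \<ominus>\<^bsub>Es ! i\<^esub> l"] c by simp
    also have "\<dots> = R * nrm (Es ! i) (p j \<ominus>\<^bsub>Es ! i\<^esub> l)"
      using assms(2) by (subst prod.remove[of _ i]) (auto simp: R_def intro!: arg_cong2[where f = "(*)"] prod.cong)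
    finally show "nrm F (A (x(i := p j)) \<ominus> A (x(i := l))) \<le> R * nrm (Es ! i) (p j \<ominus>\<^bsub>Es ! i\<^esub> l)" .
  qed (use assms c closed in \<open>auto intro: prod_carrier_upd\<close>)
qed

end

text \<open>That the values lie in \<open>carrier F\<close> is contained in continuity: a continuous
  map sends topspace into topspace.\<close>

lemma continuous_multilinear_onI:
  assumes "\<And>E. E \<in> set Es \<Longrightarrow> normed_space E" "normed_space F" "continuous_multilinear Es F A"
  shows "continuous_multilinear_on F Es A"
proof -
  interpret nspace_on F using assms by (simp add: nspace_on_def)
  have "A \<in> topspace (product_topology (\<lambda>i. nspace_topology (Es ! i)) {..<length Es}) \<rightarrow> carrier F"
    using continuous_map_funspace[of _ "nspace_topology F"] assms
    by (fastforce simp: continuous_multilinear_def)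
  moreover have "nspace_on (Es ! i)" if "i < length Es" for i using assms that by (simp add: nspace_on_def)
  then have "topspace (product_topology (\<lambda>i. nspace_topology (Es ! i)) {..<length Es}) = prod_carrier Es"
    by (auto simp: prod_carrier_def PiE_iff nspace_on.topspace_nspace_topology)
  ultimately have "\<And>x. x \<in> prod_carrier Es \<Longrightarrow> A x \<in> carrier F" by auto
  then show ?thesis
    using assms by unfold_locales (auto simp: continuous_multilinear_def)
qed


section \<open>The closed graph theorem for multilinear operators\<close>

text \<open>The uniform boundedness principle for families with closed graphs: Baire's theorem makes the
  closure of some sublevel set of the family a neighbourhood of \<open>0\<close>, and the successive
  approximation from the proof of the open mapping theorem removes the closure.\<close>

lemma closed_graph_uniform_bound:
  fixes Z :: "('k::real_or_complex, 'a) nspace" and W :: "('k, 'b) nspace" and T :: "'i \<Rightarrow> 'a \<Rightarrow> 'b"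
  assumes "bspace_on Z" and "bspace_on W"
    and closed: "\<And>u x. u \<in> I \<Longrightarrow> x \<in> carrier Z \<Longrightarrow> T u x \<in> carrier W"
    and add: "\<And>u x y. u \<in> I \<Longrightarrow> x \<in> carrier Z \<Longrightarrow> y \<in> carrier Z \<Longrightarrow> T u (x \<oplus>\<^bsub>Z\<^esub> y) = T u x \<oplus>\<^bsub>W\<^esub> T u y"
    and smult: "\<And>u a x. u \<in> I \<Longrightarrow> x \<in> carrier Z \<Longrightarrow> T u (a \<odot>\<^bsub>Z\<^esub> x) = a \<odot>\<^bsub>W\<^esub> T u x"
    and graph: "\<And>u p l w. u \<in> I \<Longrightarrow> nspace_on.tends Z p l \<Longrightarrow> nspace_on.tends W (\<lambda>j. T u (p j)) w \<Longrightarrow> w = T u l"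
    and pointwise: "\<And>x. x \<in> carrier Z \<Longrightarrow> \<exists>K. \<forall>u\<in>I. nrm W (T u x) \<le> K"
  shows "\<exists>K. \<forall>u\<in>I. \<forall>x\<in>carrier Z. nrm Z x \<le> 1 \<longrightarrow> nrm W (T u x) \<le> K"
proof -
  interpret Z: bspace_on Z by fact
  interpret W: bspace_on W by fact
  have minus: "T u (x \<ominus>\<^bsub>Z\<^esub> y) = T u x \<ominus>\<^bsub>W\<^esub> T u y" if "u \<in> I" "x \<in> carrier Z" "y \<in> carrier Z" for u x y
    using that by (simp add: Z.minus_eq_add_smult W.minus_eq_add_smult add smult closed)
  define G where "G K = {x \<in> carrier Z. \<forall>u\<in>I. nrm W (T u x) \<le> K}" for K :: real
  have "\<exists>k::nat. Z.mtopology interior_of (Z.mtopology closure_of G (real k)) \<noteq> {}"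
  proof (rule ccontr)
    assume "\<not> ?thesis"
    then have "Z.mtopology interior_of \<Union>(range (\<lambda>k::nat. Z.mtopology closure_of G (real k))) = {}"
      by (intro Z.metric_Baire_category_alt Z.complete) auto
    moreover have "\<Union>(range (\<lambda>k::nat. Z.mtopology closure_of G (real k))) = carrier Z"
    proof (intro equalityI subsetI)
      fix x assume x: "x \<in> carrier Z"
      then obtain K where K: "\<forall>u\<in>I. nrm W (T u x) \<le> K" using pointwise by blast
      obtain k :: nat where "K \<le> real k" using real_arch_simple by blast
      then have "x \<in> G (real k)" using K x by (force simp: G_def)
      then have "x \<in> Z.mtopology closure_of G (real k)"
        using closure_of_subset[of "G (real k)" Z.mtopology] by (auto simp: G_def)
      then show "x \<in> \<Union>(range (\<lambda>k::nat. Z.mtopology closure_of G (real k)))" by blast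
    qed (use closure_of_subset_topspace[of Z.mtopology] in auto)
    moreover have "Z.mtopology interior_of carrier Z = carrier Z"
      using interior_of_topspace[of Z.mtopology] by simp
    ultimately show False using Z.M.zero_closed by simp
  qed
  then obtain k :: nat and c where "c \<in> Z.mtopology interior_of (Z.mtopology closure_of G (real k))"
    by blast
  then obtain r where c: "c \<in> carrier Z" and r: "r > 0"
    and ball: "Z.mball c r \<subseteq> Z.mtopology closure_of G (real k)"
    by (auto simp: Z.in_interior_of_mball)
  \<comment> \<open>Both \<open>c\<close> and \<open>c \<oplus> z\<close> lie in the ball, hence are
    approximated by elements of \<open>G k\<close>; the difference of the two approximants lies in
    \<open>G (2 * k)\<close> and approximates \<open>z\<close>.\<close>
  have approx1: "\<exists>y\<in>G (2 * k). nrm Z (z \<ominus>\<^bsub>Z\<^esub> y) < e"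
    if z: "z \<in> carrier Z" "nrm Z z < r" and e: "0 < e" for z e
  proof -
    have "\<exists>y\<in>G (real k). nrm Z (x \<ominus>\<^bsub>Z\<^esub> y) < e / 2" if "x \<in> Z.mball c r" for x
    proof -
      have "x \<in> Z.mtopology closure_of G (real k)" using that ball by blast
      then obtain y where "y \<in> G (real k)" "y \<in> Z.mball x (e / 2)"
        unfolding Z.metric_closure_of using e by (auto dest!: spec[of _ "e / 2"])
      then show ?thesis by (auto simp: nspace_dist_def)
    qed
    moreover have "c \<in> Z.mball c r" using c r by simp
    moreover have "c \<oplus>\<^bsub>Z\<^esub> z \<ominus>\<^bsub>Z\<^esub> c = z"
      using c z by (simp add: Z.add_minus_cancel_left)
    then have "c \<oplus>\<^bsub>Z\<^esub> z \<in> Z.mball c r"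
      using c z by (simp add: nspace_dist_def Z.nrm_minus_commute[of c "c \<oplus>\<^bsub>Z\<^esub> z"])
    ultimately obtain y1 y2 where y: "y1 \<in> G (real k)" "nrm Z (c \<ominus>\<^bsub>Z\<^esub> y1) < e / 2"
      "y2 \<in> G (real k)" "nrm Z (c \<oplus>\<^bsub>Z\<^esub> z \<ominus>\<^bsub>Z\<^esub> y2) < e / 2" by blast
    have yc: "y1 \<in> carrier Z" "y2 \<in> carrier Z" using y by (auto simp: G_def)
    have "z \<ominus>\<^bsub>Z\<^esub> (y2 \<ominus>\<^bsub>Z\<^esub> y1) = (c \<oplus>\<^bsub>Z\<^esub> z \<ominus>\<^bsub>Z\<^esub> y2) \<ominus>\<^bsub>Z\<^esub> (c \<ominus>\<^bsub>Z\<^esub> y1)"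
      using c z yc by (simp add: Z.minus_minus_eq)
    then have "nrm Z (z \<ominus>\<^bsub>Z\<^esub> (y2 \<ominus>\<^bsub>Z\<^esub> y1)) \<le> nrm Z (c \<oplus>\<^bsub>Z\<^esub> z \<ominus>\<^bsub>Z\<^esub> y2) + nrm Z (c \<ominus>\<^bsub>Z\<^esub> y1)"
      using c z yc by (simp add: Z.nrm_minus_le)
    then have "nrm Z (z \<ominus>\<^bsub>Z\<^esub> (y2 \<ominus>\<^bsub>Z\<^esub> y1)) < e" using y by simp
    moreover have "y2 \<ominus>\<^bsub>Z\<^esub> y1 \<in> G (2 * k)"
    proof -
      have "nrm W (T u (y2 \<ominus>\<^bsub>Z\<^esub> y1)) \<le> 2 * k" if "u \<in> I" for u
      proof -
        have "nrm W (T u (y2 \<ominus>\<^bsub>Z\<^esub> y1)) \<le> nrm W (T u y2) + nrm W (T u y1)"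
          using that yc closed by (simp add: minus W.nrm_minus_le)
        moreover have "nrm W (T u y2) \<le> k" "nrm W (T u y1) \<le> k" using y that by (auto simp: G_def)
        ultimately show ?thesis by simp
      qed
      then show ?thesis using yc by (auto simp: G_def)
    qed
    ultimately show ?thesis by blast
  qed
  \<comment> \<open>The previous step scaled by \<open>s\<close>, since \<open>G\<close> scales with
    its bound.\<close>
  have approx: "\<exists>y\<in>G (s * (2 * k)). nrm Z (z \<ominus>\<^bsub>Z\<^esub> y) < e"
    if z: "z \<in> carrier Z" "nrm Z z < s * r" and s: "0 < s" and e: "0 < e" for z s e
  proof -
    let ?a = "of_real s :: 'k" and ?b = "of_real (inverse s) :: 'k"
    have n: "norm ?a = s" "norm ?b = inverse s" using s by (simp_all del: of_real_inverse)
    have ab: "?a * ?b = 1" using s by (simp flip: of_real_mult)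
    have "nrm Z (?b \<odot>\<^bsub>Z\<^esub> z) = inverse s * nrm Z z" using z n by (simp only: Z.nrm_smult)
    also have "\<dots> < r" using z s by (simp add: field_simps)
    finally have zb: "nrm Z (?b \<odot>\<^bsub>Z\<^esub> z) < r" .
    then obtain y where y: "y \<in> G (2 * k)" "nrm Z (?b \<odot>\<^bsub>Z\<^esub> z \<ominus>\<^bsub>Z\<^esub> y) < e / s"
      using approx1[OF _ zb, of "e / s"] z s e by auto
    then have yc: "y \<in> carrier Z" by (simp add: G_def)
    have "z \<ominus>\<^bsub>Z\<^esub> ?a \<odot>\<^bsub>Z\<^esub> y = ?a \<odot>\<^bsub>Z\<^esub> (?b \<odot>\<^bsub>Z\<^esub> z \<ominus>\<^bsub>Z\<^esub> y)"
      using z yc ab by (simp add: Z.smult_minus_distrib flip: Z.smult_assoc del: of_real_inverse)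
    then have "nrm Z (z \<ominus>\<^bsub>Z\<^esub> ?a \<odot>\<^bsub>Z\<^esub> y) = s * nrm Z (?b \<odot>\<^bsub>Z\<^esub> z \<ominus>\<^bsub>Z\<^esub> y)"
      using z yc n by (simp add: Z.nrm_smult del: of_real_inverse)
    then have "nrm Z (z \<ominus>\<^bsub>Z\<^esub> ?a \<odot>\<^bsub>Z\<^esub> y) < e"
      using y s by (simp add: field_simps del: of_real_inverse)
    moreover have "?a \<odot>\<^bsub>Z\<^esub> y \<in> G (s * (2 * k))"
      using y s n(1) closed by (auto simp: G_def smult W.nrm_smult)
    ultimately show ?thesis by blast
  qed
  have lim: "(\<lambda>i. a * (1 / 2) ^ i) \<longlonglongrightarrow> 0" for a :: real
    by (intro tendsto_mult_right_zero LIMSEQ_power_zero) simp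
  have bound: "nrm W (T u z) \<le> 4 * k" if u: "u \<in> I" and z: "z \<in> carrier Z" "nrm Z z < r" for u z
  proof -
    \<comment> \<open>Partial sums of a series for \<open>z\<close>: each term halves the bound on
      the remainder, and the bound on the images of the terms is halved along with it. Starting from
      zero makes \<open>T u (p i)\<close> the sum of these images. All estimates hold simultaneously
      for the whole family, so the resulting constant does not depend on \<open>u\<close>.\<close>
    have "\<exists>p. \<forall>i. (p i \<in> carrier Z \<and> nrm Z (z \<ominus>\<^bsub>Z\<^esub> p i) < r * (1 / 2) ^ i \<and> (i = 0 \<longrightarrow> p i = \<zero>\<^bsub>Z\<^esub>)) \<and>
        p (Suc i) \<ominus>\<^bsub>Z\<^esub> p i \<in> G ((1 / 2) ^ i * (2 * k))"
    proof (rule dependent_nat_choice)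
      show "\<exists>x. x \<in> carrier Z \<and> nrm Z (z \<ominus>\<^bsub>Z\<^esub> x) < r * (1 / 2) ^ 0 \<and> ((0::nat) = 0 \<longrightarrow> x = \<zero>\<^bsub>Z\<^esub>)"
        using z by auto
      fix x and i :: nat
      assume x: "x \<in> carrier Z \<and> nrm Z (z \<ominus>\<^bsub>Z\<^esub> x) < r * (1 / 2) ^ i \<and> (i = 0 \<longrightarrow> x = \<zero>\<^bsub>Z\<^esub>)"
      then obtain y where y: "y \<in> G ((1 / 2) ^ i * (2 * k))"
          "nrm Z ((z \<ominus>\<^bsub>Z\<^esub> x) \<ominus>\<^bsub>Z\<^esub> y) < r * (1 / 2) ^ Suc i"
        using approx[of "z \<ominus>\<^bsub>Z\<^esub> x" "(1 / 2) ^ i" "r * (1 / 2) ^ Suc i"] z r by (auto simp: mult.commute)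
      then have yc: "y \<in> carrier Z" by (simp add: G_def)
      have "z \<ominus>\<^bsub>Z\<^esub> (x \<oplus>\<^bsub>Z\<^esub> y) = (z \<ominus>\<^bsub>Z\<^esub> x) \<ominus>\<^bsub>Z\<^esub> y" "(x \<oplus>\<^bsub>Z\<^esub> y) \<ominus>\<^bsub>Z\<^esub> x = y"
        using x yc z by (simp_all add: Z.add_minus_cancel_left Z.minus_eq[of z] Z.minus_eq[of _ y] Z.M.minus_add Z.M.a_assoc)
      then show "\<exists>x'. (x' \<in> carrier Z \<and> nrm Z (z \<ominus>\<^bsub>Z\<^esub> x') < r * (1 / 2) ^ Suc i \<and> (Suc i = 0 \<longrightarrow> x' = \<zero>\<^bsub>Z\<^esub>)) \<and>
          x' \<ominus>\<^bsub>Z\<^esub> x \<in> G ((1 / 2) ^ i * (2 * k))"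
        using x y yc by (intro exI[of _ "x \<oplus>\<^bsub>Z\<^esub> y"]) auto
    qed
    then obtain p where p: "\<And>i. p i \<in> carrier Z" "\<And>i. nrm Z (z \<ominus>\<^bsub>Z\<^esub> p i) < r * (1 / 2) ^ i"
        "p 0 = \<zero>\<^bsub>Z\<^esub>" "\<And>i. p (Suc i) \<ominus>\<^bsub>Z\<^esub> p i \<in> G ((1 / 2) ^ i * (2 * k))" by blast
    have pz: "Z.tends p z"
      using p z by (intro Z.tends_I[OF _ _ _ lim]) (auto simp: Z.nrm_minus_commute[of _ z] intro: less_imp_le)
    let ?q = "\<lambda>i. T u (p i)"
    have q: "?q i \<in> carrier W" for i using closed u p by simp
    \<comment> \<open>The right-hand side is the geometric sum of \<open>2 * k * (1 / 2) ^ l\<close>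
      over \<open>l\<close> from \<open>i\<close> up to \<open>i + j - 1\<close>.\<close>
    have diff: "nrm W (?q (i + j) \<ominus>\<^bsub>W\<^esub> ?q i) \<le> 4 * k * ((1 / 2) ^ i - (1 / 2) ^ (i + j))" for i j
    proof (induction j)
      case 0
      then show ?case using q by (simp add: W.minus_eq W.M.r_neg)
    next
      case (Suc j)
      have "nrm W (?q (i + Suc j) \<ominus>\<^bsub>W\<^esub> ?q i) \<le>
          nrm W (?q (i + Suc j) \<ominus>\<^bsub>W\<^esub> ?q (i + j)) + nrm W (?q (i + j) \<ominus>\<^bsub>W\<^esub> ?q i)"
        using q by (intro W.nrm_minus_triangle) auto
      moreover have "nrm W (?q (i + Suc j) \<ominus>\<^bsub>W\<^esub> ?q (i + j)) \<le> (1 / 2) ^ (i + j) * (2 * k)"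
        using p(4)[of "i + j"] u p(1) by (auto simp: G_def minus)
      ultimately show ?case using Suc by (simp add: algebra_simps)
    qed
    have diff': "nrm W (?q n \<ominus>\<^bsub>W\<^esub> ?q m) \<le> 4 * k * (1 / 2) ^ m" if "m \<le> n" for m n
    proof -
      have "4 * k * ((1 / 2) ^ m - (1 / 2) ^ n) \<le> 4 * k * (1 / 2 :: real) ^ m"
        by (intro mult_left_mono) auto
      then show ?thesis using diff[of m "n - m"] that by simp
    qed
    obtain w where w: "W.tends ?q w"
    proof (rule W.Cauchy_tends[of ?q])
      fix e :: real assume e: "0 < e"
      obtain N where N: "4 * k * (1 / 2) ^ N < e / 2"
        using LIMSEQ_D[OF lim[of "4 * k"], of "e / 2"] e by auto
      have "nrm W (?q m \<ominus>\<^bsub>W\<^esub> ?q n) < e" if "N \<le> m" "N \<le> n" for m n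
        using W.nrm_minus_triangle[of "?q m" "?q N" "?q n"] q diff'[OF that(1)] diff'[OF that(2)] N
          W.nrm_minus_commute[of "?q n" "?q N"] by simp
      then show "\<exists>N. \<forall>m\<ge>N. \<forall>n\<ge>N. nrm W (?q m \<ominus>\<^bsub>W\<^esub> ?q n) < e" by blast
    qed (use q in auto)
    \<comment> \<open>Completeness of \<open>W\<close> yields some limit of the images; the closed
      graph identifies it.\<close>
    then have "w = T u z" using graph u pz by blast
    then have lim: "(\<lambda>i. nrm W (\<zero>\<^bsub>W\<^esub> \<ominus>\<^bsub>W\<^esub> ?q i)) \<longlonglongrightarrow> nrm W (\<zero>\<^bsub>W\<^esub> \<ominus>\<^bsub>W\<^esub> T u z)"
      using W.tends_nrm_minus[OF w W.M.zero_closed] by simp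
    have "T u \<zero>\<^bsub>Z\<^esub> = \<zero>\<^bsub>W\<^esub>"
      using smult[OF u, of "\<zero>\<^bsub>Z\<^esub>" 0] closed[OF u] by simp
    then have "nrm W (\<zero>\<^bsub>W\<^esub> \<ominus>\<^bsub>W\<^esub> ?q i) \<le> 4 * k" for i
      using diff'[of 0 i] p(3) q by simp
    then have "nrm W (\<zero>\<^bsub>W\<^esub> \<ominus>\<^bsub>W\<^esub> T u z) \<le> 4 * k"
      by (intro LIMSEQ_le_const2[OF lim]) blast
    then show ?thesis using closed u z by simp
  qed
  \<comment> \<open>The factor \<open>r / 2\<close> moves the closed unit ball into the open ball of
    radius \<open>r\<close>.\<close>
  have "nrm W (T u x) \<le> 2 / r * (4 * k)" if u: "u \<in> I" and x: "x \<in> carrier Z" "nrm Z x \<le> 1" for u x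
  proof -
    let ?a = "of_real (r / 2) :: 'k"
    have a: "norm ?a = r / 2" using r by (simp del: of_real_divide)
    have "nrm Z (?a \<odot>\<^bsub>Z\<^esub> x) \<le> r / 2 * 1"
      using x a r by (simp add: Z.nrm_smult mult_left_le del: of_real_divide)
    then have "nrm W (T u (?a \<odot>\<^bsub>Z\<^esub> x)) \<le> 4 * k" using bound[OF u, of "?a \<odot>\<^bsub>Z\<^esub> x"] x r by simp
    then have "r / 2 * nrm W (T u x) \<le> 4 * k"
      using u x a closed by (simp add: smult W.nrm_smult del: of_real_divide)
    then show ?thesis using r by (simp add: field_simps)
  qed
  then show ?thesis by blast
qed

text \<open>In \<open>B k x\<close> the first \<open>k\<close> coordinates range over unit balls and
  the others are frozen at those of \<open>x\<close>; boundedness of \<open>A\<close> on these sets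
  is shown by induction on \<open>k\<close>. To free variable \<open>k\<close>, the uniform bound is
  applied to the maps \<open>z \<mapsto> A (y(k := z))\<close>, indexed by the points
  \<open>y\<close> of \<open>B (Suc k) x\<close>. Uniformity in \<open>y\<close> turns separate
  bounds into a joint one.\<close>

lemma (in multilinear_on) closed_graph_continuous:
  assumes "banach_space F" and "\<And>E. E \<in> set Es \<Longrightarrow> banach_space E"
    and graph: "\<And>i x p l w. i < length Es \<Longrightarrow> x \<in> prod_carrier Es \<Longrightarrow> nspace_on.tends (Es ! i) p l \<Longrightarrow>
      tends (\<lambda>j. A (x(i := p j))) w \<Longrightarrow> w = A (x(i := l))"
  shows "continuous_multilinear Es F A"
proof -
  define B where "B k x = {y \<in> prod_carrier Es. \<forall>i<length Es.
    if i < k then nrm (Es ! i) (y i) \<le> 1 else y i = x i}" for k x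
  have "\<exists>K. \<forall>y\<in>B k x. nrm F (A y) \<le> K" if "k \<le> length Es" "x \<in> prod_carrier Es" for k x
    using that
  proof (induction k arbitrary: x)
    case 0
    have "y = x" if "y \<in> B 0 x" for y
      using 0 that by (intro prod_carrier_eqI) (auto simp: B_def)
    then show ?case by blast
  next
    case (Suc k)
    then have k: "k < length Es" by simp
    interpret E: bspace_on "Es ! k" using assms(2) k by (simp add: bspace_on_iff)
    have Bc: "y \<in> prod_carrier Es" if "y \<in> B j x" for y j x using that by (simp add: B_def)
    have "\<exists>K. \<forall>y\<in>B (Suc k) x. \<forall>z\<in>carrier (Es ! k). nrm (Es ! k) z \<le> 1 \<longrightarrow> nrm F (A (y(k := z))) \<le> K"
    proof (rule closed_graph_uniform_bound)
      show "bspace_on F" using assms by (simp add: bspace_on_iff)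
      show "\<exists>K. \<forall>y\<in>B (Suc k) x. nrm F (A (y(k := z))) \<le> K" if z: "z \<in> carrier (Es ! k)" for z
      proof -
        \<comment> \<open>For a single \<open>z\<close>, variable \<open>k\<close> is frozen at
          \<open>z\<close>, so the pointwise bound is the induction hypothesis at the base point
          \<open>x(k := z)\<close>; hence \<open>arbitrary: x\<close>.\<close>
        have "y(k := z) \<in> B k (x(k := z))" if "y \<in> B (Suc k) x" for y
          using that z k by (auto simp: B_def prod_carrier_upd less_Suc_eq)
        then show ?thesis
          using Suc.IH[of "x(k := z)"] Suc.prems z k by (meson less_imp_le prod_carrier_upd)
      qed
    qed (use k Bc graph E.bspace_on_axioms in \<open>auto simp: map_add map_smult closed prod_carrier_upd\<close>)
    then obtain K where K: "\<And>y z. y \<in> B (Suc k) x \<Longrightarrow> z \<in> carrier (Es ! k) \<Longrightarrow> nrm (Es ! k) z \<le> 1 \<Longrightarrow>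
        nrm F (A (y(k := z))) \<le> K" by blast
    have "nrm F (A y) \<le> K" if y: "y \<in> B (Suc k) x" for y
    proof -
      have "nrm (Es ! k) (y k) \<le> 1" using y k by (auto simp: B_def)
      then show ?thesis using K[OF y prod_carrier_nth[OF Bc[OF y] k]] by simp
    qed
    then show ?case by blast
  qed
  from this[OF order.refl prod_ball_subset[OF zero_in_ball]]
  obtain K where "\<forall>y\<in>B (length Es) (\<lambda>i\<in>{..<length Es}. \<zero>\<^bsub>Es ! i\<^esub>). nrm F (A y) \<le> K" by blast
  then show ?thesis by (intro continuousI[of K]) (auto simp: B_def prod_ball_def)
qed


section \<open>Spaces of operators and the scalar space\<close>

lemma multilinear_onI:
  assumes "normed_space F" "\<And>E. E \<in> set Es \<Longrightarrow> normed_space E"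
    and "\<And>x. x \<in> prod_carrier Es \<Longrightarrow> A x \<in> carrier F"
    and "\<And>i x u v. i < length Es \<Longrightarrow> x \<in> prod_carrier Es \<Longrightarrow> u \<in> carrier (Es ! i) \<Longrightarrow> v \<in> carrier (Es ! i) \<Longrightarrow>
      A (x(i := u \<oplus>\<^bsub>Es ! i\<^esub> v)) = A (x(i := u)) \<oplus>\<^bsub>F\<^esub> A (x(i := v))"
    and "\<And>i x u a. i < length Es \<Longrightarrow> x \<in> prod_carrier Es \<Longrightarrow> u \<in> carrier (Es ! i) \<Longrightarrow>
      A (x(i := a \<odot>\<^bsub>Es ! i\<^esub> u)) = a \<odot>\<^bsub>F\<^esub> A (x(i := u))"
  shows "multilinear_on F Es A"
  using assms by unfold_locales (auto simp: multilinear_def)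

lemma multilinear_ops_onD:
  assumes "normed_space F" "\<And>E. E \<in> set Es \<Longrightarrow> normed_space E" "A \<in> multilinear_ops Es F"
  shows "continuous_multilinear_on F Es A"
  using assms by (intro continuous_multilinear_onI) (auto simp: multilinear_space_def)

lemma (in multilinear_on) restrict:
  "multilinear_on F Es (\<lambda>x\<in>prod_carrier Es. A x)"
proof (rule multilinear_onI[OF normed factors])
  fix i x u v a
  assume i: "i < length Es" "x \<in> prod_carrier Es" "u \<in> carrier (Es ! i)"
  interpret E: nspace_on "Es ! i" using i factor by blast
  show "(\<lambda>x\<in>prod_carrier Es. A x) (x(i := a \<odot>\<^bsub>Es ! i\<^esub> u)) = a \<odot> (\<lambda>x\<in>prod_carrier Es. A x) (x(i := u))"
    using i by (simp add: prod_carrier_upd map_smult)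
  assume v: "v \<in> carrier (Es ! i)"
  show "(\<lambda>x\<in>prod_carrier Es. A x) (x(i := u \<oplus>\<^bsub>Es ! i\<^esub> v)) =
      (\<lambda>x\<in>prod_carrier Es. A x) (x(i := u)) \<oplus> (\<lambda>x\<in>prod_carrier Es. A x) (x(i := v))"
    using i v by (simp add: prod_carrier_upd map_add)
qed (auto simp: closed)

lemma (in multilinear_on) restrict_in_multilinear_ops:
  assumes "\<And>x. x \<in> prod_ball Es \<Longrightarrow> nrm F (A x) \<le> C"
  shows "(\<lambda>x\<in>prod_carrier Es. A x) \<in> multilinear_ops Es F"
  using multilinear_on.continuousI[OF restrict, of C] assms
  by (auto simp: multilinear_space_def prod_ball_subset)

lemma multilinear_space_simps:
  "A \<oplus>\<^bsub>multilinear_space Es F\<^esub> B = (\<lambda>x\<in>prod_carrier Es. A x \<oplus>\<^bsub>F\<^esub> B x)"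
  "a \<odot>\<^bsub>multilinear_space Es F\<^esub> A = (\<lambda>x\<in>prod_carrier Es. a \<odot>\<^bsub>F\<^esub> A x)"
  "\<zero>\<^bsub>multilinear_space Es F\<^esub> = (\<lambda>x\<in>prod_carrier Es. \<zero>\<^bsub>F\<^esub>)"
  by (simp_all add: multilinear_space_def)

lemma multilinear_ops_restrict: "A \<in> multilinear_ops Es F \<Longrightarrow> (\<lambda>x\<in>prod_carrier Es. A x) = A"
  by (auto simp: multilinear_space_def extensional_restrict)

locale multilinear_space_on = nspace_on F for F :: "('k::real_or_complex, 'b) nspace" (structure) +
  fixes Es :: "('k, 'a) nspace list"
  assumes normed_factors: "\<And>E. E \<in> set Es \<Longrightarrow> normed_space E"
begin

lemma opsD: "A \<in> multilinear_ops Es F \<Longrightarrow> continuous_multilinear_on F Es A"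
  using multilinear_ops_onD normed normed_factors by blast

lemma ops_closed: "A \<in> multilinear_ops Es F \<Longrightarrow> x \<in> prod_carrier Es \<Longrightarrow> A x \<in> carrier F"
  using opsD multilinear_on.closed[of F Es A x] by (simp add: continuous_multilinear_on_def)

lemma ops_eqI:
  "A \<in> multilinear_ops Es F \<Longrightarrow> B \<in> multilinear_ops Es F \<Longrightarrow> (\<And>x. x \<in> prod_carrier Es \<Longrightarrow> A x = B x) \<Longrightarrow> A = B"
  by (auto simp: multilinear_space_def intro: extensionalityI)

lemma ops_zero: "\<zero>\<^bsub>multilinear_space Es F\<^esub> \<in> multilinear_ops Es F"
proof -
  interpret multilinear_on F Es "\<lambda>x. \<zero>"
    by (rule multilinear_onI) (auto simp: normed normed_factors)
  show ?thesis unfolding multilinear_space_simps by (rule restrict_in_multilinear_ops[of 0]) simp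
qed

lemma ops_add:
  assumes "A \<in> multilinear_ops Es F" "B \<in> multilinear_ops Es F"
  shows "A \<oplus>\<^bsub>multilinear_space Es F\<^esub> B \<in> multilinear_ops Es F"
proof -
  interpret A: continuous_multilinear_on F Es A using assms opsD by blast
  interpret B: continuous_multilinear_on F Es B using assms opsD by blast
  interpret multilinear_on F Es "\<lambda>x. A x \<oplus> B x"
    by (rule multilinear_onI) (auto simp: normed normed_factors A.closed B.closed A.map_add B.map_add
      A.map_smult B.map_smult smult_r_distr prod_carrier_upd M.a_ac)
  show ?thesis unfolding multilinear_space_simps
  proof (rule restrict_in_multilinear_ops)
    fix x assume x: "x \<in> prod_ball Es"
    then have "nrm F (A x \<oplus> B x) \<le> nrm F (A x) + nrm F (B x)"
      by (intro nrm_triangle A.closed B.closed) (auto intro: prod_ball_subset)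
    then show "nrm F (A x \<oplus> B x) \<le> multilinear_norm Es F A + multilinear_norm Es F B"
      using A.nrm_le_norm[OF x] B.nrm_le_norm[OF x] by simp
  qed
qed

lemma ops_smult:
  assumes "A \<in> multilinear_ops Es F"
  shows "a \<odot>\<^bsub>multilinear_space Es F\<^esub> A \<in> multilinear_ops Es F"
proof -
  interpret A: continuous_multilinear_on F Es A using assms opsD by blast
  interpret multilinear_on F Es "\<lambda>x. a \<odot> A x"
    by (rule multilinear_onI) (auto simp: normed normed_factors A.closed A.map_add
      A.map_smult smult_r_distr prod_carrier_upd mult.commute simp flip: smult_assoc)
  show ?thesis unfolding multilinear_space_simps
  proof (rule restrict_in_multilinear_ops)
    fix x assume x: "x \<in> prod_ball Es"
    then show "nrm F (a \<odot> A x) \<le> norm a * multilinear_norm Es F A"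
      using A.nrm_le_norm[OF x] A.closed by (simp add: nrm_smult prod_ball_subset mult_left_mono)
  qed
qed

text \<open>Stated for an arbitrary stable set and an arbitrary norm, so that one verification of
  the axioms serves the space of all operators and the space of summing operators with its own
  norm.\<close>

lemma sub_module:
  assumes H: "H \<subseteq> multilinear_ops Es F"
    and zero: "\<zero>\<^bsub>multilinear_space Es F\<^esub> \<in> H"
    and add: "\<And>A B. A \<in> H \<Longrightarrow> B \<in> H \<Longrightarrow> A \<oplus>\<^bsub>multilinear_space Es F\<^esub> B \<in> H"
    and smult: "\<And>a A. A \<in> H \<Longrightarrow> a \<odot>\<^bsub>multilinear_space Es F\<^esub> A \<in> H"
  shows "Module.module scalar_ring ((multilinear_space Es F)\<lparr>carrier := H, nrm := \<nu>\<rparr>)"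
proof (rule scalar_module_intro, goal_cases)
  case (3 A B C)
  then show ?case using H by (auto simp: multilinear_space_simps fun_eq_iff restrict_def ops_closed M.a_assoc subset_iff)
next
  case (4 A B)
  then show ?case using H by (auto simp: multilinear_space_simps fun_eq_iff restrict_def ops_closed M.a_comm subset_iff)
next
  case (5 A)
  then have A: "A \<in> multilinear_ops Es F" using H by auto
  \<comment> \<open>Adding zero produces a restriction to the domain, which is \<open>A\<close>
    again by extensionality.\<close>
  then show ?case
    by (subst (2) multilinear_ops_restrict[OF A, symmetric])
      (auto simp: multilinear_space_simps fun_eq_iff restrict_def ops_closed)
next
  case (7 A)
  then show ?case using H by (auto simp: multilinear_space_simps fun_eq_iff restrict_def ops_closed subset_iff)
next
  case (8 a b A)
  then show ?case using H by (auto simp: multilinear_space_simps fun_eq_iff restrict_def ops_closed smult_add_left subset_iff)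
next
  case (9 a A B)
  then show ?case using H by (auto simp: multilinear_space_simps fun_eq_iff restrict_def ops_closed smult_r_distr subset_iff)
next
  case (10 a b A)
  then show ?case using H by (auto simp: multilinear_space_simps fun_eq_iff restrict_def ops_closed smult_assoc subset_iff)
next
  case (11 A)
  then have A: "A \<in> multilinear_ops Es F" using H by auto
  then show ?case
    by (subst (2) multilinear_ops_restrict[OF A, symmetric])
      (auto simp: multilinear_space_simps fun_eq_iff restrict_def ops_closed)
qed (use zero add smult in auto)

lemma module: "Module.module scalar_ring (multilinear_space Es F)"
proof -
  have "(multilinear_space Es F)\<lparr>carrier := multilinear_ops Es F, nrm := nrm (multilinear_space Es F)\<rparr> = multilinear_space Es F"
    by simp
  then show ?thesis
    using sub_module[OF order.refl ops_zero ops_add ops_smult, of "nrm (multilinear_space Es F)"] by simp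
qed

lemma submoduleI:
  assumes H: "H \<subseteq> multilinear_ops Es F"
    and zero: "\<zero>\<^bsub>multilinear_space Es F\<^esub> \<in> H"
    and add: "\<And>A B. A \<in> H \<Longrightarrow> B \<in> H \<Longrightarrow> A \<oplus>\<^bsub>multilinear_space Es F\<^esub> B \<in> H"
    and smult: "\<And>a A. A \<in> H \<Longrightarrow> a \<odot>\<^bsub>multilinear_space Es F\<^esub> A \<in> H"
  shows "submodule H scalar_ring (multilinear_space Es F)"
proof -
  interpret L: Module.module scalar_ring "multilinear_space Es F" by (rule module)
  show ?thesis
  proof (rule L.submoduleI[OF H zero _ add smult])
    fix A assume A: "A \<in> H"
    then have "A \<in> multilinear_ops Es F" using H by blast
    then have "\<ominus>\<^bsub>multilinear_space Es F\<^esub> A = (- 1) \<odot>\<^bsub>multilinear_space Es F\<^esub> A"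
      using L.smult_l_minus[of 1 A] L.smult_one[of A] by simp
    then show "\<ominus>\<^bsub>multilinear_space Es F\<^esub> A \<in> H" using smult[OF A] by simp
  qed
qed

end

text \<open>The explicit constant allows estimates to be passed on without computing a
  supremum.\<close>

definition bounded_linear_map ::
  "('k::real_or_complex, 'a) nspace \<Rightarrow> ('k, 'b) nspace \<Rightarrow> real \<Rightarrow> ('a \<Rightarrow> 'b) \<Rightarrow> bool"
  where "bounded_linear_map E F C u \<longleftrightarrow>
    (\<forall>x\<in>carrier E. u x \<in> carrier F \<and> nrm F (u x) \<le> C * nrm E x) \<and>
    (\<forall>x\<in>carrier E. \<forall>y\<in>carrier E. u (x \<oplus>\<^bsub>E\<^esub> y) = u x \<oplus>\<^bsub>F\<^esub> u y) \<and>
    (\<forall>a. \<forall>x\<in>carrier E. u (a \<odot>\<^bsub>E\<^esub> x) = a \<odot>\<^bsub>F\<^esub> u x)"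

lemma bounded_linear_map_multilinear_on:
  assumes "normed_space E" "normed_space F" "bounded_linear_map E F C u"
  shows "multilinear_on F [E] (\<lambda>x. u (x 0))"
  using assms by (intro multilinear_onI) (auto simp: bounded_linear_map_def prod_carrier_nth[of _ "[E]" 0, simplified])

text \<open>A linear operator is viewed as a multilinear one on the list \<open>[E]\<close>. The two
  unit balls correspond, so \<open>linear_norm\<close> is the multilinear norm, and the bound is the
  multilinear one.\<close>

lemma linear_ops_bounded:
  assumes "normed_space E" "normed_space F" "u \<in> linear_ops E F"
  shows "bounded_linear_map E F (linear_norm E F u) u" and "0 \<le> linear_norm E F u"
proof -
  interpret E: nspace_on E using assms by (simp add: nspace_on_def)
  interpret F: nspace_on F using assms by (simp add: nspace_on_def)
  have u: "continuous_map (nspace_topology E) (nspace_topology F) u"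
    and lin: "\<And>x y. x \<in> carrier E \<Longrightarrow> y \<in> carrier E \<Longrightarrow> u (x \<oplus>\<^bsub>E\<^esub> y) = u x \<oplus>\<^bsub>F\<^esub> u y"
      "\<And>a x. x \<in> carrier E \<Longrightarrow> u (a \<odot>\<^bsub>E\<^esub> x) = a \<odot>\<^bsub>F\<^esub> u x"
    using assms by (auto simp: linear_ops_def)
  have closed: "u x \<in> carrier F" if "x \<in> carrier E" for x
    using continuous_map_funspace[OF u] that by auto
  have "multilinear_on F [E] (\<lambda>x. u (x 0))"
    using assms(1,2) lin closed
    by (intro multilinear_onI) (auto simp: prod_carrier_nth[of _ "[E]" 0, simplified])
  moreover have "continuous_map (product_topology (\<lambda>i. nspace_topology ([E] ! i)) {..<length [E]}) (nspace_topology F)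
      (\<lambda>x. u (x 0))"
    using continuous_map_compose[OF continuous_map_product_projection[of 0 "{..<length [E]}" "\<lambda>i. nspace_topology ([E] ! i)"], of _ u]
      u by (simp add: o_def)
  ultimately interpret A: continuous_multilinear_on F "[E]" "\<lambda>x. u (x 0)"
    by (auto simp: continuous_multilinear_on_def continuous_multilinear_on_axioms_def
      continuous_multilinear_def multilinear_on.multilinear)
  have P: "(\<lambda>i\<in>{..<1}. x) \<in> prod_carrier [E]" if "x \<in> carrier E" for x
    using that by (auto simp: prod_carrier_def PiE_iff)
  have "(\<lambda>x. nrm F (u (x 0))) ` prod_ball [E] = (\<lambda>x. nrm F (u x)) ` {x \<in> carrier E. nrm E x \<le> 1}"
  proof (intro equalityI subsetI)
    fix r assume "r \<in> (\<lambda>x. nrm F (u x)) ` {x \<in> carrier E. nrm E x \<le> 1}"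
    then obtain x where x: "x \<in> carrier E" "nrm E x \<le> 1" "r = nrm F (u x)" by auto
    then have "(\<lambda>i\<in>{..<1}. x) \<in> prod_ball [E]" using P by (simp add: prod_ball_def)
    then show "r \<in> (\<lambda>x. nrm F (u (x 0))) ` prod_ball [E]"
      using x by (intro image_eqI[of _ _ "\<lambda>i\<in>{..<1}. x"]) auto
  qed (auto simp: prod_ball_def dest: prod_carrier_nth[of _ "[E]" 0, simplified])
  then have norm: "multilinear_norm [E] F (\<lambda>x. u (x 0)) = linear_norm E F u"
    by (simp add: multilinear_norm_eq linear_norm_def)
  have "nrm F (u x) \<le> linear_norm E F u * nrm E x" if "x \<in> carrier E" for x
    using A.nrm_le[OF P[OF that]] by (simp add: norm)
  then show "bounded_linear_map E F (linear_norm E F u) u" using lin closed by (auto simp: bounded_linear_map_def)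
  show "0 \<le> linear_norm E F u" using A.norm_nonneg by (simp add: norm)
qed

lemma bounded_linear_map_linear_ops:
  assumes "normed_space E" "normed_space F" "bounded_linear_map E F C u"
  shows "u \<in> linear_ops E F"
proof -
  interpret E: nspace_on E using assms by (simp add: nspace_on_def)
  interpret F: nspace_on F using assms by (simp add: nspace_on_def)
  have u: "\<And>x. x \<in> carrier E \<Longrightarrow> u x \<in> carrier F" "\<And>x. x \<in> carrier E \<Longrightarrow> nrm F (u x) \<le> C * nrm E x"
     "\<And>x y. x \<in> carrier E \<Longrightarrow> y \<in> carrier E \<Longrightarrow> u (x \<oplus>\<^bsub>E\<^esub> y) = u x \<oplus>\<^bsub>F\<^esub> u y"
      "\<And>a x. x \<in> carrier E \<Longrightarrow> u (a \<odot>\<^bsub>E\<^esub> x) = a \<odot>\<^bsub>F\<^esub> u x"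
    using assms(3) by (auto simp: bounded_linear_map_def)
  have minus: "u x \<ominus>\<^bsub>F\<^esub> u y = u (x \<ominus>\<^bsub>E\<^esub> y)" if "x \<in> carrier E" "y \<in> carrier E" for x y
    using that u by (simp add: E.minus_eq_add_smult F.minus_eq_add_smult)
  have "continuous_map (nspace_topology E) (nspace_topology F) u"
    unfolding E.nspace_topology_eq F.nspace_topology_eq E.metric_continuous_map[OF F.Metric_space_axioms]
  proof (intro conjI ballI allI impI)
    fix a and e :: real assume a: "a \<in> carrier E" and e: "0 < e"
    \<comment> \<open>\<open>max C 0 + 1\<close> is a positive Lipschitz constant, so it may be
      divided by.\<close>
    have "nrm F (u a \<ominus>\<^bsub>F\<^esub> u x) < e" if x: "x \<in> carrier E" "nrm E (a \<ominus>\<^bsub>E\<^esub> x) < e / (max C 0 + 1)" for x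
    proof -
      have "nrm F (u a \<ominus>\<^bsub>F\<^esub> u x) \<le> C * nrm E (a \<ominus>\<^bsub>E\<^esub> x)" using a x u by (simp add: minus)
      also have "\<dots> \<le> (max C 0 + 1) * nrm E (a \<ominus>\<^bsub>E\<^esub> x)" using a x by (intro mult_right_mono) auto
      also have "\<dots> < e" using x(2) by (simp add: pos_less_divide_eq mult.commute add_nonneg_pos)
      finally show ?thesis .
    qed
    then show "\<exists>\<delta>>0. \<forall>x. x \<in> carrier E \<and> nspace_dist E a x < \<delta> \<longrightarrow> nspace_dist F (u a) (u x) < e"
      using a e u by (intro exI[of _ "e / (max C 0 + 1)"]) (auto simp: nspace_dist_def)
  qed (use u in auto)
  then show ?thesis using u by (simp add: linear_ops_def)
qed

section \<open>The scalar field as a Banach space\<close>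

lemma isometry_Cauchy_convergent:
  fixes p :: "nat \<Rightarrow> 'a::real_normed_vector" and f :: "'a \<Rightarrow> 'b::banach"
  assumes f: "bij f" "\<forall>x y. f (x + y) = f x + f y" "\<forall>x. norm (f x) = norm x" and "Cauchy p"
  shows "convergent p"
proof -
  have "f (x - y) + f y = f x" for x y using f(2)[rule_format, of "x - y" y] by simp
  then have minus: "f (x - y) = f x - f y" for x y by (simp add: eq_diff_eq)
  have dist: "dist (f x) (f y) = dist x y" for x y by (simp add: dist_norm f(3) flip: minus)
  have "Cauchy (\<lambda>i. f (p i))" using assms by (simp add: Cauchy_def dist)
  then obtain l where "(\<lambda>i. f (p i)) \<longlonglongrightarrow> l" using Cauchy_convergent convergent_def by blast
  moreover obtain l' where "l = f l'" using f(1) by (metis bij_pointE)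
  ultimately have "p \<longlonglongrightarrow> l'" by (simp add: LIMSEQ_def dist)
  then show ?thesis by (rule convergentI)
qed

text \<open>The class provides a norm-preserving field isomorphism onto the real or the complex
  numbers, along which completeness is pulled back.\<close>

lemma real_or_complex_Cauchy_convergent:
  fixes p :: "nat \<Rightarrow> 'k::real_or_complex"
  assumes "Cauchy p"
  shows "convergent p"
  using real_or_complex[where 'a = 'k]
proof (elim disjE exE conjE)
qed (use assms in \<open>blast intro: isometry_Cauchy_convergent\<close>)+

lemma scalar_space_simps:
  assumes "inj \<iota>"
  shows "carrier (scalar_space \<iota>) = range \<iota>" "\<zero>\<^bsub>scalar_space \<iota>\<^esub> = \<iota> 0"
    "\<iota> a \<oplus>\<^bsub>scalar_space \<iota>\<^esub> \<iota> b = \<iota> (a + b)" "c \<odot>\<^bsub>scalar_space \<iota>\<^esub> \<iota> a = \<iota> (c * a)" "nrm (scalar_space \<iota>) (\<iota> a) = norm a"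
  using assms by (simp_all add: scalar_space_def)

lemma scalar_space_banach:
  fixes \<iota> :: "'k::real_or_complex \<Rightarrow> 'a"
  assumes "inj \<iota>"
  shows "banach_space (scalar_space \<iota>)"
proof -
  note [simp] = scalar_space_simps[OF assms]
  have inj [simp]: "\<iota> a = \<iota> b \<longleftrightarrow> a = b" for a b using assms by (simp add: inj_eq)
  have "Module.module scalar_ring (scalar_space \<iota>)"
    by (rule scalar_module_intro) (auto simp: algebra_simps)
  then have "normed_space (scalar_space \<iota>)"
    by (auto simp: normed_space_def norm_mult norm_triangle_ineq)
  then interpret nspace_on "scalar_space \<iota>" by (simp add: nspace_on_def)
  have minus [simp]: "\<iota> a \<ominus>\<^bsub>scalar_space \<iota>\<^esub> \<iota> b = \<iota> (a - b)" for a b by (simp add: minus_eq_add_smult)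
  have "bspace_on (scalar_space \<iota>)"
  proof (rule bspace_onI)
    fix p :: "nat \<Rightarrow> 'a" assume p: "\<And>i. p i \<in> carrier (scalar_space \<iota>)"
      and C: "\<And>e. e > 0 \<Longrightarrow> \<exists>N. \<forall>m\<ge>N. \<forall>n\<ge>N. nrm (scalar_space \<iota>) (p m \<ominus>\<^bsub>scalar_space \<iota>\<^esub> p n) < e"
    from p have "\<forall>i. \<exists>a. p i = \<iota> a" by auto
    then obtain q :: "nat \<Rightarrow> 'k" where q: "\<And>i. p i = \<iota> (q i)" by metis
    have "Cauchy q" unfolding Cauchy_def using C by (simp add: q dist_norm)
    then obtain l where "q \<longlonglongrightarrow> l" using real_or_complex_Cauchy_convergent convergent_def by blast
    then have "tends p (\<iota> l)" by (simp add: tends_def q LIM_zero_iff tendsto_norm_zero_iff)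
    then show "\<exists>l. tends p l" ..
  qed
  then show ?thesis by (simp add: bspace_on_iff)
qed

text \<open>Used on both sides: for \<open>X\<close> to embed single vectors as sequences, for
  \<open>Y\<close> to attach the vector of an elementary operator.\<close>

lemma scalar_smult_bounded:
  fixes \<iota> :: "'k::real_or_complex \<Rightarrow> 'a" and F :: "('k, 'b) nspace"
  assumes "inj \<iota>" "normed_space F" "b \<in> carrier F"
  shows "bounded_linear_map (scalar_space \<iota>) F (nrm F b) (\<lambda>x. inv_into UNIV \<iota> x \<odot>\<^bsub>F\<^esub> b)"
proof -
  interpret F: nspace_on F using assms by (simp add: nspace_on_def)
  show ?thesis using assms
    by (auto simp: bounded_linear_map_def scalar_space_simps F.nrm_smult F.smult_add_left F.smult_assoc)
qed


section \<open>Sequence classes and induced operators\<close>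

locale seq_space_on = E: bspace_on E + S: bspace_on S
  for E :: "('k::real_or_complex, 'a) nspace" and S :: "('k, nat \<Rightarrow> 'a) nspace" +
  assumes embeds: "embeds S (linfty E)"
begin

lemma coord_closed: "s \<in> carrier S \<Longrightarrow> s j \<in> carrier E"
  and nrm_coord_le: "s \<in> carrier S \<Longrightarrow> nrm E (s j) \<le> nrm S s"
proof -
  assume "s \<in> carrier S"
  then have s: "s \<in> carrier (linfty E)" "nrm (linfty E) s \<le> nrm S s"
    using embeds by (auto simp: embeds_def)
  then show "s j \<in> carrier E" by (simp add: linfty_def)
  have "nrm E (s j) \<le> (SUP j. nrm E (s j))"
    using s by (intro cSUP_upper) (auto simp: linfty_def)
  then show "nrm E (s j) \<le> nrm S s" using s by (simp add: linfty_def)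
qed

lemma add_eq: "s \<in> carrier S \<Longrightarrow> t \<in> carrier S \<Longrightarrow> s \<oplus>\<^bsub>S\<^esub> t = (\<lambda>j. s j \<oplus>\<^bsub>E\<^esub> t j)"
  and smult_eq: "s \<in> carrier S \<Longrightarrow> a \<odot>\<^bsub>S\<^esub> s = (\<lambda>j. a \<odot>\<^bsub>E\<^esub> s j)"
  using embeds by (auto simp: embeds_def linfty_def)

text \<open>\<open>embeds\<close> compares sums and scalar multiples but not the zero elements, so
  zero is rewritten as a scalar multiple.\<close>

lemma zero_eq: "\<zero>\<^bsub>S\<^esub> = (\<lambda>j. \<zero>\<^bsub>E\<^esub>)"
proof -
  have "\<zero>\<^bsub>S\<^esub> = 0 \<odot>\<^bsub>S\<^esub> \<zero>\<^bsub>S\<^esub>" by simp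
  also have "\<dots> = (\<lambda>j. 0 \<odot>\<^bsub>E\<^esub> \<zero>\<^bsub>S\<^esub> j)" by (rule smult_eq) simp
  also have "\<dots> = (\<lambda>j. \<zero>\<^bsub>E\<^esub>)" using coord_closed[OF S.M.zero_closed] by simp
  finally show ?thesis .
qed

lemma minus_eq:
  assumes "s \<in> carrier S" "t \<in> carrier S"
  shows "s \<ominus>\<^bsub>S\<^esub> t = (\<lambda>j. s j \<ominus>\<^bsub>E\<^esub> t j)"
proof -
  have "s \<ominus>\<^bsub>S\<^esub> t = (\<lambda>j. s j \<oplus>\<^bsub>E\<^esub> ((- 1) \<odot>\<^bsub>S\<^esub> t) j)"
    using assms by (simp add: S.minus_eq_add_smult add_eq)
  then show ?thesis using assms by (simp add: smult_eq E.minus_eq_add_smult coord_closed)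
qed

lemma nrm_coord_minus_le:
  assumes "s \<in> carrier S" "t \<in> carrier S"
  shows "nrm E (s j \<ominus>\<^bsub>E\<^esub> t j) \<le> nrm S (s \<ominus>\<^bsub>S\<^esub> t)"
  using nrm_coord_le[OF S.minus_closed'[OF assms], of j] by (simp add: minus_eq assms)

lemma tends_coord: "S.tends p l \<Longrightarrow> E.tends (\<lambda>i. p i j) (l j)"
  by (rule E.tends_I[where b = "\<lambda>i. nrm S (p i \<ominus>\<^bsub>S\<^esub> l)"])
    (auto simp: S.tends_def coord_closed nrm_coord_minus_le)

end

lemma sequence_class_space:
  assumes "sequence_class \<iota> X" "banach_space E"
  shows "seq_space_on E (X E)"
  using assms by (simp add: seq_space_on_def seq_space_on_axioms_def bspace_on_iff sequence_class_def)

lemma banach_imp_normed: "banach_space E \<Longrightarrow> normed_space E"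
  by (simp add: banach_space_def)

text \<open>Exchanging one sequence means exchanging one argument in every coordinate; this reduces
  multilinearity and limits of induced operators to those of \<open>A\<close>.\<close>

lemma induced_upd:
  "i < n \<Longrightarrow> induced n A (s(i := u)) j = A ((\<lambda>m\<in>{..<n}. s m j)(i := u j))"
  by (auto simp: induced_def intro!: arg_cong[of _ _ A])

lemma induced_eq: "induced n A s j = A (\<lambda>m\<in>{..<n}. s m j)"
  by (simp add: induced_def)

lemma prod_carrier_slice:
  assumes "sequence_class \<iota> X" "\<And>E. E \<in> set Es \<Longrightarrow> banach_space E" "s \<in> prod_carrier (map X Es)"
  shows "(\<lambda>m\<in>{..<length Es}. s m j) \<in> prod_carrier Es"
proof (rule prod_carrier_restrict)
  fix i assume i: "i < length Es"
  interpret seq_space_on "Es ! i" "X (Es ! i)" using assms i by (intro sequence_class_space) auto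
  show "s i j \<in> carrier (Es ! i)" using prod_carrier_nth[OF assms(3), of i] i by (simp add: coord_closed)
qed

section \<open>Consequences of the stability of \<open>X\<close> and \<open>Y\<close>\<close>

locale summing_pair =
  fixes \<iota> :: "'k::real_or_complex \<Rightarrow> 'a"
    and X Y :: "('k, 'a) nspace \<Rightarrow> ('k, nat \<Rightarrow> 'a) nspace"
  assumes inj: "inj \<iota>"
    and seq_X: "sequence_class \<iota> X" and seq_Y: "sequence_class \<iota> Y"
    and stable_X: "multilinearly_stable X" and stable_Y: "linearly_stable Y"
    and power: "1 \<le> n \<Longrightarrow> power_embeds \<iota> n X Y"
begin

abbreviation K :: "('k, 'a) nspace" where "K \<equiv> scalar_space \<iota>"

lemma banach_K: "banach_space K"
  using inj by (rule scalar_space_banach)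

lemmas K_simps = scalar_space_simps[OF inj]

lemma inv_\<iota> [simp]: "inv_into UNIV \<iota> (\<iota> a) = a"
  using inj by simp

lemma banach_X: "banach_space E \<Longrightarrow> banach_space (X E)"
  and banach_Y: "banach_space E \<Longrightarrow> banach_space (Y E)"
  using seq_X seq_Y by (simp_all add: sequence_class_def)

lemma induced_X:
  assumes "Es \<noteq> []" "\<And>E. E \<in> set Es \<Longrightarrow> banach_space E" "banach_space F" "A \<in> multilinear_ops Es F"
  shows "continuous_multilinear_on (X F) (map X Es) (induced (length Es) A)"
    and "multilinear_norm (map X Es) (X F) (induced (length Es) A) = multilinear_norm Es F A"
proof -
  have s: "continuous_multilinear (map X Es) (X F) (induced (length Es) A) \<and>
      multilinear_norm (map X Es) (X F) (induced (length Es) A) = multilinear_norm Es F A"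
    using stable_X assms unfolding multilinearly_stable_def by blast
  then show "continuous_multilinear_on (X F) (map X Es) (induced (length Es) A)"
    using assms banach_X by (intro continuous_multilinear_onI banach_imp_normed) auto
  show "multilinear_norm (map X Es) (X F) (induced (length Es) A) = multilinear_norm Es F A"
    using s by blast
qed

lemma linear_Y:
  assumes "banach_space E" "banach_space F" "u \<in> linear_ops E F" "s \<in> carrier (Y E)"
  shows "(\<lambda>j. u (s j)) \<in> carrier (Y F)" "nrm (Y F) (\<lambda>j. u (s j)) \<le> linear_norm E F u * nrm (Y E) s"
proof -
  have u: "(\<lambda>s j. u (s j)) \<in> linear_ops (Y E) (Y F)"
      "linear_norm (Y E) (Y F) (\<lambda>s j. u (s j)) = linear_norm E F u"
    using stable_Y assms unfolding linearly_stable_def by blast+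
  have "bounded_linear_map (Y E) (Y F) (linear_norm (Y E) (Y F) (\<lambda>s j. u (s j))) (\<lambda>s j. u (s j))"
    using assms by (intro linear_ops_bounded u banach_imp_normed banach_Y)
  then show "(\<lambda>j. u (s j)) \<in> carrier (Y F)" "nrm (Y F) (\<lambda>j. u (s j)) \<le> linear_norm E F u * nrm (Y E) s"
    using assms(4) by (auto simp: bounded_linear_map_def u(2))
qed

text \<open>Multilinear stability for the one-element list \<open>[E]\<close>.\<close>

lemma linear_X:
  assumes "banach_space E" "banach_space F" "bounded_linear_map E F C u" "0 \<le> C" "s \<in> carrier (X E)"
  shows "(\<lambda>j. u (s j)) \<in> carrier (X F)" "nrm (X F) (\<lambda>j. u (s j)) \<le> C * nrm (X E) s"
proof -
  interpret E: seq_space_on E "X E" using assms seq_X by (intro sequence_class_space)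
  interpret u: multilinear_on F "[E]" "\<lambda>x. u (x 0)"
    using assms by (intro bounded_linear_map_multilinear_on banach_imp_normed)
  define A where "A = (\<lambda>x\<in>prod_carrier [E]. u (x 0))"
  have bound: "nrm F (u (x 0)) \<le> C" if "x \<in> prod_ball [E]" for x
  proof -
    have x: "x 0 \<in> carrier E" "nrm E (x 0) \<le> 1"
      using that by (auto simp: prod_ball_def dest: prod_carrier_nth[of _ "[E]" 0, simplified])
    then have "nrm F (u (x 0)) \<le> C * nrm E (x 0)" using assms(3) by (simp add: bounded_linear_map_def)
    also have "\<dots> \<le> C" using x assms(4) by (simp add: mult_left_le)
    finally show ?thesis .
  qed
  have A: "A \<in> multilinear_ops [E] F" unfolding A_def using bound by (rule u.restrict_in_multilinear_ops)
  have normA: "multilinear_norm [E] F A \<le> C"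
    unfolding A_def using bound by (intro multilinear_on.norm_leI[OF u.restrict]) (simp add: prod_ball_subset)
  interpret A: continuous_multilinear_on "X F" "map X [E]" "induced (length [E]) A"
    using A assms by (intro induced_X) auto
  have norm: "multilinear_norm (map X [E]) (X F) (induced (length [E]) A) = multilinear_norm [E] F A"
    using A assms by (intro induced_X) auto
  define t where "t = (\<lambda>m\<in>{..<1::nat}. s)"
  have t: "t \<in> prod_carrier (map X [E])"
    using assms(5) by (auto simp: t_def prod_carrier_def PiE_iff)
  \<comment> \<open>\<open>A\<close> is \<open>u\<close> made extensional; since the slices lie in
    its domain, it induces the same sequence as \<open>u\<close>.\<close>
  have "(\<lambda>m\<in>{..<1::nat}. s j) \<in> prod_carrier [E]" for j
    using E.coord_closed[OF assms(5)] by (auto simp: prod_carrier_def PiE_iff)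
  then have eq: "induced (length [E]) A t = (\<lambda>j. u (s j))"
    by (simp add: induced_def A_def t_def cong: restrict_cong)
  show "(\<lambda>j. u (s j)) \<in> carrier (X F)" using A.closed[OF t] unfolding eq .
  have "nrm (X F) (\<lambda>j. u (s j)) \<le> multilinear_norm [E] F A * nrm (X E) s"
    using A.nrm_le[OF t] unfolding eq norm by (simp add: t_def)
  also have "\<dots> \<le> C * nrm (X E) s" using normA assms(5) by (intro mult_right_mono) auto
  finally show "nrm (X F) (\<lambda>j. u (s j)) \<le> C * nrm (X E) s" .
qed

definition first :: "('k, 'a) nspace \<Rightarrow> 'a \<Rightarrow> nat \<Rightarrow> 'a"
  where "first E x = (\<lambda>j. if j = 0 then x else \<zero>\<^bsub>E\<^esub>)"

lemma unit_seq_X: "(\<lambda>i. \<iota> (if i = 0 then 1 else 0)) \<in> carrier (X K)" "nrm (X K) (\<lambda>i. \<iota> (if i = 0 then 1 else 0)) = 1"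
proof -
  have "(\<lambda>i. \<iota> (if i = 0 then 1 else 0)) \<in> c00 K"
    by (auto simp: c00_def K_simps intro!: exI[of _ 1])
  then show "(\<lambda>i. \<iota> (if i = 0 then 1 else 0)) \<in> carrier (X K)"
    using seq_X banach_K by (auto simp: sequence_class_def)
  show "nrm (X K) (\<lambda>i. \<iota> (if i = 0 then 1 else 0)) = 1"
    using seq_X by (simp add: sequence_class_def)
qed

lemma first_X:
  assumes "banach_space E" "x \<in> carrier E"
  shows "first E x \<in> carrier (X E)" "nrm (X E) (first E x) \<le> nrm E x"
proof -
  interpret E: bspace_on E using assms by (simp add: bspace_on_iff)
  have "bounded_linear_map K E (nrm E x) (\<lambda>a. inv_into UNIV \<iota> a \<odot>\<^bsub>E\<^esub> x)"
    using inj E.normed assms(2) by (rule scalar_smult_bounded)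
  note * = linear_X[OF banach_K assms(1) this E.nrm_nonneg[OF assms(2)] unit_seq_X(1)]
  have "(\<lambda>j. inv_into UNIV \<iota> (\<iota> (if j = 0 then 1 else 0)) \<odot>\<^bsub>E\<^esub> x) = first E x"
    using assms by (auto simp: first_def fun_eq_iff)
  then show "first E x \<in> carrier (X E)" "nrm (X E) (first E x) \<le> nrm E x"
    using * unit_seq_X(2) by auto
qed

text \<open>The bound by 1 is \<open>power_embeds\<close>. It is attained at
  \<open>(e_0, ..., e_0)\<close>: the product is \<open>e_0\<close> again, which has norm 1 in both
  \<open>X(K)\<close> and \<open>Y(K)\<close>. The supremum is thus a maximum.\<close>

lemma norm_scalar_mult_op:
  assumes n: "1 \<le> n"
  shows "summing_norm X Y (replicate n K) K (scalar_mult_op \<iota> n) = 1"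
proof -
  interpret XK: seq_space_on K "X K" using seq_X banach_K by (rule sequence_class_space)
  let ?I = "induced n (scalar_mult_op \<iota> n)"
  \<comment> \<open>Elements of \<open>X K\<close> take values in the range of
    \<open>\<iota>\<close>, which brings them into the form required by
    \<open>power_embeds\<close>.\<close>
  have ind: "?I s = (\<lambda>j. \<iota> (\<Prod>m<n. inv_into UNIV \<iota> (s m j)))"
      and mem: "\<And>m. m < n \<Longrightarrow> (\<lambda>j. \<iota> (inv_into UNIV \<iota> (s m j))) = s m"
    if s: "s \<in> prod_carrier (replicate n (X K))" for s
  proof -
    have sm: "s m \<in> carrier (X K)" if "m < n" for m using prod_carrier_nth[OF s, of m] that by simp
    have "s m j \<in> range \<iota>" if "m < n" for m j using XK.coord_closed[OF sm[OF that], of j] by (simp add: K_simps)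
    then show "\<And>m. m < n \<Longrightarrow> (\<lambda>j. \<iota> (inv_into UNIV \<iota> (s m j))) = s m"
      by (auto simp: fun_eq_iff f_inv_into_f)
    have "(\<lambda>m\<in>{..<n}. s m j) \<in> prod_carrier (replicate n K)" for j
      using XK.coord_closed[OF sm, of _ j] by (auto simp: prod_carrier_def PiE_iff)
    then show "?I s = (\<lambda>j. \<iota> (\<Prod>m<n. inv_into UNIV \<iota> (s m j)))"
      by (auto simp: induced_def scalar_mult_op_def fun_eq_iff)
  qed
  have le: "nrm (Y K) (?I s) \<le> 1" if "s \<in> prod_ball (replicate n (X K))" for s
  proof -
    have s: "s \<in> prod_carrier (replicate n (X K))" "\<And>m. m < n \<Longrightarrow> nrm (X K) (s m) \<le> 1"
      using that by (auto simp: prod_ball_def)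
    have sm: "s m \<in> carrier (X K)" if "m < n" for m using prod_carrier_nth[OF s(1), of m] that by simp
    have "\<forall>m<n. (\<lambda>j. \<iota> (inv_into UNIV \<iota> (s m j))) \<in> carrier (X K)"
      using sm by (simp add: mem[OF s(1)])
    then have "nrm (Y K) (?I s) \<le> (\<Prod>m<n. nrm (X K) (\<lambda>j. \<iota> (inv_into UNIV \<iota> (s m j))))"
      using power[OF n, unfolded power_embeds_def, rule_format, of "\<lambda>m j. inv_into UNIV \<iota> (s m j)"]
      unfolding ind[OF s(1)] by blast
    also have "\<dots> \<le> 1"
      using s(2) sm by (intro prod_le_1) (auto simp: mem[OF s(1)])
    finally show ?thesis .
  qed
  define t :: "nat \<Rightarrow> nat \<Rightarrow> 'a" where "t = (\<lambda>m\<in>{..<n}. (\<lambda>i. \<iota> (if i = 0 then 1 else 0)))"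
  have t: "t \<in> prod_ball (replicate n (X K))"
    using unit_seq_X by (auto simp: prod_ball_def prod_carrier_def PiE_iff t_def)
  \<comment> \<open>\<open>1 \<le> n\<close> makes the product vanish off coordinate 0; an empty
    product would be 1 everywhere.\<close>
  have "?I t = (\<lambda>j. \<iota> (if j = 0 then 1 else 0))"
    using n by (subst ind[OF prod_ball_subset[OF t]]) (auto simp: t_def fun_eq_iff power_0_left)
  then have nt: "nrm (Y K) (?I t) = 1"
    using seq_Y by (simp add: sequence_class_def)
  have "(SUP s\<in>prod_ball (replicate n (X K)). nrm (Y K) (?I s)) = 1"
  proof (rule cSup_eq_maximum)
    show "1 \<in> (\<lambda>s. nrm (Y K) (?I s)) ` prod_ball (replicate n (X K))"
      using t nt by (intro image_eqI[of _ _ t]) simp_all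
  qed (use le in blast)
  then show ?thesis by (simp add: summing_norm_def multilinear_norm_eq map_replicate)
qed

end

section \<open>Summing operators between fixed spaces and their induced operators\<close>

locale summing_component = summing_pair \<iota> X Y + F: seq_space_on F "Y F"
  for \<iota> :: "'k::real_or_complex \<Rightarrow> 'a" and X Y and F +
  fixes Es :: "('k, 'a) nspace list"
  assumes banach_factors: "\<And>E. E \<in> set Es \<Longrightarrow> banach_space E"
    and nonempty: "Es \<noteq> []"
begin

lemma banach_F: "banach_space F" and banach_YF: "banach_space (Y F)"
  using F.E.bspace_on_axioms F.S.bspace_on_axioms by (simp_all add: bspace_on_iff)

sublocale M: multilinear_space_on F Es
  using banach_factors by unfold_locales (simp add: banach_imp_normed)

abbreviation "H \<equiv> summing_ops X Y Es F"
abbreviation "\<nu> \<equiv> summing_norm X Y Es F"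
abbreviation "ind \<equiv> induced (length Es) :: ((nat \<Rightarrow> 'a) \<Rightarrow> 'a) \<Rightarrow> (nat \<Rightarrow> nat \<Rightarrow> 'a) \<Rightarrow> nat \<Rightarrow> 'a"

lemma factor: "i < length Es \<Longrightarrow> seq_space_on (Es ! i) (X (Es ! i))"
  using seq_X banach_factors by (intro sequence_class_space) auto

lemma slice: "s \<in> prod_carrier (map X Es) \<Longrightarrow> (\<lambda>m\<in>{..<length Es}. s m j) \<in> prod_carrier Es"
  using seq_X banach_factors by (rule prod_carrier_slice)

lemma summing_ops: "A \<in> H \<Longrightarrow> A \<in> multilinear_ops Es F"
  and ind_closed: "A \<in> H \<Longrightarrow> s \<in> prod_carrier (map X Es) \<Longrightarrow> ind A s \<in> carrier (Y F)"
  by (simp_all add: summing_ops_def)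

lemma ind_continuous:
  assumes A: "A \<in> H"
  shows "continuous_multilinear_on (Y F) (map X Es) (ind A)"
proof -
  interpret A: continuous_multilinear_on F Es A using summing_ops[OF A] by (rule M.opsD)
  interpret indA: multilinear_on "Y F" "map X Es" "ind A"
  proof (rule multilinear_onI)
    show "normed_space (Y F)" "\<And>E. E \<in> set (map X Es) \<Longrightarrow> normed_space E"
      using banach_YF banach_X banach_factors by (auto intro: banach_imp_normed)
    show "\<And>s. s \<in> prod_carrier (map X Es) \<Longrightarrow> ind A s \<in> carrier (Y F)" using ind_closed[OF A] .
    fix i s u v a assume i: "i < length (map X Es)" and s: "s \<in> prod_carrier (map X Es)"
      and u: "u \<in> carrier (map X Es ! i)"
    then have i': "i < length Es" and u': "u \<in> carrier (X (Es ! i))" by auto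
    interpret E: seq_space_on "Es ! i" "X (Es ! i)" using i' by (rule factor)
    have "ind A (s(i := a \<odot>\<^bsub>map X Es ! i\<^esub> u)) = (\<lambda>j. a \<odot>\<^bsub>F\<^esub> ind A (s(i := u)) j)"
      using i' u' slice[OF s] E.coord_closed by (simp add: fun_eq_iff induced_upd E.smult_eq A.map_smult)
    then show "ind A (s(i := a \<odot>\<^bsub>map X Es ! i\<^esub> u)) = a \<odot>\<^bsub>Y F\<^esub> ind A (s(i := u))"
      using F.smult_eq ind_closed[OF A] prod_carrier_upd[OF s i u] by simp
    assume v: "v \<in> carrier (map X Es ! i)"
    then have v': "v \<in> carrier (X (Es ! i))" using i' by simp
    have "ind A (s(i := u \<oplus>\<^bsub>map X Es ! i\<^esub> v)) = (\<lambda>j. ind A (s(i := u)) j \<oplus>\<^bsub>F\<^esub> ind A (s(i := v)) j)"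
      using i' u' v' slice[OF s] E.coord_closed by (simp add: fun_eq_iff induced_upd E.add_eq A.map_add)
    then show "ind A (s(i := u \<oplus>\<^bsub>map X Es ! i\<^esub> v)) = ind A (s(i := u)) \<oplus>\<^bsub>Y F\<^esub> ind A (s(i := v))"
      using F.add_eq ind_closed[OF A] prod_carrier_upd[OF s i u] prod_carrier_upd[OF s i v] by simp
  qed
  have "continuous_multilinear (map X Es) (Y F) (ind A)"
  proof (rule indA.closed_graph_continuous[OF banach_YF])
    show "\<And>E. E \<in> set (map X Es) \<Longrightarrow> banach_space E" using banach_X banach_factors by auto
    fix i s p l w assume i: "i < length (map X Es)" and s: "s \<in> prod_carrier (map X Es)"
      and p: "nspace_on.tends (map X Es ! i) p l" and w: "F.S.tends (\<lambda>k. ind A (s(i := p k))) w"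
    then have i': "i < length Es" by simp
    interpret E: seq_space_on "Es ! i" "X (Es ! i)" using i' by (rule factor)
    have p': "E.S.tends p l" using p i' by simp
    have "w j = ind A (s(i := l)) j" for j
    proof (rule F.E.tends_unique)
      show "F.E.tends (\<lambda>k. ind A (s(i := p k)) j) (w j)" using w by (rule F.tends_coord)
      show "F.E.tends (\<lambda>k. ind A (s(i := p k)) j) (ind A (s(i := l)) j)"
        using A.tends_map[OF slice[OF s] i' E.tends_coord[OF p']] i' by (simp add: induced_upd)
    qed
    then show "w = ind A (s(i := l))" by blast
  qed
  then show ?thesis by unfold_locales
qed

lemma \<nu>_nonneg: "A \<in> H \<Longrightarrow> 0 \<le> \<nu> A"
  and nrm_ind_le: "A \<in> H \<Longrightarrow> s \<in> prod_carrier (map X Es) \<Longrightarrow>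
    nrm (Y F) (ind A s) \<le> \<nu> A * (\<Prod>i<length Es. nrm (X (Es ! i)) (s i))"
  and nrm_ind_ball_le: "A \<in> H \<Longrightarrow> s \<in> prod_ball (map X Es) \<Longrightarrow> nrm (Y F) (ind A s) \<le> \<nu> A"
  using continuous_multilinear_on.norm_nonneg[OF ind_continuous, of A]
    continuous_multilinear_on.nrm_le[OF ind_continuous, of A s]
    continuous_multilinear_on.nrm_le_norm[OF ind_continuous, of A s]
  by (simp_all add: summing_norm_def)

lemma \<nu>_leI:
  "A \<in> H \<Longrightarrow> (\<And>s. s \<in> prod_ball (map X Es) \<Longrightarrow> nrm (Y F) (ind A s) \<le> C) \<Longrightarrow> \<nu> A \<le> C"
  unfolding summing_norm_def
  using multilinear_on.norm_leI[of "Y F" "map X Es" "ind A" C] ind_continuous[of A]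
  by (auto simp: continuous_multilinear_on_def)

text \<open>Coordinate 0 of the sequence induced from the tuple of
  \<open>first (Es ! i) (x i)\<close> is \<open>A x\<close>. The product form serves arbitrary
  points of the domain, at which pointwise limits are taken later.\<close>

lemma nrm_le:
  assumes A: "A \<in> H" and x: "x \<in> prod_carrier Es"
  shows "nrm F (A x) \<le> \<nu> A * (\<Prod>i<length Es. nrm (Es ! i) (x i))"
proof -
  define s where "s = (\<lambda>i\<in>{..<length Es}. first (Es ! i) (x i))"
  have f: "s i \<in> carrier (X (Es ! i))" "nrm (X (Es ! i)) (s i) \<le> nrm (Es ! i) (x i)" if "i < length Es" for i
    using first_X[of "Es ! i" "x i"] prod_carrier_nth[OF x that] banach_factors that by (auto simp: s_def)
  have s: "s \<in> prod_carrier (map X Es)"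
    using f(1) by (auto simp: prod_carrier_def PiE_iff s_def)
  have "(\<lambda>m\<in>{..<length Es}. s m 0) = x"
    by (rule prod_carrier_eqI[OF slice[OF s] x]) (simp add: s_def first_def)
  then have "ind A s 0 = A x" by (simp add: induced_def)
  then have "nrm F (A x) \<le> nrm (Y F) (ind A s)"
    using F.nrm_coord_le[OF ind_closed[OF A s], of 0] by simp
  also have "\<dots> \<le> \<nu> A * (\<Prod>i<length Es. nrm (X (Es ! i)) (s i))" using A s by (rule nrm_ind_le)
  also have "\<dots> \<le> \<nu> A * (\<Prod>i<length Es. nrm (Es ! i) (x i))"
  proof (intro mult_left_mono prod_mono \<nu>_nonneg A conjI)
    fix i assume "i \<in> {..<length Es}"
    then have i: "i < length Es" by simp
    interpret E: seq_space_on "Es ! i" "X (Es ! i)" using i by (rule factor)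
    show "0 \<le> nrm (X (Es ! i)) (s i)" using f(1)[OF i] by simp
    show "nrm (X (Es ! i)) (s i) \<le> nrm (Es ! i) (x i)" using f(2)[OF i] .
  qed
  finally show ?thesis .
qed

abbreviation "L \<equiv> multilinear_space Es F"

lemma ind_add: "A \<in> H \<Longrightarrow> B \<in> H \<Longrightarrow> s \<in> prod_carrier (map X Es) \<Longrightarrow> ind (A \<oplus>\<^bsub>L\<^esub> B) s = ind A s \<oplus>\<^bsub>Y F\<^esub> ind B s"
  by (simp add: F.add_eq ind_closed fun_eq_iff induced_eq multilinear_space_simps slice)

lemma ind_smult: "A \<in> H \<Longrightarrow> s \<in> prod_carrier (map X Es) \<Longrightarrow> ind (a \<odot>\<^bsub>L\<^esub> A) s = a \<odot>\<^bsub>Y F\<^esub> ind A s"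
  by (simp add: F.smult_eq ind_closed fun_eq_iff induced_eq multilinear_space_simps slice)

lemma ind_zero: "s \<in> prod_carrier (map X Es) \<Longrightarrow> ind \<zero>\<^bsub>L\<^esub> s = \<zero>\<^bsub>Y F\<^esub>"
  by (simp add: F.zero_eq fun_eq_iff induced_eq multilinear_space_simps slice)

lemma H_zero: "\<zero>\<^bsub>L\<^esub> \<in> H"
  by (simp add: summing_ops_def M.ops_zero ind_zero)

lemma H_I: "A \<in> multilinear_ops Es F \<Longrightarrow> (\<And>s. s \<in> prod_carrier (map X Es) \<Longrightarrow> ind A s \<in> carrier (Y F)) \<Longrightarrow> A \<in> H"
  by (simp add: summing_ops_def)

lemma H_add: "A \<in> H \<Longrightarrow> B \<in> H \<Longrightarrow> A \<oplus>\<^bsub>L\<^esub> B \<in> H"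
  by (rule H_I[OF M.ops_add[OF summing_ops summing_ops]]) (simp_all add: ind_add ind_closed)

lemma H_smult: "A \<in> H \<Longrightarrow> a \<odot>\<^bsub>L\<^esub> A \<in> H"
  by (rule H_I[OF M.ops_smult[OF summing_ops]]) (simp_all add: ind_smult ind_closed)

lemma H_submodule: "submodule H scalar_ring L"
  using summing_ops by (intro M.submoduleI H_zero H_add H_smult) auto

end


section \<open>Completeness of the space of summing operators\<close>

context summing_component
begin

section \<open>Operators of finite type\<close>

lemma H_elementary:
  assumes \<phi>: "\<And>i. i < length Es \<Longrightarrow> \<phi> i \<in> linear_ops (Es ! i) (scalar_space id)" and b: "b \<in> carrier F"
  shows "(\<lambda>x\<in>prod_carrier Es. (\<Prod>i<length Es. \<phi> i (x i)) \<odot>\<^bsub>F\<^esub> b) \<in> H"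
proof -
  let ?c = "\<lambda>i. linear_norm (Es ! i) (scalar_space id) (\<phi> i)"
  \<comment> \<open>Unfolding removes \<open>id\<close> from the values, folding restores it inside
    \<open>scalar_space id\<close>.\<close>
  note id_simps = scalar_space_simps[OF inj_on_id, unfolded id_def, folded id_def]
  have \<phi>_bounded: "bounded_linear_map (Es ! i) (scalar_space id) (?c i) (\<phi> i)" and c: "0 \<le> ?c i" if "i < length Es" for i
    using that banach_factors scalar_space_banach[OF inj_on_id]
    by (auto intro!: linear_ops_bounded banach_imp_normed \<phi>)
  have \<phi>_norm: "norm (\<phi> i x) \<le> ?c i * nrm (Es ! i) x"
    and \<phi>_add: "y \<in> carrier (Es ! i) \<Longrightarrow> \<phi> i (x \<oplus>\<^bsub>Es ! i\<^esub> y) = \<phi> i x + \<phi> i y"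
    and \<phi>_smult: "\<phi> i (a \<odot>\<^bsub>Es ! i\<^esub> x) = a * \<phi> i x"
    if "i < length Es" "x \<in> carrier (Es ! i)" for i x y a
    using \<phi>_bounded[OF that(1)] that(2) by (auto simp: bounded_linear_map_def id_simps)
  let ?A = "\<lambda>x. (\<Prod>i<length Es. \<phi> i (x i)) \<odot>\<^bsub>F\<^esub> b"
  have upd: "(\<Prod>i<length Es. \<phi> i ((x(k := u)) i)) = \<phi> k u * (\<Prod>i\<in>{..<length Es} - {k}. \<phi> i (x i))"
    if "k < length Es" for x u k
    using that by (subst prod.remove[of _ k]) (auto intro!: arg_cong2[where f = "(*)"] prod.cong)
  interpret multilinear_on F Es ?A
    using b by (intro multilinear_onI F.E.normed M.normed_factors)
      (auto simp: upd \<phi>_add \<phi>_smult distrib_right F.E.smult_add_left mult.assoc F.E.smult_assoc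
        simp del: fun_upd_apply)
  have A: "(\<lambda>x\<in>prod_carrier Es. ?A x) \<in> multilinear_ops Es F"
  proof (rule restrict_in_multilinear_ops)
    fix x assume x: "x \<in> prod_ball Es"
    have "nrm F (?A x) = (\<Prod>i<length Es. norm (\<phi> i (x i))) * nrm F b"
      using b by (simp add: F.E.nrm_smult prod_norm)
    also have "\<dots> \<le> (\<Prod>i<length Es. ?c i) * nrm F b"
    proof (intro mult_right_mono prod_mono conjI)
      fix i assume "i \<in> {..<length Es}"
      then have i: "i < length Es" "x i \<in> carrier (Es ! i)" "nrm (Es ! i) (x i) \<le> 1"
        using x by (auto simp: prod_ball_def prod_carrier_nth)
      show "norm (\<phi> i (x i)) \<le> ?c i"
        using order_trans[OF \<phi>_norm[OF i(1,2)] mult_left_le[OF i(3) c[OF i(1)]]] .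
    qed (use b in auto)
    finally show "nrm F (?A x) \<le> (\<Prod>i<length Es. ?c i) * nrm F b" .
  qed
  show ?thesis
  proof (rule H_I[OF A])
    fix s assume s: "s \<in> prod_carrier (map X Es)"
    \<comment> \<open>Composing with \<open>\<iota>\<close> moves the functional into the copy of
      the field on which \<open>X\<close> acts, with the same bound.\<close>
    have "(\<lambda>j. \<iota> (\<phi> m (s m j))) \<in> carrier (X K)" if m: "m < length Es" for m
    proof (rule linear_X(1)[where u = "\<lambda>x. \<iota> (\<phi> m x)", OF _ banach_K _ c[OF m]])
      show "bounded_linear_map (Es ! m) K (?c m) (\<lambda>x. \<iota> (\<phi> m x))"
        using m by (simp add: bounded_linear_map_def K_simps \<phi>_norm \<phi>_add \<phi>_smult)
      show "s m \<in> carrier (X (Es ! m))" using prod_carrier_nth[OF s] m by simp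
    qed (use m banach_factors in auto)
    then have prod: "(\<lambda>j. \<iota> (\<Prod>m<length Es. \<phi> m (s m j))) \<in> carrier (Y K)"
      using power[of "length Es", unfolded power_embeds_def, rule_format, of "\<lambda>m j. \<phi> m (s m j)"] nonempty
      by (simp add: Suc_le_eq)
    have "(\<lambda>x. inv_into UNIV \<iota> x \<odot>\<^bsub>F\<^esub> b) \<in> linear_ops K F"
      using scalar_smult_bounded[OF inj F.E.normed b] banach_K F.E.normed
      by (intro bounded_linear_map_linear_ops) (auto intro: banach_imp_normed)
    note linear_Y(1)[OF banach_K banach_F this prod]
    moreover have "ind (\<lambda>x\<in>prod_carrier Es. ?A x) s = (\<lambda>j. (\<Prod>m<length Es. \<phi> m (s m j)) \<odot>\<^bsub>F\<^esub> b)"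
      using slice[OF s] by (simp add: fun_eq_iff induced_eq)
    ultimately show "ind (\<lambda>x\<in>prod_carrier Es. ?A x) s \<in> carrier (Y F)" by simp
  qed
qed

lemma H_finite_type: "finite_type_ops Es F \<subseteq> H"
proof
  fix A assume "A \<in> finite_type_ops Es F"
  then obtain N :: nat and c \<phi> b where
    \<phi>: "\<And>k i. k < N \<Longrightarrow> i < length Es \<Longrightarrow> \<phi> k i \<in> linear_ops (Es ! i) (scalar_space id)"
    and b: "\<And>k. k < N \<Longrightarrow> b k \<in> carrier F"
    and A: "A = (\<lambda>x\<in>prod_carrier Es.
            \<Oplus>\<^bsub>F\<^esub>k\<in>{..<N}. c k \<odot>\<^bsub>F\<^esub> ((\<Prod>i<length Es. \<phi> k i (x i)) \<odot>\<^bsub>F\<^esub> b k))"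
    unfolding finite_type_ops_def by blast
  let ?T = "\<lambda>k x. c k \<odot>\<^bsub>F\<^esub> ((\<Prod>i<length Es. \<phi> k i (x i)) \<odot>\<^bsub>F\<^esub> b k)"
  have "n \<le> N \<Longrightarrow> (\<lambda>x\<in>prod_carrier Es. \<Oplus>\<^bsub>F\<^esub>k\<in>{..<n}. ?T k x) \<in> H" for n
  proof (induction n)
    case 0
    then show ?case using H_zero by (simp add: multilinear_space_simps restrict_def)
  next
    case (Suc n)
    have "(\<lambda>x\<in>prod_carrier Es. \<Oplus>\<^bsub>F\<^esub>k\<in>{..<Suc n}. ?T k x) =
        c n \<odot>\<^bsub>L\<^esub> (\<lambda>x\<in>prod_carrier Es. (\<Prod>i<length Es. \<phi> n i (x i)) \<odot>\<^bsub>F\<^esub> b n) \<oplus>\<^bsub>L\<^esub>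
        (\<lambda>x\<in>prod_carrier Es. \<Oplus>\<^bsub>F\<^esub>k\<in>{..<n}. ?T k x)"
    proof -
      have "(\<Oplus>\<^bsub>F\<^esub>k\<in>{..<Suc n}. ?T k x) = ?T n x \<oplus>\<^bsub>F\<^esub> (\<Oplus>\<^bsub>F\<^esub>k\<in>{..<n}. ?T k x)" for x
        using Suc.prems b by (simp add: lessThan_Suc F.E.M.finsum_insert Pi_def)
      then show ?thesis by (auto simp: multilinear_space_simps fun_eq_iff)
    qed
    moreover have "\<dots> \<in> H"
      by (intro H_add H_smult H_elementary Suc.IH) (use Suc.prems b \<phi> in auto)
    ultimately show ?case by argo
  qed
  then show "A \<in> H" by (simp add: A)
qed

section \<open>The summing norm and its completeness\<close>

abbreviation "R \<equiv> L\<lparr>carrier := H, nrm := \<nu>\<rparr>"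

lemma R_module: "Module.module scalar_ring R"
  using summing_ops by (intro M.sub_module H_zero H_add H_smult) auto

text \<open>\<open>\<nu>_leI\<close> yields upper bounds only; for nonzero \<open>a\<close> the
  reverse inequality follows from this one with \<open>inverse a\<close> in place of
  \<open>a\<close>.\<close>

lemma \<nu>_smult_le: "A \<in> H \<Longrightarrow> \<nu> (a \<odot>\<^bsub>L\<^esub> A) \<le> norm a * \<nu> A"
proof (rule \<nu>_leI)
  fix s assume A: "A \<in> H" and s: "s \<in> prod_ball (map X Es)"
  then show "nrm (Y F) (ind (a \<odot>\<^bsub>L\<^esub> A) s) \<le> norm a * \<nu> A"
    using nrm_ind_ball_le[OF A s]
    by (simp add: ind_smult prod_ball_subset F.S.nrm_smult ind_closed mult_left_mono)
qed (rule H_smult)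

lemma R_normed: "normed_space R"
  unfolding normed_space_def
proof (intro conjI ballI allI R_module)
  interpret R: Module.module scalar_ring R by (rule R_module)
  fix A assume "A \<in> carrier R"
  then have A: "A \<in> H" by simp
  show "0 \<le> nrm R A" using \<nu>_nonneg[OF A] by simp
  show "nrm R A = 0 \<longleftrightarrow> A = \<zero>\<^bsub>R\<^esub>"
  proof
    assume "nrm R A = 0"
    then have "\<nu> A = 0" by simp
    have "A x = \<zero>\<^bsub>F\<^esub>" if "x \<in> prod_carrier Es" for x
    proof -
      have "A x \<in> carrier F" using summing_ops[OF A] that by (rule M.ops_closed)
      moreover have "nrm F (A x) \<le> 0" using nrm_le[OF A that] \<open>\<nu> A = 0\<close> by simp
      ultimately show ?thesis using F.E.nrm_eq_0_iff F.E.nrm_nonneg order.antisym by blast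
    qed
    then have "A = \<zero>\<^bsub>L\<^esub>"
      by (intro M.ops_eqI summing_ops A H_zero) (simp add: multilinear_space_simps)
    then show "A = \<zero>\<^bsub>R\<^esub>" by simp
  next
    assume "A = \<zero>\<^bsub>R\<^esub>"
    then have "A = \<zero>\<^bsub>L\<^esub>" by simp
    moreover have "\<nu> \<zero>\<^bsub>L\<^esub> \<le> 0"
      by (rule \<nu>_leI[OF H_zero]) (simp add: ind_zero prod_ball_subset)
    ultimately show "nrm R A = 0" using \<nu>_nonneg[OF H_zero] by simp
  qed
  show "nrm R (a \<odot>\<^bsub>R\<^esub> A) = norm a * nrm R A" for a
  proof (cases "a = 0")
    case True
    moreover have "\<nu> (0 \<odot>\<^bsub>L\<^esub> A) \<le> norm (0 :: 'k) * \<nu> A" using A by (rule \<nu>_smult_le)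
    then have "\<nu> (0 \<odot>\<^bsub>L\<^esub> A) = 0" using \<nu>_nonneg[OF H_smult[OF A, of 0]] by simp
    ultimately show ?thesis by simp
  next
    case False
    have "inverse a \<odot>\<^bsub>R\<^esub> (a \<odot>\<^bsub>R\<^esub> A) = A"
      using R.smult_assoc1[of "inverse a" a A] R.smult_one[of A] A False by simp
    then have "\<nu> A \<le> norm (inverse a) * \<nu> (a \<odot>\<^bsub>L\<^esub> A)"
      using \<nu>_smult_le[OF H_smult[OF A, of a], of "inverse a"] by simp
    then have "norm a * \<nu> A \<le> \<nu> (a \<odot>\<^bsub>L\<^esub> A)"
      using False by (simp add: nonzero_norm_inverse pos_le_divide_eq mult.commute flip: divide_inverse_commute)
    then show ?thesis using \<nu>_smult_le[OF A, of a] by simp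
  qed
  fix B assume "B \<in> carrier R"
  then have B: "B \<in> H" by simp
  have "\<nu> (A \<oplus>\<^bsub>L\<^esub> B) \<le> \<nu> A + \<nu> B"
  proof (rule \<nu>_leI[OF H_add[OF A B]])
    fix s assume s: "s \<in> prod_ball (map X Es)"
    then have s': "s \<in> prod_carrier (map X Es)" by (rule prod_ball_subset)
    have "nrm (Y F) (ind A s \<oplus>\<^bsub>Y F\<^esub> ind B s) \<le> nrm (Y F) (ind A s) + nrm (Y F) (ind B s)"
      using ind_closed[OF A s'] ind_closed[OF B s'] by (rule F.S.nrm_triangle)
    then show "nrm (Y F) (ind (A \<oplus>\<^bsub>L\<^esub> B) s) \<le> \<nu> A + \<nu> B"
      using nrm_ind_ball_le[OF A s] nrm_ind_ball_le[OF B s] by (simp add: ind_add A B s')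
  qed
  then show "nrm R (A \<oplus>\<^bsub>R\<^esub> B) \<le> nrm R A + nrm R B" by simp
qed

sublocale R: nspace_on R
  by unfold_locales (rule R_normed)

text \<open>Subtraction refers to inverses within the carrier \<open>H\<close>, while addition and
  scalar multiplication of \<open>R\<close> are literally those of \<open>L\<close>; the scalar
  \<open>- 1\<close> mediates between them.\<close>

lemma R_minus: "A \<in> H \<Longrightarrow> B \<in> H \<Longrightarrow> A \<ominus>\<^bsub>R\<^esub> B = A \<oplus>\<^bsub>L\<^esub> ((- 1) \<odot>\<^bsub>L\<^esub> B)"
  using R.minus_eq_add_smult[of A B] by simp

lemma R_minus_closed: "A \<in> H \<Longrightarrow> B \<in> H \<Longrightarrow> A \<ominus>\<^bsub>R\<^esub> B \<in> H"
  by (simp add: R_minus H_add H_smult)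

lemma R_minus_apply: "A \<in> H \<Longrightarrow> B \<in> H \<Longrightarrow> x \<in> prod_carrier Es \<Longrightarrow> (A \<ominus>\<^bsub>R\<^esub> B) x = A x \<ominus>\<^bsub>F\<^esub> B x"
  by (simp add: R_minus multilinear_space_simps F.E.minus_eq_add_smult M.ops_closed summing_ops)

lemma R_minus_ind: "A \<in> H \<Longrightarrow> B \<in> H \<Longrightarrow> s \<in> prod_carrier (map X Es) \<Longrightarrow>
    ind (A \<ominus>\<^bsub>R\<^esub> B) s = ind A s \<ominus>\<^bsub>Y F\<^esub> ind B s"
  by (simp add: R_minus ind_add ind_smult H_smult F.S.minus_eq_add_smult ind_closed)

lemma R_banach: "banach_space R"
proof -
  have "bspace_on R"
  proof (rule R.bspace_onI)
    fix p :: "nat \<Rightarrow> (nat \<Rightarrow> 'a) \<Rightarrow> 'a"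
    assume "\<And>i. p i \<in> carrier R"
      and "\<And>e. e > 0 \<Longrightarrow> \<exists>N. \<forall>m\<ge>N. \<forall>n\<ge>N. nrm R (p m \<ominus>\<^bsub>R\<^esub> p n) < e"
    then have p: "p i \<in> H" and C: "e > 0 \<Longrightarrow> \<exists>N. \<forall>m\<ge>N. \<forall>n\<ge>N. \<nu> (p m \<ominus>\<^bsub>R\<^esub> p n) < e" for i e
      by simp_all
    \<comment> \<open>Anything dominated by a fixed multiple of the summing distances inherits the
      Cauchy condition; it is applied to values at a point and to induced sequences. The denominator
      \<open>c + 1\<close> allows \<open>c = 0\<close>.\<close>
    have C': "\<exists>N. \<forall>m\<ge>N. \<forall>n\<ge>N. d m n < e"
      if d: "\<And>m n. d m n \<le> \<nu> (p m \<ominus>\<^bsub>R\<^esub> p n) * c" and e: "0 < e" and c: "0 \<le> c" for d c e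
    proof -
      have "0 < e / (c + 1)" using e c by simp
      then obtain N where N: "\<forall>m\<ge>N. \<forall>n\<ge>N. \<nu> (p m \<ominus>\<^bsub>R\<^esub> p n) < e / (c + 1)" using C by blast
      have "d m n < e" if "N \<le> m" "N \<le> n" for m n
      proof -
        have "d m n \<le> \<nu> (p m \<ominus>\<^bsub>R\<^esub> p n) * c" by (rule d)
        also have "\<dots> \<le> e / (c + 1) * c" using N that c by (intro mult_right_mono) (auto intro: less_imp_le)
        also have "\<dots> < e" using e c by (simp add: field_simps)
        finally show ?thesis .
      qed
      then show ?thesis by blast
    qed
    have "\<exists>l. F.E.tends (\<lambda>i. p i x) l" if x: "x \<in> prod_carrier Es" for x
    proof -
      have "0 \<le> (\<Prod>i<length Es. nrm (Es ! i) (x i))"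
        using M.normed_factors prod_carrier_nth[OF x]
        by (intro prod_nonneg) (auto simp: nspace_on_def intro!: nspace_on.nrm_nonneg)
      note C'' = C'[of "\<lambda>m n. nrm F (p m x \<ominus>\<^bsub>F\<^esub> p n x)", OF _ _ this]
      have "p i x \<in> carrier F" for i using x by (rule M.ops_closed[OF summing_ops[OF p]])
      moreover have "nrm F (p m x \<ominus>\<^bsub>F\<^esub> p n x) \<le> \<nu> (p m \<ominus>\<^bsub>R\<^esub> p n) * (\<Prod>i<length Es. nrm (Es ! i) (x i))" for m n
        using nrm_le[OF R_minus_closed[OF p p] x, of m n] by (simp only: R_minus_apply p x)
      ultimately show ?thesis
        using F.E.Cauchy_tends[of "\<lambda>i. p i x" "\<exists>l. F.E.tends (\<lambda>i. p i x) l"] C'' by blast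
    qed
    then obtain A0 where A0: "\<And>x. x \<in> prod_carrier Es \<Longrightarrow> F.E.tends (\<lambda>i. p i x) (A0 x)" by metis
    interpret A0: multilinear_on F Es A0
    proof (rule multilinear_onI[OF F.E.normed M.normed_factors])
      show "A0 x \<in> carrier F" if "x \<in> prod_carrier Es" for x using A0[OF that] by (simp add: F.E.tends_def)
      fix i x u v a assume i: "i < length Es" and x: "x \<in> prod_carrier Es" and u: "u \<in> carrier (Es ! i)"
      interpret E: seq_space_on "Es ! i" "X (Es ! i)" using i by (rule factor)
      have pk: "continuous_multilinear_on F Es (p k)" for k using p summing_ops M.opsD by blast
      then have pk': "multilinear_on F Es (p k)" for k by (simp add: continuous_multilinear_on_def)
      have "F.E.tends (\<lambda>k. a \<odot>\<^bsub>F\<^esub> p k (x(i := u))) (A0 (x(i := a \<odot>\<^bsub>Es ! i\<^esub> u)))"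
        using A0[of "x(i := a \<odot>\<^bsub>Es ! i\<^esub> u)"] i x u
        by (simp add: prod_carrier_upd multilinear_on.map_smult[OF pk'])
      then show "A0 (x(i := a \<odot>\<^bsub>Es ! i\<^esub> u)) = a \<odot>\<^bsub>F\<^esub> A0 (x(i := u))"
        using F.E.tends_smult[OF A0[OF prod_carrier_upd[OF x i u]]] by (rule F.E.tends_unique)
      assume v: "v \<in> carrier (Es ! i)"
      have "F.E.tends (\<lambda>k. p k (x(i := u)) \<oplus>\<^bsub>F\<^esub> p k (x(i := v))) (A0 (x(i := u \<oplus>\<^bsub>Es ! i\<^esub> v)))"
        using A0[of "x(i := u \<oplus>\<^bsub>Es ! i\<^esub> v)"] i x u v
        by (simp add: prod_carrier_upd multilinear_on.map_add[OF pk'])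
      then show "A0 (x(i := u \<oplus>\<^bsub>Es ! i\<^esub> v)) = A0 (x(i := u)) \<oplus>\<^bsub>F\<^esub> A0 (x(i := v))"
        using F.E.tends_add[OF A0[OF prod_carrier_upd[OF x i u]] A0[OF prod_carrier_upd[OF x i v]]]
        by (rule F.E.tends_unique)
    qed
    \<comment> \<open>Distance at most 1 from one term bounds the limit operator on the unit ball,
      which gives its continuity.\<close>
    obtain N where N: "\<forall>m\<ge>N. \<forall>n\<ge>N. \<nu> (p m \<ominus>\<^bsub>R\<^esub> p n) < 1" using C[of 1] by auto
    have "nrm F (A0 x) \<le> \<nu> (p N) + 1" if x: "x \<in> prod_ball Es" for x
    proof -
      have x': "x \<in> prod_carrier Es" using x by (rule prod_ball_subset)
      have prod: "(\<Prod>i<length Es. nrm (Es ! i) (x i)) \<le> 1"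
        using x M.normed_factors prod_carrier_nth[OF x']
        by (intro prod_le_1) (auto simp: prod_ball_def nspace_on_def intro!: nspace_on.nrm_nonneg)
      have le: "nrm F (A x) \<le> \<nu> A" if "A \<in> H" for A
        using order_trans[OF nrm_le[OF that x'] mult_left_le[OF prod \<nu>_nonneg[OF that]]] .
      have pc: "p N x \<in> carrier F" using p x' by (simp add: M.ops_closed summing_ops)
      have "nrm F (p N x \<ominus>\<^bsub>F\<^esub> p i x) \<le> 1" if "N \<le> i" for i
      proof -
        have "nrm F ((p N \<ominus>\<^bsub>R\<^esub> p i) x) \<le> \<nu> (p N \<ominus>\<^bsub>R\<^esub> p i)" using p by (intro le R_minus_closed)
        also have "\<dots> \<le> 1" using N that by (simp add: less_imp_le)
        finally show ?thesis by (simp add: R_minus_apply p x')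
      qed
      then have "nrm F (p N x \<ominus>\<^bsub>F\<^esub> A0 x) \<le> 1"
        using F.E.tends_nrm_minus_le[OF A0[OF x'] pc] by blast
      then show ?thesis
        using F.E.nrm_le_add_minus[OF A0.closed[OF x'] pc] le[OF p, of N]
          F.E.nrm_minus_commute[OF A0.closed[OF x'] pc] by linarith
    qed
    then have A_ops: "(\<lambda>x\<in>prod_carrier Es. A0 x) \<in> multilinear_ops Es F"
      by (rule A0.restrict_in_multilinear_ops)
    define A where "A = (\<lambda>x\<in>prod_carrier Es. A0 x)"
    have tends_ind: "F.S.tends (\<lambda>i. ind (p i) s) (ind A s)" if s: "s \<in> prod_carrier (map X Es)" for s
    proof -
      have "0 \<le> (\<Prod>i<length Es. nrm (X (Es ! i)) (s i))"
        using banach_X banach_factors prod_carrier_nth[OF s]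
        by (intro prod_nonneg) (auto simp: nspace_on_def intro!: nspace_on.nrm_nonneg banach_imp_normed)
      note C'' = C'[of "\<lambda>m n. nrm (Y F) (ind (p m) s \<ominus>\<^bsub>Y F\<^esub> ind (p n) s)", OF _ _ this]
      have "nrm (Y F) (ind (p m) s \<ominus>\<^bsub>Y F\<^esub> ind (p n) s) \<le>
          \<nu> (p m \<ominus>\<^bsub>R\<^esub> p n) * (\<Prod>i<length Es. nrm (X (Es ! i)) (s i))" for m n
        using nrm_ind_le[OF R_minus_closed[OF p p] s, of m n] by (simp only: R_minus_ind p s)
      then obtain w where w: "F.S.tends (\<lambda>i. ind (p i) s) w"
        using F.S.Cauchy_tends[of "\<lambda>i. ind (p i) s" "\<exists>l. F.S.tends (\<lambda>i. ind (p i) s) l"] ind_closed[OF p s] C''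
        by blast
      \<comment> \<open>Completeness of \<open>Y F\<close> only provides some limit
        \<open>w\<close>; the pointwise limits of \<open>p\<close> determine its
        coordinates.\<close>
      have "w j = ind A s j" for j
      proof (rule F.E.tends_unique)
        show "F.E.tends (\<lambda>i. ind (p i) s j) (w j)" using w by (rule F.tends_coord)
        show "F.E.tends (\<lambda>i. ind (p i) s j) (ind A s j)"
          using A0[OF slice[OF s]] slice[OF s] by (simp add: induced_eq A_def)
      qed
      then have "w = ind A s" by blast
      then show ?thesis using w by simp
    qed
    have A: "A \<in> H"
      using A_ops tends_ind by (intro H_I) (auto simp: A_def F.S.tends_def)
    have "(\<lambda>i. nrm R (p i \<ominus>\<^bsub>R\<^esub> A)) \<longlonglongrightarrow> 0"
    proof (rule LIMSEQ_I)
      fix e :: real assume "0 < e"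
      then obtain N where N: "\<forall>m\<ge>N. \<forall>n\<ge>N. \<nu> (p m \<ominus>\<^bsub>R\<^esub> p n) < e / 2" using C[of "e / 2"] by auto
      \<comment> \<open>For fixed \<open>s\<close> the second index goes to infinity. The bound
        \<open>e / 2\<close> is the same for all \<open>s\<close> in the unit ball and hence bounds
        the norm; passing to the limit loses strictness, so half of \<open>e\<close> is
        used.\<close>
      have "\<nu> (p i \<ominus>\<^bsub>R\<^esub> A) \<le> e / 2" if i: "N \<le> i" for i
      proof (rule \<nu>_leI[OF R_minus_closed[OF p A]])
        fix s assume s: "s \<in> prod_ball (map X Es)"
        then have s': "s \<in> prod_carrier (map X Es)" by (rule prod_ball_subset)
        have "nrm (Y F) (ind (p i) s \<ominus>\<^bsub>Y F\<^esub> ind (p n) s) \<le> e / 2" if n: "N \<le> n" for n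
        proof -
          have "nrm (Y F) (ind (p i \<ominus>\<^bsub>R\<^esub> p n) s) \<le> \<nu> (p i \<ominus>\<^bsub>R\<^esub> p n)"
            using R_minus_closed[OF p p] s by (rule nrm_ind_ball_le)
          also have "\<dots> \<le> e / 2" using N i n by (simp add: less_imp_le)
          finally show ?thesis by (simp add: R_minus_ind p s')
        qed
        then have "nrm (Y F) (ind (p i) s \<ominus>\<^bsub>Y F\<^esub> ind A s) \<le> e / 2"
          using F.S.tends_nrm_minus_le[OF tends_ind[OF s'] ind_closed[OF p s']] by blast
        then show "nrm (Y F) (ind (p i \<ominus>\<^bsub>R\<^esub> A) s) \<le> e / 2" by (simp add: R_minus_ind p A s')
      qed
      then show "\<exists>N. \<forall>i\<ge>N. norm (nrm R (p i \<ominus>\<^bsub>R\<^esub> A) - 0) < e"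
        using \<open>0 < e\<close> \<nu>_nonneg[OF R_minus_closed[OF p A]] by (intro exI[of _ N]) fastforce
    qed
    then show "\<exists>l. R.tends p l" using p A by (auto simp: R.tends_def)
  qed
  then show ?thesis by (simp add: bspace_on_iff)
qed

end


section \<open>The hyper-ideal property\<close>

text \<open>The argument of \<open>B i\<close> inside \<open>compose_blocks\<close>, renumbered from
  0. Being polymorphic in the entries, it cuts tuples of sequences as well.\<close>

definition block :: "(nat \<Rightarrow> nat) \<Rightarrow> nat \<Rightarrow> (nat \<Rightarrow> 'a) \<Rightarrow> nat \<Rightarrow> 'a"
  where "block m i x = (\<lambda>j\<in>{..<m (Suc i) - m i}. x (m i + j))"

lemma block_prod_carrier:
  assumes "m (Suc i) \<le> length Gs" "x \<in> prod_carrier Gs"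
  shows "block m i x \<in> prod_carrier (map ((!) Gs) [m i..<m (Suc i)])"
  using assms by (auto simp: block_def prod_carrier_def PiE_iff)

lemma block_prod_ball:
  assumes "m (Suc i) \<le> length Gs" "x \<in> prod_ball Gs"
  shows "block m i x \<in> prod_ball (map ((!) Gs) [m i..<m (Suc i)])"
  using assms block_prod_carrier[of m i, OF assms(1), of x] by (auto simp: prod_ball_def block_def)

lemma block_upd_same:
  "m i \<le> k \<Longrightarrow> k < m (Suc i) \<Longrightarrow> block m i (x(k := u)) = (block m i x)(k - m i := u)"
  by (auto simp: block_def fun_eq_iff)

lemma block_upd_other:
  "k < m i \<or> m (Suc i) \<le> k \<Longrightarrow> block m i (x(k := u)) = block m i x"
  by (auto simp: block_def fun_eq_iff)

text \<open>Going down from \<open>n\<close>, the first \<open>i\<close> with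
  \<open>m i \<le> k\<close> is the right one; it exists because \<open>m 0 = 0\<close>.\<close>

lemma block_index:
  fixes m :: "nat \<Rightarrow> nat"
  assumes "m 0 = 0" "k < m n"
  obtains i where "i < n" "m i \<le> k" "k < m (Suc i)"
proof -
  have "\<exists>i<n. m i \<le> k \<and> k < m (Suc i)"
    using assms(2)
  proof (induction n)
    case (Suc n)
    show ?case
    proof (cases "k < m n")
      case True
      then show ?thesis using Suc.IH less_SucI by blast
    next
      case False
      then show ?thesis using Suc.prems by (intro exI[of _ n]) simp
    qed
  qed (use assms in simp)
  then show ?thesis using that by blast
qed

lemma compose_blocks_eq:
  "compose_blocks m n Gs t A B = (\<lambda>x\<in>prod_carrier Gs. t (A (\<lambda>i\<in>{..<n}. B i (block m i x))))"
  by (simp add: compose_blocks_def block_def)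

text \<open>No constant is lost, because stability asserts equality of norms: the operators induced
  by the \<open>B i\<close> on \<open>X\<close> and by \<open>t\<close> on \<open>Y\<close> have the
  norms of \<open>B i\<close> and \<open>t\<close>, so the estimate is a product of operator
  bounds.\<close>

lemma (in summing_pair) compose_blocks_summing:
  assumes m: "m 0 = 0" "\<And>i. i < length Es \<Longrightarrow> m i < m (Suc i)" "length Gs = m (length Es)" and n: "1 \<le> length Es"
    and Gs: "\<And>G. G \<in> set Gs \<Longrightarrow> banach_space G" and Es: "\<And>E. E \<in> set Es \<Longrightarrow> banach_space E"
    and F: "banach_space F" and H: "banach_space H"
    and A: "A \<in> summing_ops X Y Es F"
    and B: "\<And>i. i < length Es \<Longrightarrow> B i \<in> multilinear_ops (map ((!) Gs) [m i..<m (Suc i)]) (Es ! i)"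
    and t: "t \<in> linear_ops F H"
  shows "compose_blocks m (length Es) Gs t A B \<in> summing_ops X Y Gs H"
    and "summing_norm X Y Gs H (compose_blocks m (length Es) Gs t A B)
        \<le> linear_norm F H t * summing_norm X Y Es F A
          * (\<Prod>i<length Es. multilinear_norm (map ((!) Gs) [m i..<m (Suc i)]) (Es ! i) (B i))"
proof -
  let ?n = "length Es"
  let ?Gb = "\<lambda>i. map ((!) Gs) [m i..<m (Suc i)]"
  let ?b = "\<lambda>i. multilinear_norm (?Gb i) (Es ! i) (B i)"
  have mono: "i \<le> j \<Longrightarrow> j \<le> ?n \<Longrightarrow> m i \<le> m j" for i j
    by (induction j rule: dec_induct) (auto intro: order_trans[OF _ less_imp_le[OF m(2)]])
  have le: "m (Suc i) \<le> length Gs" if "i < ?n" for i using mono[of "Suc i" ?n] that m(3) by simp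
  have "m 0 < m (Suc 0)" by (rule m(2)) (use n in linarith)
  also have "\<dots> \<le> length Gs" by (rule le) (use n in linarith)
  finally have Gs_ne: "Gs \<noteq> []" by auto
  have Es_ne: "Es \<noteq> []" using n by auto
  have Gb: "banach_space G" if "i < ?n" "G \<in> set (?Gb i)" for i G
    using that le[OF that(1)] by (auto intro!: Gs nth_mem)
  \<comment> \<open>Multilinear stability speaks of nonempty lists; \<open>m i < m (Suc i)\<close>
    makes each block nonempty.\<close>
  have Gb_ne: "?Gb i \<noteq> []" if "i < ?n" for i using m(2)[OF that] by simp
  interpret F: seq_space_on F "Y F" using seq_Y F by (rule sequence_class_space)
  interpret H: seq_space_on H "Y H" using seq_Y H by (rule sequence_class_space)
  interpret A: summing_component \<iota> X Y F Es using Es Es_ne by unfold_locales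
  interpret C: summing_component \<iota> X Y H Gs using Gs Gs_ne by unfold_locales
  interpret Am: continuous_multilinear_on F Es A using A.summing_ops[OF A] by (rule A.M.opsD)
  have Bm: "continuous_multilinear_on (Es ! i) (?Gb i) (B i)" if "i < ?n" for i
    using B[OF that] Gb[OF that] Es that by (intro multilinear_ops_onD) (auto intro: banach_imp_normed)
  have b: "0 \<le> ?b i" if "i < ?n" for i
    using Bm[OF that] by (rule continuous_multilinear_on.norm_nonneg)
  have t_bounded: "bounded_linear_map F H (linear_norm F H t) t" and t_nonneg: "0 \<le> linear_norm F H t"
    using F H t by (auto intro!: linear_ops_bounded banach_imp_normed)
  define g where "g x = (\<lambda>i\<in>{..<?n}. B i (block m i x))" for x
  have g: "g x \<in> prod_carrier Es" if "x \<in> prod_carrier Gs" for x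
  proof -
    have "B i (block m i x) \<in> carrier (Es ! i)" if i: "i < ?n" for i
    proof -
      interpret Bi: continuous_multilinear_on "Es ! i" "?Gb i" "B i" using i by (rule Bm)
      show ?thesis using block_prod_carrier[of m i, OF le[OF i] \<open>x \<in> prod_carrier Gs\<close>] by (rule Bi.closed)
    qed
    then show ?thesis unfolding g_def by (rule prod_carrier_restrict)
  qed
  let ?f = "\<lambda>x. t (A (g x))"
  interpret f: multilinear_on H Gs ?f
  proof (rule multilinear_onI)
    fix k x u v a assume k: "k < length Gs" and x: "x \<in> prod_carrier Gs" and u: "u \<in> carrier (Gs ! k)"
    obtain i where i: "i < ?n" "m i \<le> k" "k < m (Suc i)" using block_index[of m k ?n] m k by auto
    interpret Bi: continuous_multilinear_on "Es ! i" "?Gb i" "B i" using i(1) by (rule Bm)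
    have bl: "block m i x \<in> prod_carrier (?Gb i)" using le[OF i(1)] x by (rule block_prod_carrier)
    have j: "k - m i < length (?Gb i)" and nth: "?Gb i ! (k - m i) = Gs ! k" using i by auto
    \<comment> \<open>Variable \<open>k\<close> belongs to block \<open>i\<close> alone, so only the
      \<open>i\<close>-th argument of \<open>A\<close> changes; multilinearity of \<open>B i\<close>
      and of \<open>A\<close> can be chained.\<close>
    have gu: "g (x(k := w)) = (g x)(i := B i ((block m i x)(k - m i := w)))" for w
    proof -
      have "block m i' (x(k := w)) = block m i' x" if "i' < ?n" "i' \<noteq> i" for i'
      proof (cases "i' < i")
        case True
        then show ?thesis using mono[of "Suc i'" i] i by (intro block_upd_other) auto
      next
        case False
        then show ?thesis using mono[of "Suc i" i'] i that by (intro block_upd_other) auto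
      qed
      then show ?thesis using i by (intro ext) (simp add: g_def block_upd_same)
    qed
    have Bu: "B i ((block m i x)(k - m i := w)) \<in> carrier (Es ! i)" if "w \<in> carrier (Gs ! k)" for w
      using prod_carrier_upd[OF bl j] that nth by (intro Bi.closed) auto
    have Au: "A (g (x(k := w))) \<in> carrier F" if "w \<in> carrier (Gs ! k)" for w
      using g x k that by (intro Am.closed) (auto intro: prod_carrier_upd)
    have "A (g (x(k := a \<odot>\<^bsub>Gs ! k\<^esub> u))) = a \<odot>\<^bsub>F\<^esub> A (g (x(k := u)))"
      unfolding gu using Bi.map_smult[OF j bl, of u a] Am.map_smult[OF i(1) g[OF x] Bu[OF u], of a] u
      by (simp add: nth)
    then show "?f (x(k := a \<odot>\<^bsub>Gs ! k\<^esub> u)) = a \<odot>\<^bsub>H\<^esub> ?f (x(k := u))"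
      using t_bounded Au[OF u] by (simp add: bounded_linear_map_def)
    assume v: "v \<in> carrier (Gs ! k)"
    have "A (g (x(k := u \<oplus>\<^bsub>Gs ! k\<^esub> v))) = A (g (x(k := u))) \<oplus>\<^bsub>F\<^esub> A (g (x(k := v)))"
      unfolding gu using Bi.map_add[OF j bl, of u v] Am.map_add[OF i(1) g[OF x] Bu[OF u] Bu[OF v]] u v
      by (simp add: nth)
    then show "?f (x(k := u \<oplus>\<^bsub>Gs ! k\<^esub> v)) = ?f (x(k := u)) \<oplus>\<^bsub>H\<^esub> ?f (x(k := v))"
      using t_bounded Au[OF u] Au[OF v] by (simp add: bounded_linear_map_def)
  next
    show "?f x \<in> carrier H" if "x \<in> prod_carrier Gs" for x
      using t_bounded Am.closed[OF g[OF that]] by (simp add: bounded_linear_map_def)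
  qed (auto intro: banach_imp_normed H Gs)
  have comp: "compose_blocks m ?n Gs t A B = (\<lambda>x\<in>prod_carrier Gs. ?f x)"
    by (simp add: compose_blocks_eq g_def)
  \<comment> \<open>Membership among the summing operators includes continuity in the ordinary
    sense, obtained here from the ordinary operator norms.\<close>
  have ops: "compose_blocks m ?n Gs t A B \<in> multilinear_ops Gs H"
    unfolding comp
  proof (rule f.restrict_in_multilinear_ops)
    fix x assume x: "x \<in> prod_ball Gs"
    have gx: "g x \<in> prod_carrier Es" using g x by (simp add: prod_ball_subset)
    have "nrm H (?f x) \<le> linear_norm F H t * nrm F (A (g x))"
      using t_bounded Am.closed[OF gx] by (simp add: bounded_linear_map_def)
    also have "\<dots> \<le> linear_norm F H t * (multilinear_norm Es F A * (\<Prod>i<?n. ?b i))"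
    proof (rule mult_left_mono[OF _ t_nonneg])
      have "nrm F (A (g x)) \<le> multilinear_norm Es F A * (\<Prod>i<?n. nrm (Es ! i) (g x i))"
        using gx by (rule Am.nrm_le)
      also have "\<dots> \<le> multilinear_norm Es F A * (\<Prod>i<?n. ?b i)"
      proof (intro mult_left_mono prod_mono conjI Am.norm_nonneg)
        fix i assume "i \<in> {..<?n}"
        then have i: "i < ?n" by simp
        interpret Bi: continuous_multilinear_on "Es ! i" "?Gb i" "B i" using i by (rule Bm)
        show "0 \<le> nrm (Es ! i) (g x i)" using prod_carrier_nth[OF gx i] by (rule Bi.nrm_nonneg)
        show "nrm (Es ! i) (g x i) \<le> ?b i"
          using Bi.nrm_le_norm[OF block_prod_ball[of m i, OF le[OF i] x]] i by (simp add: g_def)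
      qed
      finally show "nrm F (A (g x)) \<le> multilinear_norm Es F A * (\<Prod>i<?n. ?b i)" .
    qed
    finally show "nrm H (?f x) \<le> linear_norm F H t * (multilinear_norm Es F A * (\<Prod>i<?n. ?b i))" .
  qed
  \<comment> \<open>The tuple at which the operator induced by \<open>A\<close> is evaluated;
    multilinear stability of \<open>X\<close> places its entries in the spaces
    \<open>X (Es ! i)\<close>.\<close>
  define \<sigma> where "\<sigma> s = (\<lambda>i\<in>{..<?n}. induced (length (?Gb i)) (B i) (block m i s))" for s :: "nat \<Rightarrow> nat \<Rightarrow> 'a"
  \<comment> \<open>Applying \<open>X\<close> commutes with cutting out a block of factors, so the
    lemmas on blocks apply to \<open>map X Gs\<close>.\<close>
  have map_Gb: "map X (?Gb i) = map ((!) (map X Gs)) [m i..<m (Suc i)]" if "i < ?n" for i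
    using le[OF that] by (auto simp: comp_def)
  have Bi: "continuous_multilinear_on (X (Es ! i)) (map ((!) (map X Gs)) [m i..<m (Suc i)]) (induced (length (?Gb i)) (B i))"
    and Bi_norm: "multilinear_norm (map ((!) (map X Gs)) [m i..<m (Suc i)]) (X (Es ! i)) (induced (length (?Gb i)) (B i)) = ?b i"
    if "i < ?n" for i
    using induced_X[OF Gb_ne[OF that] Gb[OF that] _ B[OF that]] Es that unfolding map_Gb[OF that] by auto
  have \<sigma>: "\<sigma> s \<in> prod_carrier (map X Es)" if s: "s \<in> prod_carrier (map X Gs)" for s
  proof -
    have "\<sigma> s i \<in> carrier (X (Es ! i))" if i: "i < ?n" for i
    proof -
      interpret Bi: continuous_multilinear_on "X (Es ! i)" "map ((!) (map X Gs)) [m i..<m (Suc i)]"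
        "induced (length (?Gb i)) (B i)" using i by (rule Bi)
      show ?thesis using Bi.closed[OF block_prod_carrier[of m i "map X Gs" s]] le[OF i] s i by (simp add: \<sigma>_def)
    qed
    then show ?thesis by (auto simp: prod_carrier_def PiE_iff \<sigma>_def)
  qed
  have ind: "C.ind (compose_blocks m ?n Gs t A B) s = (\<lambda>j. t (A.ind A (\<sigma> s) j))"
    if s: "s \<in> prod_carrier (map X Gs)" for s
  proof
    fix j
    \<comment> \<open>Cutting out a block commutes with taking \<open>j\<close>-th terms; hence
      composing and inducing commute coordinate by coordinate.\<close>
    have "block m i (\<lambda>k\<in>{..<length Gs}. s k j) = (\<lambda>k\<in>{..<length (?Gb i)}. block m i s k j)" if "i < ?n" for i
      using le[OF that] by (auto simp: block_def fun_eq_iff)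
    then have "g (\<lambda>k\<in>{..<length Gs}. s k j) = (\<lambda>i\<in>{..<?n}. \<sigma> s i j)"
      by (intro ext) (simp add: g_def \<sigma>_def induced_def)
    then show "C.ind (compose_blocks m ?n Gs t A B) s j = t (A.ind A (\<sigma> s) j)"
      using C.slice[OF s] by (simp add: comp induced_eq)
  qed
  show summing: "compose_blocks m ?n Gs t A B \<in> summing_ops X Y Gs H"
    using linear_Y(1)[OF F H t A.ind_closed[OF A \<sigma>]] by (intro C.H_I[OF ops]) (simp add: ind)
  show "summing_norm X Y Gs H (compose_blocks m ?n Gs t A B)
      \<le> linear_norm F H t * summing_norm X Y Es F A * (\<Prod>i<?n. ?b i)"
  proof (rule C.\<nu>_leI[OF summing])
    fix s assume s: "s \<in> prod_ball (map X Gs)"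
    then have s': "s \<in> prod_carrier (map X Gs)" by (rule prod_ball_subset)
    have "nrm (Y H) (C.ind (compose_blocks m ?n Gs t A B) s) \<le> linear_norm F H t * nrm (Y F) (A.ind A (\<sigma> s))"
      unfolding ind[OF s'] by (rule linear_Y(2)[OF F H t A.ind_closed[OF A \<sigma>[OF s']]])
    also have "\<dots> \<le> linear_norm F H t * (A.\<nu> A * (\<Prod>i<?n. ?b i))"
    proof (rule mult_left_mono[OF _ t_nonneg])
      have "nrm (Y F) (A.ind A (\<sigma> s)) \<le> A.\<nu> A * (\<Prod>i<?n. nrm (X (Es ! i)) (\<sigma> s i))"
        using A \<sigma>[OF s'] by (rule A.nrm_ind_le)
      also have "\<dots> \<le> A.\<nu> A * (\<Prod>i<?n. ?b i)"
      proof (intro mult_left_mono prod_mono conjI A.\<nu>_nonneg A)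
        fix i assume "i \<in> {..<?n}"
        then have i: "i < ?n" by simp
        interpret Bi: continuous_multilinear_on "X (Es ! i)" "map ((!) (map X Gs)) [m i..<m (Suc i)]"
          "induced (length (?Gb i)) (B i)" using i by (rule Bi)
        show "0 \<le> nrm (X (Es ! i)) (\<sigma> s i)"
          using prod_carrier_nth[OF \<sigma>[OF s'], of i] i by (intro Bi.nrm_nonneg) simp
        show "nrm (X (Es ! i)) (\<sigma> s i) \<le> ?b i"
          using Bi.nrm_le_norm[OF block_prod_ball[of m i "map X Gs" s]] le[OF i] s i
          unfolding Bi_norm[OF i] by (simp add: \<sigma>_def)
      qed
      finally show "nrm (Y F) (A.ind A (\<sigma> s)) \<le> A.\<nu> A * (\<Prod>i<?n. ?b i)" .
    qed
    finally show "nrm (Y H) (C.ind (compose_blocks m ?n Gs t A B) s)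
        \<le> linear_norm F H t * summing_norm X Y Es F A * (\<Prod>i<?n. ?b i)" by (simp add: mult.assoc)
  qed
qed

theorem theorem2p3:
  fixes \<iota> :: "'k::real_or_complex \<Rightarrow> 'a"
    and X Y :: "('k, 'a) nspace \<Rightarrow> ('k, nat \<Rightarrow> 'a) nspace"
  assumes "inj \<iota>"
    and "sequence_class \<iota> X" and "sequence_class \<iota> Y"
    and "multilinearly_stable X"
    and "linearly_stable Y"
    and "\<And>n::nat. n \<ge> 1 \<Longrightarrow> power_embeds \<iota> n X Y"
  shows "banach_hyper_ideal \<iota> (summing_ops X Y) (summing_norm X Y)"
proof -
  interpret summing_pair \<iota> X Y using assms by unfold_locales
  show ?thesis
    unfolding banach_hyper_ideal_def
  proof (intro conjI allI impI)
    fix Es :: "('k, 'a) nspace list" and F :: "('k, 'a) nspace"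
    assume *: "Es \<noteq> [] \<and> (\<forall>E\<in>set Es. banach_space E) \<and> banach_space F"
    then interpret F: seq_space_on F "Y F" using seq_Y by (intro sequence_class_space) auto
    interpret summing_component \<iota> X Y F Es using * by unfold_locales auto
    show "submodule H scalar_ring L" by (rule H_submodule)
    show "finite_type_ops Es F \<subseteq> H" by (rule H_finite_type)
    show "banach_space R" by (rule R_banach)
  next
    show "summing_norm X Y (replicate n K) K (scalar_mult_op \<iota> n) = 1" if "1 \<le> n" for n
      using that by (rule norm_scalar_mult_op)
  next
    fix n m and Gs Es :: "('k, 'a) nspace list" and F H :: "('k, 'a) nspace" and A B t
    assume n: "1 \<le> n" and *: "m 0 = 0 \<and> (\<forall>i<n. m i < m (Suc i)) \<and> length Gs = m n \<and> length Es = n \<and>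
      (\<forall>G\<in>set Gs. banach_space G) \<and> (\<forall>E\<in>set Es. banach_space E) \<and>
      banach_space F \<and> banach_space H \<and> A \<in> summing_ops X Y Es F \<and>
      (\<forall>i<n. B i \<in> multilinear_ops (map ((!) Gs) [m i..<m (Suc i)]) (Es ! i)) \<and> t \<in> linear_ops F H"
    then have len: "length Es = n" by simp
    note comp = compose_blocks_summing[of m Es Gs F H A B t, unfolded len]
    show "compose_blocks m n Gs t A B \<in> summing_ops X Y Gs H"
      using n * by (intro comp(1)) auto
    show "summing_norm X Y Gs H (compose_blocks m n Gs t A B)
        \<le> linear_norm F H t * summing_norm X Y Es F A
          * (\<Prod>i<n. multilinear_norm (map ((!) Gs) [m i..<m (Suc i)]) (Es ! i) (B i))"
      using n * by (intro comp(2)) auto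
  qed
qed

end
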